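(* There are group isomorphisms, for the models defined in the context: $$\mathrm{Alt}_5\cong\mathrm{PSL}_2(4)\cong\mathrm{PSL}_2(5),\qquad \mathrm{PSL}_2(7)\cong\mathrm{PSL}_3(2),$$ $$\mathrm{Alt}_6\cong\mathrm{PSL}_2(9)\cong B_2(2)'\cong C_2(2)',\qquad \mathrm{Alt}_8\cong\mathrm{PSL}_4(2),\qquad B_2(3)\cong C_2(3),$$ and $B_2(2)\cong\mathrm{Sym}_6$, where a prime denotes the derived subgroup.
   Context: $\mathrm{Alt}_n$ and $\mathrm{Sym}_n$ are the alternating and symmetric groups of degree $n$. $\mathrm{PSL}_n(q)=\mathrm{SL}_n(\mathbb F_q)/Z(\mathrm{SL}_n(\mathbb F_q))$. $C_r(q)=\mathrm{PSp}_{2r}(q)=\mathrm{Sp}_{2r}(\mathbb F_q)/Z(\mathrm{Sp}_{2r}(\mathbb F_q))$. $B_r(q)$ is the group generated by all Siegel transformations of the quadratic form $Q(x,y,z)=\sum_{i=1}^r x_iy_i+z^2$ on $\mathbb F_q^{2r+1}$, divided by its subgroup of scalar transformations. With polar form $B(x,y)=Q(x+y)-Q(x)-Q(y)$, a Siegel transformation is a map $x\mapsto x+B(x,u)w-B(x,w)u-Q(w)B(x,u)u$, where $u\ne0$, $Q(u)=0$, $B(u,w)=0$. *)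

theory Defs
  imports
    "HOL-Algebra.Sym_Groups"
    "HOL-Algebra.Bij"
    "Jordan_Normal_Form.Determinant"
begin

definition group_center :: "('a, 'b) monoid_scheme \<Rightarrow> 'a set" where
  "group_center G =
     {z \<in> carrier G. \<forall>g \<in> carrier G. z \<otimes>\<^bsub>G\<^esub> g = g \<otimes>\<^bsub>G\<^esub> z}"

definition derived_subgroup :: "'a monoid \<Rightarrow> 'a monoid" where
  "derived_subgroup G = G \<lparr> carrier := derived G (carrier G) \<rparr>"


text \<open>The ground field is the type argument: the field with \<open>q\<close> elements is rendered
  as an arbitrary type of class \<^class>\<open>field\<close> with exactly \<open>q\<close> elements.\<close>

definition SL :: "nat \<Rightarrow> 'a::field itself \<Rightarrow> 'a mat monoid" where
  "SL n _ =
     \<lparr> carrier = {A \<in> carrier_mat n n. det A = 1}, mult = (*), one = 1\<^sub>m n \<rparr>"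

definition PSL :: "nat \<Rightarrow> 'a::field itself \<Rightarrow> 'a mat set monoid" where
  "PSL n F = SL n F Mod group_center (SL n F)"

text \<open>Gram matrix of the standard alternating form
  \<open>\<Sum>i<r. x $ i * y $ (r + i) - x $ (r + i) * y $ i\<close> on dimension \<open>2 * r\<close>
  (alternating in characteristic 2 as well).\<close>

definition symplectic_form_mat :: "nat \<Rightarrow> 'a::field mat" where
  "symplectic_form_mat r =
     four_block_mat (0\<^sub>m r r) (1\<^sub>m r) (- 1\<^sub>m r) (0\<^sub>m r r)"

definition Sp :: "nat \<Rightarrow> 'a::field itself \<Rightarrow> 'a mat monoid" where
  "Sp r _ =
     \<lparr> carrier = {A \<in> carrier_mat (2 * r) (2 * r).
         transpose_mat A * symplectic_form_mat r * A = symplectic_form_mat r},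
       mult = (*), one = 1\<^sub>m (2 * r) \<rparr>"

definition type_C :: "nat \<Rightarrow> 'a::field itself \<Rightarrow> 'a mat set monoid" where
  "type_C r F = Sp r F Mod group_center (Sp r F)"


text \<open>A vector \<open>v\<close> of dimension \<open>2 * r + 1\<close> holds \<open>x\<close> in positions
  \<open>0, \<dots>, r - 1\<close>, \<open>y\<close> in positions \<open>r, \<dots>, 2 * r - 1\<close>
  and \<open>z\<close> in position \<open>2 * r\<close>.\<close>

definition quad_form :: "nat \<Rightarrow> 'a::field vec \<Rightarrow> 'a" where
  "quad_form r v = (\<Sum>i<r. v $ i * v $ (r + i)) + (v $ (2 * r))\<^sup>2"

definition polar_form :: "nat \<Rightarrow> 'a::field vec \<Rightarrow> 'a vec \<Rightarrow> 'a" where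
  "polar_form r x y = quad_form r (x + y) - quad_form r x - quad_form r y"

text \<open>Transformations of the space are extensional functions, as required by
  \<^const>\<open>BijGroup\<close>.\<close>

definition siegel :: "nat \<Rightarrow> 'a::field vec \<Rightarrow> 'a vec \<Rightarrow> 'a vec \<Rightarrow> 'a vec" where
  "siegel r u w = (\<lambda>x \<in> carrier_vec (2 * r + 1).
     x + polar_form r x u \<cdot>\<^sub>v w - polar_form r x w \<cdot>\<^sub>v u
       - (quad_form r w * polar_form r x u) \<cdot>\<^sub>v u)"

definition siegel_set :: "nat \<Rightarrow> ('a::field vec \<Rightarrow> 'a vec) set" where
  "siegel_set r =
     {siegel r u w | u w. u \<in> carrier_vec (2 * r + 1) \<and> w \<in> carrier_vec (2 * r + 1) \<and>
        u \<noteq> 0\<^sub>v (2 * r + 1) \<and> quad_form r u = 0 \<and> polar_form r u w = 0}"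

definition siegel_group :: "nat \<Rightarrow> 'a::field itself \<Rightarrow> ('a vec \<Rightarrow> 'a vec) monoid" where
  "siegel_group r _ = (BijGroup (carrier_vec (2 * r + 1)))
     \<lparr> carrier := generate (BijGroup (carrier_vec (2 * r + 1))) (siegel_set r) \<rparr>"

definition scalar_maps :: "nat \<Rightarrow> ('a::field vec \<Rightarrow> 'a vec) set" where
  "scalar_maps n = {(\<lambda>x \<in> carrier_vec n. c \<cdot>\<^sub>v x) | c. True}"

definition type_B :: "nat \<Rightarrow> 'a::field itself \<Rightarrow> ('a vec \<Rightarrow> 'a vec) set monoid" where
  "type_B r F =
     siegel_group r F Mod (carrier (siegel_group r F) \<inter> scalar_maps (2 * r + 1))"

end

theory Submission
  imports Defs "HOL-Number_Theory.Residues"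
begin

text \<open>All isomorphisms come from Goursat's lemma: a subgroup \<open>R\<close> of \<open>G \<times> H\<close> projecting onto both factors
  induces \<open>G / N \<cong> H / M\<close>, where \<open>N\<close> and \<open>M\<close> consist of the elements related to \<open>1\<close>. Here \<open>R\<close> consists of
  the pairs acting compatibly on a common configuration, so that surjectivity only requires a partner
  for each generator of \<open>G\<close> and of \<open>H\<close>, and no group order is ever computed.

  For a matrix group and \<open>Alt\<^sub>n\<close> or \<open>Sym\<^sub>n\<close> the configuration is a set of \<open>n\<close> matrices \<open>b\<^sub>i\<close>, and \<open>R\<close> consists of the
  \<open>(g, p)\<close> such that \<open>g (b\<^sub>i - b\<^sub>j) g\<^sup>* = b\<^bsub>p i\<^esub> - b\<^bsub>p j\<^esub>\<close> for all \<open>i, j\<close>. This realises the classical identifications of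
  the module of \<open>Alt\<^sub>n\<close> on vectors of sum zero with a space of Hermitian, symmetric or alternating matrices.
  For types \<open>B\<^sub>2\<close> and \<open>C\<^sub>2\<close>, over any field, the configuration is the five-dimensional submodule of the exterior
  square of the symplectic space: unipotent elements of the two opposite Siegel parabolic subgroups act
  on it as Siegel transformations, and every Siegel transformation is conjugate to one of these.\<close>

section \<open>Isomorphisms from compatible actions\<close>

text \<open>Linear maps fix 0 while permutations move every vertex, so one vertex is placed at 0 and
  only differences of vertices are compared. The identity matrix is then related to every
  permutation that acts as a translation of the simplex, and each case has to rule these out. This
  is a real issue: for \<open>Alt_5\<close> with q = 5, \<open>Alt_6\<close> with q = 9 and
  \<open>Alt_8\<close> with q = 2 the characteristic divides the degree, the vertices add up to 0,
  and the matrix space is the module of sum-zero vectors modulo the constants. For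
  \<open>Sym_6\<close> the characteristic divides the degree too, but the five-dimensional module is
  kept whole, and the vertices add up to the Gram matrix of the symplectic form. The eight matrices
  used for \<open>Alt_8\<close> are a Kerdock set, and six of them serve for \<open>Sym_6\<close>.
  For types B and C the exterior square is treated through generators because in characteristic 2
  the polar form has a radical; the arguments rely on the quadratic form itself, not on
  nondegeneracy or division by 2.\<close>

lemma goursat_normal:
  assumes G: "group G" and H: "group H" and R: "subgroup R (G \<times>\<times> H)"
    and fst: "fst ` R = carrier G" and snd: "snd ` R = carrier H"
  shows "{g. (g, \<one>\<^bsub>H\<^esub>) \<in> R} \<lhd> G" "{h. (\<one>\<^bsub>G\<^esub>, h) \<in> R} \<lhd> H"
proof -
  interpret G: group G by fact
  interpret H: group H by fact
  interpret R: subgroup R "G \<times>\<times> H" by fact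
  define N where "N = {g. (g, \<one>\<^bsub>H\<^esub>) \<in> R}"
  define M where "M = {h. (\<one>\<^bsub>G\<^esub>, h) \<in> R}"
  have car: "g \<in> carrier G" "h \<in> carrier H" if "(g, h) \<in> R" for g h
    using R.subset that by (auto simp: DirProd_def)
  have mul: "(g \<otimes>\<^bsub>G\<^esub> g', h \<otimes>\<^bsub>H\<^esub> h') \<in> R" if "(g, h) \<in> R" "(g', h') \<in> R" for g h g' h'
    using R.m_closed[OF that] by (simp add: DirProd_def)
  have inv: "(inv\<^bsub>G\<^esub> g, inv\<^bsub>H\<^esub> h) \<in> R" if "(g, h) \<in> R" for g h
    using R.m_inv_closed[OF that] car[OF that] by (simp add: inv_DirProd[OF G H])
  have one: "(\<one>\<^bsub>G\<^esub>, \<one>\<^bsub>H\<^esub>) \<in> R" using R.one_closed by (simp add: DirProd_def)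
  have exG: "\<exists>h. (g, h) \<in> R" if "g \<in> carrier G" for g using that fst by force
  have exH: "\<exists>g. (g, h) \<in> R" if "h \<in> carrier H" for h using that snd by force
  have sN: "subgroup N G"
  proof (rule G.subgroupI)
    show "N \<subseteq> carrier G" using car by (auto simp: N_def)
    show "N \<noteq> {}" using one by (auto simp: N_def)
    show "inv\<^bsub>G\<^esub> a \<in> N" if "a \<in> N" for a using inv[of a "\<one>\<^bsub>H\<^esub>"] that by (simp add: N_def)
    show "a \<otimes>\<^bsub>G\<^esub> b \<in> N" if "a \<in> N" "b \<in> N" for a b
      using mul[of a "\<one>\<^bsub>H\<^esub>" b "\<one>\<^bsub>H\<^esub>"] that by (simp add: N_def)
  qed
  have nN: "N \<lhd> G"
    unfolding G.normal_inv_iff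
  proof (intro conjI sN ballI)
    fix x n assume x: "x \<in> carrier G" and n: "n \<in> N"
    \<comment> \<open>Surjectivity onto \<open>G\<close> provides some partner of \<open>x\<close>;
      conjugating \<open>(n, 1)\<close> by the pair leaves the second component 1.\<close>
    obtain h where h: "(x, h) \<in> R" using exG[OF x] ..
    show "x \<otimes>\<^bsub>G\<^esub> n \<otimes>\<^bsub>G\<^esub> inv\<^bsub>G\<^esub> x \<in> N"
      using mul[OF mul[OF h] inv[OF h], of n "\<one>\<^bsub>H\<^esub>"] n car[OF h] by (simp add: N_def)
  qed
  have sM: "subgroup M H"
  proof (rule H.subgroupI)
    show "M \<subseteq> carrier H" using car by (auto simp: M_def)
    show "M \<noteq> {}" using one by (auto simp: M_def)
    show "inv\<^bsub>H\<^esub> a \<in> M" if "a \<in> M" for a using inv[of "\<one>\<^bsub>G\<^esub>" a] that by (simp add: M_def)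
    show "a \<otimes>\<^bsub>H\<^esub> b \<in> M" if "a \<in> M" "b \<in> M" for a b
      using mul[of "\<one>\<^bsub>G\<^esub>" a "\<one>\<^bsub>G\<^esub>" b] that by (simp add: M_def)
  qed
  have nM: "M \<lhd> H"
    unfolding H.normal_inv_iff
  proof (intro conjI sM ballI)
    fix x n assume x: "x \<in> carrier H" and n: "n \<in> M"
    obtain h where h: "(h, x) \<in> R" using exH[OF x] ..
    show "x \<otimes>\<^bsub>H\<^esub> n \<otimes>\<^bsub>H\<^esub> inv\<^bsub>H\<^esub> x \<in> M"
      using mul[OF mul[OF h] inv[OF h], of "\<one>\<^bsub>G\<^esub>" n] n car[OF h] by (simp add: M_def)
  qed
  show "{g. (g, \<one>\<^bsub>H\<^esub>) \<in> R} \<lhd> G" "{h. (\<one>\<^bsub>G\<^esub>, h) \<in> R} \<lhd> H"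
    using nN nM unfolding N_def M_def .
qed

text \<open>Both quotients are \<open>R\<close> modulo one and the same kernel: for
  \<open>(g, h)\<close> in \<open>R\<close>, multiplying by \<open>(inv g, 1)\<close> or
  \<open>(1, inv h)\<close> shows that \<open>g\<close> lies in \<open>N\<close> exactly when
  \<open>h\<close> lies in \<open>M\<close>.\<close>

lemma goursat_iso:
  assumes G: "group G" and H: "group H" and R: "subgroup R (G \<times>\<times> H)"
    and fst: "fst ` R = carrier G" and snd: "snd ` R = carrier H"
  shows "G Mod {g. (g, \<one>\<^bsub>H\<^esub>) \<in> R} \<cong> H Mod {h. (\<one>\<^bsub>G\<^esub>, h) \<in> R}"
proof -
  interpret G: group G by fact
  interpret H: group H by fact
  interpret P: group "G \<times>\<times> H" using G H by (rule DirProd_group)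
  interpret R: subgroup R "G \<times>\<times> H" by fact
  define N where "N = {g. (g, \<one>\<^bsub>H\<^esub>) \<in> R}"
  define M where "M = {h. (\<one>\<^bsub>G\<^esub>, h) \<in> R}"
  let ?R = "(G \<times>\<times> H) \<lparr>carrier := R\<rparr>"
  have gR: "group ?R" by (rule P.subgroup_imp_group[OF R])
  have car: "g \<in> carrier G" "h \<in> carrier H" if "(g, h) \<in> R" for g h
    using R.subset that by (auto simp: DirProd_def)
  have mul: "(g \<otimes>\<^bsub>G\<^esub> g', h \<otimes>\<^bsub>H\<^esub> h') \<in> R" if "(g, h) \<in> R" "(g', h') \<in> R" for g h g' h'
    using R.m_closed[OF that] by (simp add: DirProd_def)
  have inv: "(inv\<^bsub>G\<^esub> g, inv\<^bsub>H\<^esub> h) \<in> R" if "(g, h) \<in> R" for g h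
    using R.m_inv_closed[OF that] car[OF that] by (simp add: inv_DirProd[OF G H])
  have nN: "N \<lhd> G" and nM: "M \<lhd> H"
    using goursat_normal[OF G H R fst snd] unfolding N_def M_def .
  note sN = normal_imp_subgroup[OF nN] and sM = normal_imp_subgroup[OF nM]
  let ?f = "\<lambda>r. N #>\<^bsub>G\<^esub> fst r" and ?k = "\<lambda>r. M #>\<^bsub>H\<^esub> snd r"
  have homf: "group_hom ?R (G Mod N) ?f"
    using gR normal.factorgroup_is_group[OF nN] car
    by (auto intro!: group_hom.intro homI simp: group_hom_axioms_def carrier_FactGroup
        normal.rcos_sum[OF nN] DirProd_def)
  have homk: "group_hom ?R (H Mod M) ?k"
    using gR normal.factorgroup_is_group[OF nM] car
    by (auto intro!: group_hom.intro homI simp: group_hom_axioms_def carrier_FactGroup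
        normal.rcos_sum[OF nM] DirProd_def)
  have surjf: "?f ` carrier ?R = carrier (G Mod N)"
    by (simp add: carrier_FactGroup fst[symmetric] image_image)
  have surjk: "?k ` carrier ?R = carrier (H Mod M)"
    by (simp add: carrier_FactGroup snd[symmetric] image_image)
  have fN: "?f (g, h) = N \<longleftrightarrow> h \<in> M" if "(g, h) \<in> R" for g h
  proof -
    have "?f (g, h) = N \<longleftrightarrow> g \<in> N"
      using G.coset_join1 G.coset_join2 sN car[OF that] by (metis fst_conv)
    also have "\<dots> \<longleftrightarrow> h \<in> M"
    proof
      assume "g \<in> N"
      then have "(inv\<^bsub>G\<^esub> g, \<one>\<^bsub>H\<^esub>) \<in> R" using inv[of g "\<one>\<^bsub>H\<^esub>"] by (simp add: N_def)
      from mul[OF this that] show "h \<in> M" using car[OF that] by (simp add: M_def)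
    next
      assume "h \<in> M"
      then have "(\<one>\<^bsub>G\<^esub>, inv\<^bsub>H\<^esub> h) \<in> R" using inv[of "\<one>\<^bsub>G\<^esub>" h] by (simp add: M_def)
      from mul[OF this that] show "g \<in> N" using car[OF that] by (simp add: N_def)
    qed
    finally show ?thesis .
  qed
  have kM: "?k (g, h) = M \<longleftrightarrow> h \<in> M" if "(g, h) \<in> R" for g h
    using H.coset_join1 H.coset_join2 sM car[OF that] by (metis snd_conv)
  have ker: "kernel ?R (G Mod N) ?f = kernel ?R (H Mod M) ?k"
    unfolding kernel_def by (rule Collect_cong) (use fN kM in \<open>force simp del: fst_conv snd_conv\<close>)
  have i1: "?R Mod kernel ?R (G Mod N) ?f \<cong> G Mod N"
    by (rule group_hom.FactGroup_iso[OF homf surjf])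
  have i2: "?R Mod kernel ?R (G Mod N) ?f \<cong> H Mod M"
    unfolding ker by (rule group_hom.FactGroup_iso[OF homk surjk])
  have "group (?R Mod kernel ?R (G Mod N) ?f)"
    by (intro normal.factorgroup_is_group group_hom.normal_kernel[OF homf])
  then show ?thesis
    using i1 i2 group.iso_sym iso_trans unfolding N_def M_def by blast
qed

text \<open>The projections of \<open>R\<close> are subgroups, so they are everything once they
  contain generators; partners of different generators need no relation to each other.\<close>

lemma generated_projections:
  assumes G: "group G" and H: "group H" and R: "subgroup R (G \<times>\<times> H)"
    and S: "carrier G = generate G S" "\<And>s. s \<in> S \<Longrightarrow> \<exists>h. (s, h) \<in> R"
    and T: "carrier H = generate H T" "\<And>t. t \<in> T \<Longrightarrow> \<exists>g. (g, t) \<in> R"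
  shows "fst ` R = carrier G" "snd ` R = carrier H"
proof -
  interpret G: group G by fact
  interpret H: group H by fact
  interpret P: group "G \<times>\<times> H" using G H by (rule DirProd_group)
  have hf: "group_hom (G \<times>\<times> H) G fst" and hs: "group_hom (G \<times>\<times> H) H snd"
    by unfold_locales (auto simp: hom_def DirProd_def)
  have sub: "subgroup (fst ` R) G" "subgroup (snd ` R) H"
    using group_hom.subgroup_img_is_subgroup[OF hf R] group_hom.subgroup_img_is_subgroup[OF hs R] .
  have "S \<subseteq> fst ` R" "T \<subseteq> snd ` R" using S(2) T(2) by force+
  then have "generate G S \<subseteq> fst ` R" "generate H T \<subseteq> snd ` R"
    using G.generate_subgroup_incl H.generate_subgroup_incl sub by auto
  then show "fst ` R = carrier G" "snd ` R = carrier H"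
    using subgroup.subset[OF sub(1)] subgroup.subset[OF sub(2)] S(1) T(1) by auto
qed

text \<open>Goursat's lemma when \<open>H\<close> acts faithfully on the configuration, as
  permutation groups do here; dividing by the trivial subgroup returns \<open>H\<close>.\<close>

lemma quotient_iso_of_relation:
  assumes G: "group G" and H: "group H" and R: "subgroup R (G \<times>\<times> H)"
    and S: "carrier G = generate G S" "\<And>s. s \<in> S \<Longrightarrow> \<exists>h. (s, h) \<in> R"
    and T: "carrier H = generate H T" "\<And>t. t \<in> T \<Longrightarrow> \<exists>g. (g, t) \<in> R"
    and N: "\<And>g. (g, \<one>\<^bsub>H\<^esub>) \<in> R \<longleftrightarrow> g \<in> N"
    and M: "\<And>h. (\<one>\<^bsub>G\<^esub>, h) \<in> R \<Longrightarrow> h = \<one>\<^bsub>H\<^esub>"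
  shows "G Mod N \<cong> H"
proof -
  have "(\<one>\<^bsub>G\<^esub>, \<one>\<^bsub>H\<^esub>) \<in> R" using subgroup.one_closed[OF R] by simp
  then have M': "{h. (\<one>\<^bsub>G\<^esub>, h) \<in> R} = {\<one>\<^bsub>H\<^esub>}" by (blast dest: M)
  have N': "{g. (g, \<one>\<^bsub>H\<^esub>) \<in> R} = N" using N by auto
  have proj: "fst ` R = carrier G" "snd ` R = carrier H"
    by (rule generated_projections[OF G H R, of S T]; use S T in blast)+
  have "G Mod N \<cong> H Mod {\<one>\<^bsub>H\<^esub>}"
    using goursat_iso[OF G H R proj] unfolding M' N' .
  then show ?thesis by (rule iso_trans[OF _ is_isoI[OF group.trivial_factor_iso[OF H]]])
qed

text \<open>The labelling \<open>d\<close> need not be injective. Labels may therefore be pairs of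
  vertices carrying their differences, where all pairs \<open>(i, i)\<close> carry 0.\<close>

definition intertwiners ::
  "('g, 'm) monoid_scheme \<Rightarrow> ('h, 'n) monoid_scheme \<Rightarrow> ('g \<Rightarrow> 'v \<Rightarrow> 'v) \<Rightarrow> ('h \<Rightarrow> 'i \<Rightarrow> 'i) \<Rightarrow>
    'i set \<Rightarrow> ('i \<Rightarrow> 'v) \<Rightarrow> ('g \<times> 'h) set" where
  "intertwiners G H \<phi> \<alpha> I d =
     {(g, h). g \<in> carrier G \<and> h \<in> carrier H \<and> (\<forall>i\<in>I. \<phi> g (d i) = d (\<alpha> h i))}"

lemma subgroup_intertwiners:
  assumes G: "group G" and H: "group H"
    and d: "\<And>i. i \<in> I \<Longrightarrow> d i \<in> V"
    and \<phi>1: "\<And>x. x \<in> V \<Longrightarrow> \<phi> \<one>\<^bsub>G\<^esub> x = x"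
    and \<phi>m: "\<And>g g' x. g \<in> carrier G \<Longrightarrow> g' \<in> carrier G \<Longrightarrow> x \<in> V \<Longrightarrow>
               \<phi> (g \<otimes>\<^bsub>G\<^esub> g') x = \<phi> g (\<phi> g' x)"
    and \<alpha>I: "\<And>h i. h \<in> carrier H \<Longrightarrow> i \<in> I \<Longrightarrow> \<alpha> h i \<in> I"
    and \<alpha>1: "\<And>i. i \<in> I \<Longrightarrow> \<alpha> \<one>\<^bsub>H\<^esub> i = i"
    and \<alpha>m: "\<And>h h' i. h \<in> carrier H \<Longrightarrow> h' \<in> carrier H \<Longrightarrow> i \<in> I \<Longrightarrow>
               \<alpha> (h \<otimes>\<^bsub>H\<^esub> h') i = \<alpha> h (\<alpha> h' i)"
  shows "subgroup (intertwiners G H \<phi> \<alpha> I d) (G \<times>\<times> H)"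
proof -
  interpret G: group G by fact
  interpret H: group H by fact
  interpret P: group "G \<times>\<times> H" using G H by (rule DirProd_group)
  have inv: "\<phi> (inv\<^bsub>G\<^esub> g) (d i) = d (\<alpha> (inv\<^bsub>H\<^esub> h) i)"
    if g: "g \<in> carrier G" and h: "h \<in> carrier H" and R: "\<And>i. i \<in> I \<Longrightarrow> \<phi> g (d i) = d (\<alpha> h i)"
      and i: "i \<in> I" for g h i
  proof -
    \<comment> \<open>The relation for \<open>(g, h)\<close> at the label \<open>?j\<close> becomes,
      after applying the inverse of \<open>g\<close>, the relation for the inverses at
      \<open>i\<close>.\<close>
    let ?j = "\<alpha> (inv\<^bsub>H\<^esub> h) i"
    have j: "?j \<in> I" and hj: "\<alpha> h ?j = i"
      using \<alpha>m[of h "inv\<^bsub>H\<^esub> h" i] h i by (auto simp: \<alpha>I \<alpha>1)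
    have "\<phi> (inv\<^bsub>G\<^esub> g) (d i) = \<phi> (inv\<^bsub>G\<^esub> g) (\<phi> g (d ?j))" using R[OF j] hj by simp
    also have "\<dots> = d ?j" using \<phi>m[of "inv\<^bsub>G\<^esub> g" g "d ?j"] g j by (simp add: d \<phi>1)
    finally show ?thesis .
  qed
  show ?thesis
  proof (rule P.subgroupI)
    have "(\<one>\<^bsub>G\<^esub>, \<one>\<^bsub>H\<^esub>) \<in> intertwiners G H \<phi> \<alpha> I d"
      by (simp add: intertwiners_def \<phi>1 \<alpha>1 d)
    then show "intertwiners G H \<phi> \<alpha> I d \<noteq> {}" by blast
  qed (auto simp: intertwiners_def inv_DirProd[OF G H] \<phi>m \<alpha>m \<alpha>I d inv)
qed

section \<open>Derived subgroups and centres\<close>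

lemma derived_subgroup_iso:
  assumes G: "group G" and H: "group H" and iso: "G \<cong> H"
  shows "derived_subgroup G \<cong> derived_subgroup H"
proof -
  obtain f where f: "f \<in> iso G H" using iso by (auto simp: is_iso_def)
  then have hom: "group_hom G H f" and bij: "bij_betw f (carrier G) (carrier H)"
    using G H by (auto simp: group_hom_def group_hom_axioms_def iso_def)
  interpret group_hom G H f by fact
  have img: "f ` derived G (carrier G) = derived H (carrier H)"
    using derived_img[of "carrier G"] bij by (simp add: bij_betw_def)
  have sub: "derived G (carrier G) \<subseteq> carrier G"
    using G.derived_in_carrier by simp
  have "f \<in> iso (derived_subgroup G) (derived_subgroup H)"
    using img sub bij hom_mult unfolding iso_def hom_def derived_subgroup_def bij_betw_def
    by (auto intro: inj_on_subset simp: subset_iff)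
  then show ?thesis by (auto simp: is_iso_def)
qed

lemma normal_group_center:
  fixes G (structure)
  assumes "group G" shows "group_center G \<lhd> G"
proof -
  interpret group G by fact
  have comm: "z \<in> carrier G" "\<And>g. g \<in> carrier G \<Longrightarrow> z \<otimes> g = g \<otimes> z" if "z \<in> group_center G" for z
    using that by (simp_all add: group_center_def)
  have "subgroup (group_center G) G"
  proof (rule subgroupI)
    fix a assume a: "a \<in> group_center G"
    have "inv a \<otimes> g = g \<otimes> inv a" if g: "g \<in> carrier G" for g
      using arg_cong[OF comm(2)[OF a, of "inv g"], of "m_inv G"] comm(1)[OF a] g
      by (simp add: inv_mult_group)
    then show "inv a \<in> group_center G" using comm(1)[OF a] by (simp add: group_center_def)
    fix b assume b: "b \<in> group_center G"
    have "a \<otimes> b \<otimes> g = g \<otimes> (a \<otimes> b)" if g: "g \<in> carrier G" for g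
    proof -
      have c: "a \<in> carrier G" "b \<in> carrier G" using comm(1) a b by blast+
      have "a \<otimes> b \<otimes> g = a \<otimes> (b \<otimes> g)" using c g by (simp add: m_assoc)
      also have "\<dots> = a \<otimes> (g \<otimes> b)" by (simp only: comm(2)[OF b g])
      also have "\<dots> = a \<otimes> g \<otimes> b" using c g by (simp add: m_assoc)
      also have "\<dots> = g \<otimes> a \<otimes> b" by (simp only: comm(2)[OF a g])
      finally show ?thesis using c g by (simp add: m_assoc)
    qed
    then show "a \<otimes> b \<in> group_center G"
      using comm(1)[OF a] comm(1)[OF b] by (simp add: group_center_def)
  qed (auto simp: group_center_def)
  moreover have "x \<otimes> z \<otimes> inv x = z" if x: "x \<in> carrier G" and z: "z \<in> group_center G" for x z
  proof -
    have "x \<otimes> z \<otimes> inv x = z \<otimes> x \<otimes> inv x" by (simp only: comm(2)[OF z x])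
    also have "\<dots> = z" using comm(1)[OF z] x by (simp add: m_assoc)
    finally show ?thesis .
  qed
  ultimately show ?thesis unfolding normal_inv_iff by simp
qed

section \<open>Special linear groups and explicit matrices\<close>

lemma SL_simps [simp]:
  "carrier (SL n F) = {A \<in> carrier_mat n n. det A = 1}"
  "mult (SL n F) = (*)" "one (SL n F) = 1\<^sub>m n"
  by (simp_all add: SL_def)

lemma group_SL: "group (SL n TYPE('a::field))"
proof (rule groupI)
  fix A assume A: "A \<in> carrier (SL n TYPE('a))"
  then have "adj_mat A * A = 1\<^sub>m n" "adj_mat A \<in> carrier_mat n n"
    using adj_mat[of A n] by auto
  moreover from this have "det (adj_mat A) = 1"
    using A det_mult[of "adj_mat A" n A] by simp
  ultimately show "\<exists>B\<in>carrier (SL n TYPE('a)). B \<otimes>\<^bsub>SL n TYPE('a)\<^esub> A = \<one>\<^bsub>SL n TYPE('a)\<^esub>"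
    by auto
qed (auto simp: det_mult)

lemma addrow_in_SL:
  assumes "A \<in> carrier (SL n TYPE('a::field))" "k < n" "l < n" "k \<noteq> l"
  shows "addrow a k l A \<in> carrier (SL n TYPE('a))"
  using assms det_addrow[of l n k A a] by auto

lemma addrow_mat_in_SL:
  assumes "k < n" "l < n" "k \<noteq> l"
  shows "addrow_mat n a k l \<in> carrier (SL n TYPE('a::field))"
  using assms by (auto simp: det_addrow_mat)

section \<open>Generation of special linear groups by transvections\<close>

definition elementary_mats :: "nat \<Rightarrow> 'a::field set \<Rightarrow> 'a mat set" where
  "elementary_mats n S = {addrow_mat n a k l | a k l. a \<in> S \<and> k < n \<and> l < n \<and> k \<noteq> l}"

text \<open>Elimination by row operations, column after column. A pivot is made 1 by adding a
  multiple of a lower row with nonzero entry, so neither row exchanges nor diagonal matrices occur.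
  Only the last column has no row below, and there the determinant forces the pivot to be 1.\<close>

lemma SL_generated_by_elementary_mats:
  "carrier (SL n TYPE('a::field)) = generate (SL n TYPE('a)) (elementary_mats n UNIV)"
proof
  let ?T = "elementary_mats n (UNIV :: 'a set)"
  interpret group "SL n TYPE('a)" by (rule group_SL)
  let ?H = "generate (SL n TYPE('a)) ?T"
  have TC: "?T \<subseteq> carrier (SL n TYPE('a))" using addrow_mat_in_SL by (auto simp: elementary_mats_def simp del: SL_simps)
  show "?H \<subseteq> carrier (SL n TYPE('a))" by (rule generate_incl[OF TC])
  have one_step: "A \<in> ?H"
    if A: "A \<in> carrier (SL n TYPE('a))" and kl: "k < n" "l < n" "k \<noteq> l" and H: "addrow a k l A \<in> ?H"
    for A a k l
  proof -
    let ?E = "addrow_mat n a k l :: 'a mat"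
    have E: "?E \<in> ?H" using kl by (auto simp: elementary_mats_def intro: generate.incl)
    have EC: "?E \<in> carrier (SL n TYPE('a))" by (rule addrow_mat_in_SL[OF kl])
    have eq: "addrow a k l A = ?E \<otimes>\<^bsub>SL n TYPE('a)\<^esub> A"
      using addrow_mat[of A n n l a k] A kl by auto
    have "inv\<^bsub>SL n TYPE('a)\<^esub> ?E \<otimes>\<^bsub>SL n TYPE('a)\<^esub> addrow a k l A \<in> ?H"
      using generate.eng[OF generate_m_inv_closed[OF TC E] H] .
    then show ?thesis unfolding eq using A EC by (simp only: inv_solve_left' m_assoc[symmetric] inv_closed l_inv l_one)
  qed
  \<comment> \<open>The first \<open>k\<close> columns are those of the identity matrix; the
    induction descends from \<open>k = n\<close>.\<close>
  define cols where "cols k A \<longleftrightarrow> A \<in> carrier (SL n TYPE('a)) \<and>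
    (\<forall>i<n. \<forall>j<k. A $$ (i,j) = (if i = j then 1 else 0))" for k and A :: "'a mat"
  have D: "A \<in> ?H" if "cols k A" "k \<le> n" for k A
    using that(2,1)
  proof (induction k arbitrary: A rule: inc_induct)
    case base
    then have "A = 1\<^sub>m n" by (intro eq_matI) (auto simp: cols_def)
    then show ?case using generate.one[of "SL n TYPE('a)" ?T] by simp
  next
    case (step k)
    note kn = \<open>k < n\<close>
    \<comment> \<open>The pivot is already 1 and column \<open>k\<close> gets cleared;
      \<open>m\<close> counts the rows known to be clear, and this induction also descends from
      \<open>n\<close>.\<close>
    have E: "A \<in> ?H" if "cols k A" "A $$ (k,k) = 1" "\<forall>i<m. i \<noteq> k \<longrightarrow> A $$ (i,k) = 0" "m \<le> n" for m A
      using that(4,1,2,3)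
    proof (induction m arbitrary: A rule: inc_induct)
      case base
      then have "cols (Suc k) A" by (auto simp: cols_def less_Suc_eq)
      then show ?case by (rule step.IH)
    next
      case (step m)
      show ?case
      proof (cases "m = k")
        case True
        then show ?thesis using step by (intro step.IH) (auto simp: less_Suc_eq)
      next
        case False
        let ?B = "addrow (- A $$ (m,k)) m k A"
        have AC: "A \<in> carrier (SL n TYPE('a))" using step.prems by (simp only: cols_def)
        have "?B \<in> ?H"
        proof (rule step.IH)
          show "cols k ?B"
            using step.prems kn step.hyps False addrow_in_SL[OF AC, of m k]
            by (auto simp: cols_def simp del: index_mat_addrow) (auto)
          show "?B $$ (k,k) = 1" "\<forall>i<Suc m. i \<noteq> k \<longrightarrow> ?B $$ (i,k) = 0"
            using step.prems kn step.hyps False AC by (auto simp: less_Suc_eq)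
        qed
        then show ?thesis using one_step[OF AC _ kn False] step.hyps by auto
      qed
    qed
    \<comment> \<open>Row \<open>i\<close> vanishes in the earlier columns, so adding a multiple of
      it to row \<open>k\<close> sets the pivot to 1 and keeps those columns.\<close>
    have F: "A \<in> ?H" if c: "cols k A" and i: "k < i" "i < n" "A $$ (i,k) \<noteq> 0" for i A
    proof -
      let ?B = "addrow ((1 - A $$ (k,k)) / A $$ (i,k)) k i A"
      have AC: "A \<in> carrier (SL n TYPE('a))" using c by (simp only: cols_def)
      have "cols k ?B"
        using c i kn addrow_in_SL[OF AC, of k i] by (auto simp: cols_def)
      moreover have "?B $$ (k,k) = 1" using i kn AC by auto
      ultimately have "?B \<in> ?H" using E[of ?B 0] by simp
      then show ?thesis using one_step[OF AC kn i(2)] i(1) by auto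
    qed
    have AC: "A \<in> carrier (SL n TYPE('a))" using step.prems by (simp only: cols_def)
    show ?case
    proof (cases "\<exists>i. k < i \<and> i < n \<and> A $$ (i,k) \<noteq> 0")
      case True
      then show ?thesis using F step.prems by blast
    next
      case False
      then have z: "A $$ (i,k) = 0" if "k < i" "i < n" for i using that by blast
      have nz: "A $$ (k,k) \<noteq> 0"
      proof
        assume 0: "A $$ (k,k) = 0"
        \<comment> \<open>The earlier columns are unit vectors and column \<open>k\<close> vanishes
          from row \<open>k\<close> on, so it is a combination of them; \<open>v\<close> holds the
          coefficients of this linear relation.\<close>
        define v where "v = vec n (\<lambda>i. if i < k then - A $$ (i,k) else if i = k then 1 else 0)"
        have "A *\<^sub>v v = 0\<^sub>v n"
        proof (rule eq_vecI)
          fix i assume i: "i < dim_vec (0\<^sub>v n :: 'a vec)"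
          have "(A *\<^sub>v v) $ i = (\<Sum>j<n. A $$ (i,j) * v $ j)"
            using AC i by (auto simp: scalar_prod_def v_def atLeast0LessThan intro!: sum.cong)
          also have "\<dots> = (\<Sum>j<n. if j = i \<and> i < k then - A $$ (i,k) else if j = k then A $$ (i,k) else 0)"
            using step.prems i by (intro sum.cong) (auto simp: v_def cols_def)
          also have "\<dots> = (\<Sum>j<n. (if j = i then if i < k then - A $$ (i,k) else 0 else 0) + (if j = k then A $$ (i,k) else 0))"
            using kn by (intro sum.cong) auto
          also have "\<dots> = 0" using i kn z 0 by (auto simp: sum.distrib) (metis not_less_iff_gr_or_eq)
          finally show "(A *\<^sub>v v) $ i = 0\<^sub>v n $ i" using i by simp
        qed (use AC in auto)
        moreover have "v \<in> carrier_vec n" "v $ k \<noteq> 0\<^sub>v n $ k"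
          using kn by (auto simp: v_def)
        then have "v \<in> carrier_vec n" "v \<noteq> 0\<^sub>v n" by auto
        ultimately have "det A = 0" using det_0_iff_vec_prod_zero_field[of A n] AC by auto
        then show False using AC by simp
      qed
      show ?thesis
      proof (cases "Suc k < n")
        case True
        \<comment> \<open>All entries below the pivot are 0; adding row \<open>k\<close> to the next
          row creates the nonzero entry that \<open>F\<close> needs.\<close>
        let ?B = "addrow 1 (Suc k) k A"
        have "?B \<in> ?H"
          using step.prems True kn addrow_in_SL[OF AC, of "Suc k" k] z[of "Suc k"] nz AC
          by (intro F[of _ "Suc k"]) (auto simp: cols_def)
        then show ?thesis using one_step[OF AC True kn] by auto
      next
        case False
        then have "n = Suc k" using kn by simp
        moreover have "upper_triangular A"
          using step.prems AC kn \<open>n = Suc k\<close> by (auto simp: cols_def less_Suc_eq upper_triangular_def)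
        then have "prod_list (diag_mat A) = 1" using det_upper_triangular[of A n] AC by auto
        moreover have "diag_mat A = map (\<lambda>i. 1) [0..<k] @ [A $$ (k,k)]"
          using step.prems AC \<open>n = Suc k\<close> by (auto simp: diag_mat_def cols_def)
        ultimately have "A $$ (k,k) = 1" by (simp add: map_replicate_const)
        then show ?thesis using E[of A 0] step.prems by simp
      qed
    qed
  qed
  show "carrier (SL n TYPE('a)) \<subseteq> ?H"
    using D[of 0] by (auto simp: cols_def)
qed

text \<open>Transvections in one position multiply by adding their entries, so entries from an
  additive generating set suffice. The premise expresses generation by repeated addition as an
  induction principle.\<close>

lemma SL_generated_by_additive_generators:
  fixes S :: "'a::field set"
  assumes S: "\<And>X. 0 \<in> X \<Longrightarrow> (\<And>x a. x \<in> X \<Longrightarrow> a \<in> S \<Longrightarrow> x + a \<in> X) \<Longrightarrow> X = UNIV"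
  shows "carrier (SL n TYPE('a)) = generate (SL n TYPE('a)) (elementary_mats n S)"
proof -
  interpret group "SL n TYPE('a)" by (rule group_SL)
  let ?H = "generate (SL n TYPE('a)) (elementary_mats n S)"
  have sub: "elementary_mats n S \<subseteq> carrier (SL n TYPE('a))" for S :: "'a set"
    using addrow_mat_in_SL by (auto simp: elementary_mats_def simp del: SL_simps)
  have "addrow_mat n a k l \<in> ?H" if kl: "k < n" "l < n" "k \<noteq> l" for a k l
  proof -
    have "{a. addrow_mat n a k l \<in> ?H} = UNIV"
    proof (rule S)
      have "addrow_mat n 0 k l = (1\<^sub>m n :: 'a mat)"
        by (intro eq_matI) (auto simp: addrow_mat_def)
      then show "0 \<in> {a. addrow_mat n a k l \<in> ?H}"
        using generate.one[of "SL n TYPE('a)" "elementary_mats n S"] by simp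
      fix x a assume x: "x \<in> {a. addrow_mat n a k l \<in> ?H}" and a: "a \<in> S"
      have "addrow_mat n a k l \<in> ?H"
        using a kl by (auto simp: elementary_mats_def intro: generate.incl)
      moreover have "addrow_mat n x k l * addrow_mat n a k l = addrow_mat n (x + a) k l"
        using kl by (subst addrow_mat[symmetric]) (auto intro!: eq_matI)
      ultimately show "x + a \<in> {a. addrow_mat n a k l \<in> ?H}"
        using x generate.eng[of "addrow_mat n x k l" "SL n TYPE('a)" "elementary_mats n S"] by fastforce
    qed
    then show ?thesis by blast
  qed
  then have "elementary_mats n UNIV \<subseteq> ?H" by (auto simp: elementary_mats_def)
  then have "carrier (SL n TYPE('a)) \<subseteq> ?H"
    using generate_subgroup_incl[OF _ generate_is_subgroup[OF sub]]
      SL_generated_by_elementary_mats[of n, where 'a='a] by blast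
  then show ?thesis using generate_incl[OF sub] by blast
qed

lemma SL_center:
  "group_center (SL n TYPE('a::field)) = {c \<cdot>\<^sub>m 1\<^sub>m n | c. c ^ n = 1}"
proof
  show "group_center (SL n TYPE('a)) \<subseteq> {c \<cdot>\<^sub>m 1\<^sub>m n | c. c ^ n = 1}"
  proof
    fix A assume "A \<in> group_center (SL n TYPE('a))"
    then have A: "A \<in> carrier_mat n n" "det A = 1"
      and comm: "\<And>B. B \<in> carrier (SL n TYPE('a)) \<Longrightarrow> A * B = B * A"
      by (auto simp: group_center_def)
    \<comment> \<open>Right multiplication by a transvection is a column operation, left
      multiplication a row operation. The position \<open>(k, l)\<close> compares two diagonal
      entries, the position \<open>(l, l)\<close> isolates an off-diagonal one.\<close>
    have eq: "addcol 1 l k A = addrow 1 k l A" if "k < n" "l < n" "k \<noteq> l" for k l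
      using comm[OF addrow_mat_in_SL[OF that]] addrow_mat[OF A(1) that(2)] addcol_mat[OF A(1) that(1)]
      by simp
    have diag: "A $$ (k,k) = A $$ (l,l)" if "k < n" "l < n" for k l
      using arg_cong[OF eq[of k l], of "\<lambda>M. M $$ (k,l)"] that A by (cases "k = l") auto
    have off: "A $$ (i,k) = 0" if "i < n" "k < n" "i \<noteq> k" for i k
      using arg_cong[OF eq[of k i], of "\<lambda>M. M $$ (i,i)"] that A by auto
    define c where "c = A $$ (0,0)"
    have "A = c \<cdot>\<^sub>m 1\<^sub>m n"
    proof (rule eq_matI)
      fix i j assume "i < dim_row (c \<cdot>\<^sub>m 1\<^sub>m n)" "j < dim_col (c \<cdot>\<^sub>m 1\<^sub>m n)"
      then show "A $$ (i,j) = (c \<cdot>\<^sub>m 1\<^sub>m n) $$ (i,j)"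
        using diag[of i 0] off[of i j] by (cases "i = j") (auto simp: c_def)
    qed (use A in auto)
    moreover from this have "c ^ n = 1" using A(2) by simp
    ultimately show "A \<in> {c \<cdot>\<^sub>m 1\<^sub>m n | c. c ^ n = 1}" by blast
  qed
qed (auto simp: group_center_def)

section \<open>Explicit matrices of size two and four\<close>

definition mat2 :: "'a::field \<Rightarrow> 'a \<Rightarrow> 'a \<Rightarrow> 'a \<Rightarrow> 'a mat" where
  "mat2 a b c d = mat_of_rows_list 2 [[a, b], [c, d]]"

definition mat4 :: "'a::field \<Rightarrow> 'a \<Rightarrow> 'a \<Rightarrow> 'a \<Rightarrow> 'a \<Rightarrow> 'a \<Rightarrow> 'a \<Rightarrow> 'a \<Rightarrow> 'a \<Rightarrow> 'a \<Rightarrow> 'a \<Rightarrow> 'a \<Rightarrow>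
    'a \<Rightarrow> 'a \<Rightarrow> 'a \<Rightarrow> 'a \<Rightarrow> 'a mat" where
  "mat4 a00 a01 a02 a03 a10 a11 a12 a13 a20 a21 a22 a23 a30 a31 a32 a33 =
     mat_of_rows_list 4 [[a00, a01, a02, a03], [a10, a11, a12, a13],
       [a20, a21, a22, a23], [a30, a31, a32, a33]]"

lemma less_2_iff: "(i::nat) < 2 \<longleftrightarrow> i = 0 \<or> i = 1" by auto
lemma less_4_iff: "(i::nat) < 4 \<longleftrightarrow> i = 0 \<or> i = 1 \<or> i = 2 \<or> i = 3" by auto

lemma atLeastLessThan_0_2: "{0..<2} = {0, 1::nat}" by auto
lemma atLeastLessThan_0_4: "{0..<4} = {0, 1, 2, 3::nat}" by auto

lemma mat2_carrier [simp]: "mat2 a b c d \<in> carrier_mat 2 2"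
  by (simp add: mat2_def mat_of_rows_list_def numeral_eq_Suc)

lemma mat4_carrier [simp]:
  "mat4 a00 a01 a02 a03 a10 a11 a12 a13 a20 a21 a22 a23 a30 a31 a32 a33 \<in> carrier_mat 4 4"
  by (simp add: mat4_def mat_of_rows_list_def numeral_eq_Suc)

lemma mat2_dim [simp]: "dim_row (mat2 a b c d) = 2" "dim_col (mat2 a b c d) = 2"
  by (simp_all add: mat2_def mat_of_rows_list_def)

lemma mat4_dim [simp]:
  "dim_row (mat4 a00 a01 a02 a03 a10 a11 a12 a13 a20 a21 a22 a23 a30 a31 a32 a33) = 4"
  "dim_col (mat4 a00 a01 a02 a03 a10 a11 a12 a13 a20 a21 a22 a23 a30 a31 a32 a33) = 4"
  by (simp_all add: mat4_def mat_of_rows_list_def)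

lemma mat2_index [simp]:
  "mat2 a b c d $$ (0,0) = a" "mat2 a b c d $$ (0,1) = b"
  "mat2 a b c d $$ (1,0) = c" "mat2 a b c d $$ (1,1) = d"
  "mat2 a b c d $$ (0,Suc 0) = b" "mat2 a b c d $$ (Suc 0,0) = c" "mat2 a b c d $$ (Suc 0,Suc 0) = d"
  by (simp_all add: mat2_def mat_of_rows_list_def)

lemma mat4_index [simp]:
  fixes a00 a01 a02 a03 a10 a11 a12 a13 a20 a21 a22 a23 a30 a31 a32 a33 :: "'a::field"
  defines "M \<equiv> mat4 a00 a01 a02 a03 a10 a11 a12 a13 a20 a21 a22 a23 a30 a31 a32 a33"
  shows "M $$ (0,0) = a00" "M $$ (0,Suc 0) = a01" "M $$ (0,2) = a02" "M $$ (0,3) = a03"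
    "M $$ (Suc 0,0) = a10" "M $$ (Suc 0,Suc 0) = a11" "M $$ (Suc 0,2) = a12" "M $$ (Suc 0,3) = a13"
    "M $$ (2,0) = a20" "M $$ (2,Suc 0) = a21" "M $$ (2,2) = a22" "M $$ (2,3) = a23"
    "M $$ (3,0) = a30" "M $$ (3,Suc 0) = a31" "M $$ (3,2) = a32" "M $$ (3,3) = a33"
  by (simp_all add: M_def mat4_def mat_of_rows_list_def)

lemma mat2_eqI:
  assumes "A \<in> carrier_mat 2 2" "B \<in> carrier_mat 2 2"
    and "\<And>i j. i \<in> {0, Suc 0} \<Longrightarrow> j \<in> {0, Suc 0} \<Longrightarrow> A $$ (i,j) = B $$ (i,j)"
  shows "A = B"
  using assms by (intro eq_matI) (simp_all add: less_2_iff)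

lemma mat2_eq_iff:
  assumes "A \<in> carrier_mat 2 2" "B \<in> carrier_mat 2 2"
  shows "A = B \<longleftrightarrow> A $$ (0,0) = B $$ (0,0) \<and> A $$ (0,1) = B $$ (0,1) \<and>
    A $$ (1,0) = B $$ (1,0) \<and> A $$ (1,1) = B $$ (1,1)"
  using assms by (auto simp: less_2_iff intro!: eq_matI)

lemma mat4_eqI:
  assumes "A \<in> carrier_mat 4 4" "B \<in> carrier_mat 4 4"
    and "\<And>i j. i \<in> {0, Suc 0, 2, 3} \<Longrightarrow> j \<in> {0, Suc 0, 2, 3} \<Longrightarrow> A $$ (i,j) = B $$ (i,j)"
  shows "A = B"
  using assms by (intro eq_matI) (simp_all add: less_4_iff)

lemma mat2_inject [simp]:
  "mat2 a b c d = mat2 a' b' c' d' \<longleftrightarrow> a = a' \<and> b = b' \<and> c = c' \<and> d = d'"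
  by (subst mat2_eq_iff) simp_all

lemma mat4_inject [simp]:
  "mat4 a00 a01 a02 a03 a10 a11 a12 a13 a20 a21 a22 a23 a30 a31 a32 a33 =
   mat4 b00 b01 b02 b03 b10 b11 b12 b13 b20 b21 b22 b23 b30 b31 b32 b33 \<longleftrightarrow>
   a00 = b00 \<and> a01 = b01 \<and> a02 = b02 \<and> a03 = b03 \<and>
   a10 = b10 \<and> a11 = b11 \<and> a12 = b12 \<and> a13 = b13 \<and>
   a20 = b20 \<and> a21 = b21 \<and> a22 = b22 \<and> a23 = b23 \<and>
   a30 = b30 \<and> a31 = b31 \<and> a32 = b32 \<and> a33 = b33" (is "?A = ?B \<longleftrightarrow> ?E")
proof
  assume eq: "?A = ?B"
  show ?E
    using arg_cong[OF eq, of "\<lambda>M. M $$ (0,0)"] arg_cong[OF eq, of "\<lambda>M. M $$ (0,Suc 0)"]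
      arg_cong[OF eq, of "\<lambda>M. M $$ (0,2)"] arg_cong[OF eq, of "\<lambda>M. M $$ (0,3)"]
      arg_cong[OF eq, of "\<lambda>M. M $$ (Suc 0,0)"] arg_cong[OF eq, of "\<lambda>M. M $$ (Suc 0,Suc 0)"]
      arg_cong[OF eq, of "\<lambda>M. M $$ (Suc 0,2)"] arg_cong[OF eq, of "\<lambda>M. M $$ (Suc 0,3)"]
      arg_cong[OF eq, of "\<lambda>M. M $$ (2,0)"] arg_cong[OF eq, of "\<lambda>M. M $$ (2,Suc 0)"]
      arg_cong[OF eq, of "\<lambda>M. M $$ (2,2)"] arg_cong[OF eq, of "\<lambda>M. M $$ (2,3)"]
      arg_cong[OF eq, of "\<lambda>M. M $$ (3,0)"] arg_cong[OF eq, of "\<lambda>M. M $$ (3,Suc 0)"]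
      arg_cong[OF eq, of "\<lambda>M. M $$ (3,2)"] arg_cong[OF eq, of "\<lambda>M. M $$ (3,3)"]
    by simp
qed simp

lemma mat2_cases:
  assumes "A \<in> carrier_mat 2 2" obtains a b c d where "A = mat2 a b c d"
  using assms that[of "A $$ (0,0)" "A $$ (0,1)" "A $$ (1,0)" "A $$ (1,1)"] by (simp add: mat2_eq_iff)

lemma mat4_cases:
  assumes "A \<in> carrier_mat 4 4"
  obtains a00 a01 a02 a03 a10 a11 a12 a13 a20 a21 a22 a23 a30 a31 a32 a33
  where "A = mat4 a00 a01 a02 a03 a10 a11 a12 a13 a20 a21 a22 a23 a30 a31 a32 a33"
proof (rule that)
  show "A = mat4 (A $$ (0,0)) (A $$ (0,Suc 0)) (A $$ (0,2)) (A $$ (0,3))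
     (A $$ (Suc 0,0)) (A $$ (Suc 0,Suc 0)) (A $$ (Suc 0,2)) (A $$ (Suc 0,3))
     (A $$ (2,0)) (A $$ (2,Suc 0)) (A $$ (2,2)) (A $$ (2,3))
     (A $$ (3,0)) (A $$ (3,Suc 0)) (A $$ (3,2)) (A $$ (3,3))"
    by (rule mat4_eqI[OF assms]) auto
qed

lemma mat2_arith [simp]:
  "mat2 a b c d * mat2 a' b' c' d' =
     mat2 (a * a' + b * c') (a * b' + b * d') (c * a' + d * c') (c * b' + d * d')"
  "mat2 a b c d + mat2 a' b' c' d' = mat2 (a + a') (b + b') (c + c') (d + d')"
  "mat2 a b c d - mat2 a' b' c' d' = mat2 (a - a') (b - b') (c - c') (d - d')"
  "x \<cdot>\<^sub>m mat2 a b c d = mat2 (x * a) (x * b) (x * c) (x * d)"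
  "transpose_mat (mat2 a b c d) = mat2 a c b d"
  "map_mat f (mat2 a b c d) = mat2 (f a) (f b) (f c) (f d)"
  "1\<^sub>m 2 = mat2 1 0 0 1"
  "0\<^sub>m 2 2 = mat2 0 0 0 0"
  by - (rule mat2_eqI; (rule carrier_matI)?; simp; (elim disjE)?; simp add: times_mat_def scalar_prod_def atLeastLessThan_0_2)+

lemma det_mat2 [simp]: "det (mat2 a b c d) = a * d - b * c"
  by (subst laplace_expansion_row[of _ 2 0])
    (auto simp: numeral_2_eq_2 cofactor_def mat_delete_def det_single)

lemma mat4_arith [simp]:
  "mat4 a00 a01 a02 a03 a10 a11 a12 a13 a20 a21 a22 a23 a30 a31 a32 a33 *
   mat4 b00 b01 b02 b03 b10 b11 b12 b13 b20 b21 b22 b23 b30 b31 b32 b33 =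
   mat4
     (a00*b00 + (a01*b10 + (a02*b20 + a03*b30))) (a00*b01 + (a01*b11 + (a02*b21 + a03*b31)))
     (a00*b02 + (a01*b12 + (a02*b22 + a03*b32))) (a00*b03 + (a01*b13 + (a02*b23 + a03*b33)))
     (a10*b00 + (a11*b10 + (a12*b20 + a13*b30))) (a10*b01 + (a11*b11 + (a12*b21 + a13*b31)))
     (a10*b02 + (a11*b12 + (a12*b22 + a13*b32))) (a10*b03 + (a11*b13 + (a12*b23 + a13*b33)))
     (a20*b00 + (a21*b10 + (a22*b20 + a23*b30))) (a20*b01 + (a21*b11 + (a22*b21 + a23*b31)))
     (a20*b02 + (a21*b12 + (a22*b22 + a23*b32))) (a20*b03 + (a21*b13 + (a22*b23 + a23*b33)))
     (a30*b00 + (a31*b10 + (a32*b20 + a33*b30))) (a30*b01 + (a31*b11 + (a32*b21 + a33*b31)))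
     (a30*b02 + (a31*b12 + (a32*b22 + a33*b32))) (a30*b03 + (a31*b13 + (a32*b23 + a33*b33)))"
  "mat4 a00 a01 a02 a03 a10 a11 a12 a13 a20 a21 a22 a23 a30 a31 a32 a33 +
   mat4 b00 b01 b02 b03 b10 b11 b12 b13 b20 b21 b22 b23 b30 b31 b32 b33 =
   mat4 (a00+b00) (a01+b01) (a02+b02) (a03+b03) (a10+b10) (a11+b11) (a12+b12) (a13+b13)
     (a20+b20) (a21+b21) (a22+b22) (a23+b23) (a30+b30) (a31+b31) (a32+b32) (a33+b33)"
  "x \<cdot>\<^sub>m mat4 a00 a01 a02 a03 a10 a11 a12 a13 a20 a21 a22 a23 a30 a31 a32 a33 =
   mat4 (x*a00) (x*a01) (x*a02) (x*a03) (x*a10) (x*a11) (x*a12) (x*a13)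
     (x*a20) (x*a21) (x*a22) (x*a23) (x*a30) (x*a31) (x*a32) (x*a33)"
  "transpose_mat (mat4 a00 a01 a02 a03 a10 a11 a12 a13 a20 a21 a22 a23 a30 a31 a32 a33) =
   mat4 a00 a10 a20 a30 a01 a11 a21 a31 a02 a12 a22 a32 a03 a13 a23 a33"
  "1\<^sub>m 4 = mat4 1 0 0 0 0 1 0 0 0 0 1 0 0 0 0 1"
  "0\<^sub>m 4 4 = mat4 0 0 0 0 0 0 0 0 0 0 0 0 0 0 0 0"
  "mat4 a00 a01 a02 a03 a10 a11 a12 a13 a20 a21 a22 a23 a30 a31 a32 a33 -
   mat4 b00 b01 b02 b03 b10 b11 b12 b13 b20 b21 b22 b23 b30 b31 b32 b33 =
   mat4 (a00-b00) (a01-b01) (a02-b02) (a03-b03) (a10-b10) (a11-b11) (a12-b12) (a13-b13)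
     (a20-b20) (a21-b21) (a22-b22) (a23-b23) (a30-b30) (a31-b31) (a32-b32) (a33-b33)"
  by - (rule mat4_eqI; (rule carrier_matI)?; simp; (elim disjE)?; simp add: times_mat_def scalar_prod_def atLeastLessThan_0_4)+

section \<open>The symplectic group of dimension four\<close>

definition J4 :: "'a::field mat" where
  "J4 = mat4 0 0 1 0 0 0 0 1 (-1) 0 0 0 0 (-1) 0 0"

lemma symplectic_form_mat_2: "symplectic_form_mat 2 = J4"
  by (rule mat4_eqI) (auto simp: symplectic_form_mat_def J4_def)

lemma Sp_2_simps [simp]:
  "carrier (Sp 2 F) = {A \<in> carrier_mat 4 4. transpose_mat A * J4 * A = J4}"
  "mult (Sp 2 F) = (*)" "one (Sp 2 F) = 1\<^sub>m 4"
  by (simp_all add: Sp_def symplectic_form_mat_2)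

lemma mult_carrier_mat_square [simp]:
  "A \<in> carrier_mat n n \<Longrightarrow> B \<in> carrier_mat n n \<Longrightarrow> A * B \<in> carrier_mat n n"
  by (rule mult_carrier_mat)

lemma J4_carrier [simp]: "J4 \<in> carrier_mat 4 4"
  by (simp add: J4_def)

lemma group_Sp_2: "group (Sp 2 TYPE('a::field))"
proof (rule groupI)
  fix A B :: "'a mat"
  assume A: "A \<in> carrier (Sp 2 TYPE('a))" and B: "B \<in> carrier (Sp 2 TYPE('a))"
  have c: "A \<in> carrier_mat 4 4" "B \<in> carrier_mat 4 4" "J4 * A \<in> carrier_mat 4 4"
    using A B by (auto intro: mult_carrier_mat[of _ 4 4])
  note assoc = assoc_mult_mat[of _ 4 4 _ 4 _ 4]
  have "transpose_mat (A * B) * J4 * (A * B) = transpose_mat B * (transpose_mat A * (J4 * (A * B)))"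
    using c by (simp add: transpose_mult[of A 4 4 B 4] assoc)
  also have "\<dots> = transpose_mat B * ((transpose_mat A * J4 * A) * B)"
    using c by (simp add: assoc)
  also have "transpose_mat A * J4 * A = J4" using A by simp
  also have "transpose_mat B * (J4 * B) = transpose_mat B * J4 * B" using c by (simp add: assoc)
  also have "\<dots> = J4" using B by simp
  finally have "transpose_mat (A * B) * J4 * (A * B) = J4" .
  then show "A \<otimes>\<^bsub>Sp 2 TYPE('a)\<^esub> B \<in> carrier (Sp 2 TYPE('a))"
    using c by (auto intro: mult_carrier_mat[of _ 4 4])
next
  fix A :: "'a mat"
  assume "A \<in> carrier (Sp 2 TYPE('a))"
  then have A: "A \<in> carrier_mat 4 4" "transpose_mat A * J4 * A = J4" by auto
  \<comment> \<open>Since \<open>J4\<close> squares to \<open>-1\<close>, the equation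
    \<open>A^T J4 A = J4\<close> makes \<open>- J4 A^T J4\<close> a left inverse of
    \<open>A\<close>.\<close>
  define B where "B = (-1) \<cdot>\<^sub>m J4 * (transpose_mat A * J4)"
  have B: "B \<in> carrier_mat 4 4" using A by (auto simp: B_def)
  have "B * A = (-1) \<cdot>\<^sub>m J4 * (transpose_mat A * J4 * A)"
    using A by (simp add: B_def assoc_mult_mat[of _ 4 4 _ 4 _ 4])
  also have "\<dots> = 1\<^sub>m 4" unfolding A(2) by (simp add: J4_def)
  finally have BA: "B * A = 1\<^sub>m 4" .
  then have AB: "A * B = 1\<^sub>m 4" using mat_mult_left_right_inverse[OF B A(1)] by simp
  have "transpose_mat B * J4 * B = transpose_mat B * (transpose_mat A * J4 * A) * B"
    by (simp only: A(2))
  also have "\<dots> = transpose_mat (A * B) * J4 * (A * B)"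
    using A(1) B by (simp add: transpose_mult[of A 4 4 B 4] assoc_mult_mat[of _ 4 4 _ 4 _ 4] del: mat4_arith)
  also have "\<dots> = J4" unfolding AB by (simp add: J4_def)
  finally show "\<exists>C\<in>carrier (Sp 2 TYPE('a)). C \<otimes>\<^bsub>Sp 2 TYPE('a)\<^esub> A = \<one>\<^bsub>Sp 2 TYPE('a)\<^esub>"
    using B BA by auto
qed (auto simp: J4_def assoc_mult_mat[of _ 4 4 _ 4 _ 4] simp del: mat4_arith(5))

text \<open>These are the pairings of the columns under the alternating form; columns 0 and 2, and
  columns 1 and 3, form hyperbolic pairs. Negative terms are moved to the other side, so that zero
  entries simplify without subtractions.\<close>

lemma Sp_2_columns:
  fixes a00 :: "'a::field"
  assumes "mat4 a00 a01 a02 a03 a10 a11 a12 a13 a20 a21 a22 a23 a30 a31 a32 a33 \<in> carrier (Sp 2 TYPE('a))"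
  shows "a00 * a21 + a10 * a31 = a20 * a01 + a30 * a11"
    "a00 * a22 + a10 * a32 = a20 * a02 + a30 * a12 + 1"
    "a00 * a23 + a10 * a33 = a20 * a03 + a30 * a13"
    "a01 * a22 + a11 * a32 = a21 * a02 + a31 * a12"
    "a01 * a23 + a11 * a33 = a21 * a03 + a31 * a13 + 1"
    "a02 * a23 + a12 * a33 = a22 * a03 + a32 * a13"
proof -
  have *: "x + y = z + w + e" if "- z + (- w + (x + y)) = e" for x y z w e :: 'a
    using that by (simp add: algebra_simps)
  have "transpose_mat (mat4 a00 a01 a02 a03 a10 a11 a12 a13 a20 a21 a22 a23 a30 a31 a32 a33) * J4 *
      mat4 a00 a01 a02 a03 a10 a11 a12 a13 a20 a21 a22 a23 a30 a31 a32 a33 = J4"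
    using assms by simp
  note eqs = this[unfolded J4_def mat4_arith mat4_inject]
  show "a00 * a21 + a10 * a31 = a20 * a01 + a30 * a11"
    "a00 * a22 + a10 * a32 = a20 * a02 + a30 * a12 + 1"
    "a00 * a23 + a10 * a33 = a20 * a03 + a30 * a13"
    "a01 * a22 + a11 * a32 = a21 * a02 + a31 * a12"
    "a01 * a23 + a11 * a33 = a21 * a03 + a31 * a13 + 1"
    "a02 * a23 + a12 * a33 = a22 * a03 + a32 * a13"
    using *[of "a20 * a01" "a30 * a11" "a00 * a21" "a10 * a31" 0]
      *[of "a20 * a02" "a30 * a12" "a00 * a22" "a10 * a32" 1]
      *[of "a20 * a03" "a30 * a13" "a00 * a23" "a10 * a33" 0]
      *[of "a21 * a02" "a31 * a12" "a01 * a22" "a11 * a32" 0]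
      *[of "a21 * a03" "a31 * a13" "a01 * a23" "a11 * a33" 1]
      *[of "a22 * a03" "a32 * a13" "a02 * a23" "a12 * a33" 0] eqs
    by (simp_all only: mult_zero_left mult_zero_right mult_1_left mult_1_right add_0 add_0_right
        mult_minus_left mult_minus_right minus_zero)
qed

section \<open>Generation of the symplectic group by two opposite unipotent subgroups\<close>

definition upper :: "'a::field \<Rightarrow> 'a \<Rightarrow> 'a \<Rightarrow> 'a mat" where
  "upper s t u = mat4 1 0 s t 0 1 t u 0 0 1 0 0 0 0 1"

definition lower :: "'a::field \<Rightarrow> 'a \<Rightarrow> 'a \<Rightarrow> 'a mat" where
  "lower s t u = mat4 1 0 0 0 0 1 0 0 s t 1 0 t u 0 1"

definition unipotents :: "'a::field mat set" where
  "unipotents = {upper s t u | s t u. True} \<union> {lower s t u | s t u. True}"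

text \<open>The off-diagonal block with entries \<open>s t t u\<close> is symmetric, which is
  exactly the condition for such a unipotent block matrix to preserve \<open>J4\<close>.\<close>

lemma upper_lower_in_Sp:
  "upper s t u \<in> carrier (Sp 2 TYPE('a::field))" "lower s t u \<in> carrier (Sp 2 TYPE('a))"
  by (simp_all add: upper_def lower_def J4_def)

lemma unipotents_subset: "unipotents \<subseteq> carrier (Sp 2 TYPE('a::field))"
  using upper_lower_in_Sp by (auto simp: unipotents_def simp del: Sp_2_simps)

text \<open>Elimination on the first column, then on the second, by left multiplication with the two
  unipotent subgroups and with Levi elements that are words in them. \<open>S1\<close> to
  \<open>S6\<close> run backwards: each shape of matrix is reduced to an earlier one.\<close>

lemma Sp_2_generated_by_unipotents:
  "carrier (Sp 2 TYPE('a::field)) = generate (Sp 2 TYPE('a)) unipotents"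
proof
  interpret group "Sp 2 TYPE('a)" by (rule group_Sp_2)
  let ?H = "generate (Sp 2 TYPE('a)) (unipotents :: 'a mat set)"
  show "?H \<subseteq> carrier (Sp 2 TYPE('a))" by (rule generate_incl[OF unipotents_subset])
  have U: "upper s t u \<in> ?H" and L: "lower s t u \<in> ?H" for s t u
    by (rule generate.incl, fastforce simp: unipotents_def)+
  have m: "A * B \<in> ?H" if "A \<in> ?H" "B \<in> ?H" for A B
    using generate.eng[OF that] by simp
  have one_step: "A \<in> ?H" if A: "A \<in> carrier (Sp 2 TYPE('a))" and E: "E \<in> ?H" and H: "E * A \<in> ?H" for A E
  proof -
    have EC: "E \<in> carrier (Sp 2 TYPE('a))" using E generate_incl[OF unipotents_subset] by blast
    have "inv\<^bsub>Sp 2 TYPE('a)\<^esub> E \<otimes>\<^bsub>Sp 2 TYPE('a)\<^esub> (E \<otimes>\<^bsub>Sp 2 TYPE('a)\<^esub> A) \<in> ?H"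
      using generate.eng[OF generate_m_inv_closed[OF unipotents_subset E]] H by simp
    then show ?thesis using A EC by (simp only: m_assoc[symmetric] inv_closed l_inv l_one)
  qed
  have closed: "E * A \<in> carrier (Sp 2 TYPE('a))" if "A \<in> carrier (Sp 2 TYPE('a))" "E \<in> ?H" for A E
    using m_closed[of E A] that generate_incl[OF unipotents_subset] by auto
  define levi where "levi x = mat4 1 x 0 0 0 1 0 0 0 0 1 0 0 0 (-x) 1" for x :: 'a
  define levi' where "levi' x = mat4 1 0 0 0 x 1 0 0 0 0 1 (-x) 0 0 0 1" for x :: 'a
  have levi: "levi x \<in> ?H" for x
  proof -
    \<comment> \<open>The first three factors form a Weyl element exchanging coordinates 1 and 3 up
      to sign, and the last three its inverse; conjugation turns \<open>upper 0 x 0\<close> into a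
      transvection of the plane of the first two coordinates, together with its dual.\<close>
    have "levi x = upper 0 0 1 * (lower 0 0 (-1) * (upper 0 0 1 * (upper 0 x 0 *
        (upper 0 0 (-1) * (lower 0 0 1 * upper 0 0 (-1))))))"
      by (simp add: levi_def upper_def lower_def)
    then show ?thesis by (simp only: m U L)
  qed
  have levi': "levi' x \<in> ?H" for x
  proof -
    have "levi' x = upper 1 0 0 * (lower (-1) 0 0 * (upper 1 0 0 * (upper 0 x 0 *
        (upper (-1) 0 0 * (lower 1 0 0 * upper (-1) 0 0)))))"
      by (simp add: levi'_def upper_def lower_def)
    then show ?thesis by (simp only: m U L)
  qed
  note defs = upper_def lower_def levi_def levi'_def
  have S1: "mat4 1 a01 a02 a03 0 1 a12 0 0 0 1 0 0 0 a32 1 \<in> ?H"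
    if "mat4 1 a01 a02 a03 0 1 a12 0 0 0 1 0 0 0 a32 1 \<in> carrier (Sp 2 TYPE('a))" for a01 a02 a03 a12 a32
  proof -
    let ?A = "mat4 1 a01 a02 a03 0 1 a12 0 0 0 1 0 0 0 a32 1"
    have "a01 = - a32" "a03 = a12"
      using Sp_2_columns(4,6)[OF that] by (simp_all add: eq_neg_iff_add_eq_0)
    then have "upper (a02 + - a03 * a32) 0 0 * (upper 0 a03 0 * levi a01) = ?A"
      by (simp add: defs algebra_simps)
    then show ?thesis using m U levi by metis
  qed
  have S2: "mat4 1 a01 a02 a03 0 1 a12 a13 0 a21 a22 a23 0 a31 a32 a33 \<in> ?H"
    if A: "mat4 1 a01 a02 a03 0 1 a12 a13 0 a21 a22 a23 0 a31 a32 a33 \<in> carrier (Sp 2 TYPE('a))" for a01 a02 a03 a12 a13 a21 a22 a23 a31 a32 a33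
  proof -
    let ?A = "mat4 1 a01 a02 a03 0 1 a12 a13 0 a21 a22 a23 0 a31 a32 a33"
    have e: "a21 = 0" "a22 = 1" "a23 = 0" using Sp_2_columns(1,2,3)[OF A] by simp_all
    then have d: "a33 - a31 * a13 = 1" using Sp_2_columns(5)[OF A] by simp
    let ?B = "lower 0 0 (- a31) * ?A"
    have Beq: "?B = mat4 1 a01 a02 a03 0 1 a12 a13 0 0 1 0 0 0 (a32 - a31 * a12) 1"
      using e d by (simp add: defs algebra_simps)
    let ?C = "upper 0 0 (- a13) * ?B"
    have Ceq: "?C = mat4 1 a01 a02 a03 0 1 (a12 - a13 * (a32 - a31 * a12)) 0 0 0 1 0 0 0 (a32 - a31 * a12) 1"
      unfolding Beq by (simp add: defs algebra_simps)
    have BC: "?B \<in> carrier (Sp 2 TYPE('a))" by (rule closed[OF A L])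
    have "?C \<in> carrier (Sp 2 TYPE('a))" by (rule closed[OF BC U])
    then have "?C \<in> ?H" unfolding Ceq by (rule S1)
    then have "?B \<in> ?H" by (rule one_step[OF BC U])
    then show ?thesis by (rule one_step[OF A L])
  qed
  have S3: "mat4 1 a01 a02 a03 0 a11 a12 a13 0 a21 a22 a23 0 a31 a32 a33 \<in> ?H"
    if A: "mat4 1 a01 a02 a03 0 a11 a12 a13 0 a21 a22 a23 0 a31 a32 a33 \<in> carrier (Sp 2 TYPE('a))" and nz: "a31 \<noteq> 0"
    for a01 a02 a03 a11 a12 a13 a21 a22 a23 a31 a32 a33
  proof -
    let ?A = "mat4 1 a01 a02 a03 0 a11 a12 a13 0 a21 a22 a23 0 a31 a32 a33"
    let ?B = "upper 0 0 ((1 - a11) / a31) * ?A"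
    have BC: "?B \<in> carrier (Sp 2 TYPE('a))" by (rule closed[OF A U])
    have "a21 = 0" using Sp_2_columns(1)[OF A] by simp
    then have "\<exists>a01 a02 a03 a12 a13 a21 a22 a23 a31 a32 a33.
        ?B = mat4 1 a01 a02 a03 0 1 a12 a13 0 a21 a22 a23 0 a31 a32 a33"
      using nz by (simp add: defs)
    then have "?B \<in> ?H" using S2 BC by metis
    then show ?thesis by (rule one_step[OF A U])
  qed
  have S4: "mat4 1 a01 a02 a03 0 a11 a12 a13 0 a21 a22 a23 0 a31 a32 a33 \<in> ?H"
    if A: "mat4 1 a01 a02 a03 0 a11 a12 a13 0 a21 a22 a23 0 a31 a32 a33 \<in> carrier (Sp 2 TYPE('a))"
    for a01 a02 a03 a11 a12 a13 a21 a22 a23 a31 a32 a33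
  proof (cases "a31 = 0")
    case True
    let ?A = "mat4 1 a01 a02 a03 0 a11 a12 a13 0 a21 a22 a23 0 a31 a32 a33"
    let ?B = "lower 0 0 1 * ?A"
    have BC: "?B \<in> carrier (Sp 2 TYPE('a))" by (rule closed[OF A L])
    \<comment> \<open>Columns 1 and 3 pair to 1, which here reads \<open>a11 * a33 = 1\<close>;
      adding row 1 to row 3 therefore makes \<open>a31\<close> nonzero.\<close>
    have "a21 = 0" "a11 \<noteq> 0" using Sp_2_columns(1,3,5)[OF A] True by auto
    then have "\<exists>a01 a02 a03 a11 a12 a13 a21 a22 a23 a31 a32 a33. a31 \<noteq> 0 \<and>
        ?B = mat4 1 a01 a02 a03 0 a11 a12 a13 0 a21 a22 a23 0 a31 a32 a33"
      using True by (simp add: defs)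
    then have "?B \<in> ?H" using S3 BC by metis
    then show ?thesis by (rule one_step[OF A L])
  qed (rule S3[OF A])
  have S5: "mat4 1 a01 a02 a03 a10 a11 a12 a13 a20 a21 a22 a23 a30 a31 a32 a33 \<in> ?H"
    if A: "mat4 1 a01 a02 a03 a10 a11 a12 a13 a20 a21 a22 a23 a30 a31 a32 a33 \<in> carrier (Sp 2 TYPE('a))"
    for a01 a02 a03 a10 a11 a12 a13 a20 a21 a22 a23 a30 a31 a32 a33
  proof -
    let ?A = "mat4 1 a01 a02 a03 a10 a11 a12 a13 a20 a21 a22 a23 a30 a31 a32 a33"
    \<comment> \<open>With corner entry 1 this clears rows 2 and 3 of the first column;
      \<open>levi'\<close> then clears row 1.\<close>
    let ?B = "lower (a30 * a10 - a20) (- a30) 0 * ?A"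
    let ?C = "levi' (- a10) * ?B"
    have BC: "?B \<in> carrier (Sp 2 TYPE('a))" by (rule closed[OF A L])
    have CC: "?C \<in> carrier (Sp 2 TYPE('a))" by (rule closed[OF BC levi'])
    have "\<exists>a01 a02 a03 a11 a12 a13 a21 a22 a23 a31 a32 a33.
        ?C = mat4 1 a01 a02 a03 0 a11 a12 a13 0 a21 a22 a23 0 a31 a32 a33"
      unfolding defs mat4_arith mat4_inject
      by (intro exI conjI; (rule refl | simp add: algebra_simps))
    then have "?C \<in> ?H" using S4 CC by metis
    then have "?B \<in> ?H" by (rule one_step[OF BC levi'])
    then show ?thesis by (rule one_step[OF A L])
  qed
  have S6: "mat4 a00 a01 a02 a03 a10 a11 a12 a13 a20 a21 a22 a23 a30 a31 a32 a33 \<in> ?H"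
    if A: "mat4 a00 a01 a02 a03 a10 a11 a12 a13 a20 a21 a22 a23 a30 a31 a32 a33 \<in> carrier (Sp 2 TYPE('a))" and nz: "a20 \<noteq> 0 \<or> a30 \<noteq> 0"
    for a00 a01 a02 a03 a10 a11 a12 a13 a20 a21 a22 a23 a30 a31 a32 a33
  proof -
    let ?A = "mat4 a00 a01 a02 a03 a10 a11 a12 a13 a20 a21 a22 a23 a30 a31 a32 a33"
    obtain s t where st: "a00 + (s * a20 + t * a30) = 1"
    proof (cases "a20 = 0")
      case True
      then show ?thesis using nz that[of 0 "(1 - a00) / a30"] by simp
    next
      case False
      then show ?thesis using that[of "(1 - a00) / a20" 0] by simp
    qed
    let ?B = "upper s t 0 * ?A"
    have BC: "?B \<in> carrier (Sp 2 TYPE('a))" by (rule closed[OF A U])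
    have "\<exists>a01 a02 a03 a10 a11 a12 a13 a20 a21 a22 a23 a30 a31 a32 a33.
        ?B = mat4 1 a01 a02 a03 a10 a11 a12 a13 a20 a21 a22 a23 a30 a31 a32 a33"
      using st by (simp add: defs)
    then have "?B \<in> ?H" using S5 BC by metis
    then show ?thesis by (rule one_step[OF A U])
  qed
  show "carrier (Sp 2 TYPE('a)) \<subseteq> ?H"
  proof
    fix A assume A: "A \<in> carrier (Sp 2 TYPE('a))"
    then obtain a00 a01 a02 a03 a10 a11 a12 a13 a20 a21 a22 a23 a30 a31 a32 a33
      where Aeq: "A = mat4 a00 a01 a02 a03 a10 a11 a12 a13 a20 a21 a22 a23 a30 a31 a32 a33"
      by (auto elim: mat4_cases)
    show "A \<in> ?H"
    proof (cases "a20 = 0 \<and> a30 = 0")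
      case True
      \<comment> \<open>The lower half of the first column vanishes, so its upper half does not;
        \<open>E\<close> adds a row with nonzero first entry to row 2.\<close>
      obtain E :: "'a mat" where E: "E = lower 0 1 0 \<or> E = lower 1 0 0"
        and nz: "a00 = 0 \<longrightarrow> E = lower 0 1 0" "a00 \<noteq> 0 \<longrightarrow> E = lower 1 0 0" by (metis (full_types))
      then have EH: "E \<in> ?H" using L by blast
      have BC: "E * A \<in> carrier (Sp 2 TYPE('a))" by (rule closed[OF A EH])
      have a: "a00 \<noteq> 0 \<or> a10 \<noteq> 0" using Sp_2_columns(2)[OF A[unfolded Aeq]] True by auto
      have "E * A \<in> carrier_mat 4 4" using BC by simp
      then obtain b00 b01 b02 b03 b10 b11 b12 b13 b20 b21 b22 b23 b30 b31 b32 b33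
        where B: "E * A = mat4 b00 b01 b02 b03 b10 b11 b12 b13 b20 b21 b22 b23 b30 b31 b32 b33"
        by (rule mat4_cases)
      have "b20 \<noteq> 0 \<or> b30 \<noteq> 0"
      proof (cases "a00 = 0")
        case True0: True
        have "lower 0 1 0 * A = mat4 b00 b01 b02 b03 b10 b11 b12 b13 b20 b21 b22 b23 b30 b31 b32 b33"
          using B nz(1) True0 by simp
        then have "b20 = a10" using True True0 by (simp only: Aeq defs mat4_arith mat4_inject) auto
        then show ?thesis using a True0 by simp
      next
        case False
        have "lower 1 0 0 * A = mat4 b00 b01 b02 b03 b10 b11 b12 b13 b20 b21 b22 b23 b30 b31 b32 b33"
          using B nz(2) False by simp
        then have "b20 = a00" using True by (simp only: Aeq defs mat4_arith mat4_inject) auto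
        then show ?thesis using False by simp
      qed
      then have "E * A \<in> ?H" using S6 BC unfolding B by blast
      then show ?thesis by (rule one_step[OF A EH])
    next
      case False
      then show ?thesis using S6 A unfolding Aeq by blast
    qed
  qed
qed

text \<open>Five unipotent elements, each with one parameter equal to 1 and the others 0, already
  have only scalars in their common centraliser.\<close>

lemma Sp_2_center:
  "group_center (Sp 2 TYPE('a::field)) = {c \<cdot>\<^sub>m 1\<^sub>m 4 | c. c\<^sup>2 = 1}"
proof
  show "group_center (Sp 2 TYPE('a)) \<subseteq> {c \<cdot>\<^sub>m 1\<^sub>m 4 | c. c\<^sup>2 = 1}"
  proof
    fix A assume Z: "A \<in> group_center (Sp 2 TYPE('a))"
    then have A: "A \<in> carrier_mat 4 4" "transpose_mat A * J4 * A = J4"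
      and comm: "\<And>B. B \<in> carrier (Sp 2 TYPE('a)) \<Longrightarrow> A * B = B * A"
      by (auto simp: group_center_def)
    obtain a00 a01 a02 a03 a10 a11 a12 a13 a20 a21 a22 a23 a30 a31 a32 a33
      where Aeq: "A = mat4 a00 a01 a02 a03 a10 a11 a12 a13 a20 a21 a22 a23 a30 a31 a32 a33"
      using mat4_cases[OF A(1)] .
    have "a10 = 0 \<and> a20 = 0 \<and> a30 = 0 \<and> a21 = 0 \<and> a23 = 0 \<and> a22 = a00"
      using comm[OF upper_lower_in_Sp(1), of 1 0 0] by (simp add: Aeq upper_def)
    moreover have "a01 = 0 \<and> a31 = 0 \<and> a32 = 0 \<and> a33 = a11"
      using comm[OF upper_lower_in_Sp(1), of 0 0 1] by (simp add: Aeq upper_def)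
    moreover have "a02 = 0 \<and> a12 = 0 \<and> a03 = 0"
      using comm[OF upper_lower_in_Sp(2), of 1 0 0] by (simp add: Aeq lower_def)
    moreover have "a13 = 0"
      using comm[OF upper_lower_in_Sp(2), of 0 0 1] by (simp add: Aeq lower_def)
    moreover have "a33 = a00"
      using comm[OF upper_lower_in_Sp(1), of 0 1 0] by (simp add: Aeq upper_def)
    ultimately have "A = a00 \<cdot>\<^sub>m 1\<^sub>m 4"
      by (simp add: Aeq)
    moreover from this have "a00\<^sup>2 = 1"
      using A(2) by (simp add: J4_def power2_eq_square)
    ultimately show "A \<in> {c \<cdot>\<^sub>m 1\<^sub>m 4 | c. c\<^sup>2 = 1}" by blast
  qed
  show "{c \<cdot>\<^sub>m 1\<^sub>m 4 | c. c\<^sup>2 = 1} \<subseteq> group_center (Sp 2 TYPE('a))"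
  proof
    fix A :: "'a mat" assume "A \<in> {c \<cdot>\<^sub>m 1\<^sub>m 4 | c. c\<^sup>2 = 1}"
    then obtain c where c: "c * c = 1" "A = c \<cdot>\<^sub>m 1\<^sub>m 4" by (auto simp: power2_eq_square)
    show "A \<in> group_center (Sp 2 TYPE('a))"
      unfolding group_center_def
    proof (safe)
      show "A \<in> carrier (Sp 2 TYPE('a))" using c by (simp add: J4_def)
      fix B assume "B \<in> carrier (Sp 2 TYPE('a))"
      then show "A \<otimes>\<^bsub>Sp 2 TYPE('a)\<^esub> B = B \<otimes>\<^bsub>Sp 2 TYPE('a)\<^esub> A"
        using c(2) mult_smult_distrib[of B 4 4 "1\<^sub>m 4" 4 c] mult_smult_assoc_mat[of "1\<^sub>m 4" 4 4 B 4 c]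
          left_mult_one_mat[of B 4 4] right_mult_one_mat[of B 4 4]
        by (simp del: mat4_arith)
    qed
  qed
qed

section \<open>The isomorphism of types B and C in rank two\<close>

definition vec5 :: "'a::field \<Rightarrow> 'a \<Rightarrow> 'a \<Rightarrow> 'a \<Rightarrow> 'a \<Rightarrow> 'a vec" where
  "vec5 a b c d e = vec_of_list [a, b, c, d, e]"

lemma vec5_index [simp]:
  "vec5 a b c d e $ 0 = a" "vec5 a b c d e $ 1 = b" "vec5 a b c d e $ Suc 0 = b"
  "vec5 a b c d e $ 2 = c" "vec5 a b c d e $ 3 = d" "vec5 a b c d e $ 4 = e"
  "dim_vec (vec5 a b c d e) = 5"
  by (simp_all add: vec5_def vec_of_list_index numeral_eq_Suc)

lemma vec5_carrier [simp]: "vec5 a b c d e \<in> carrier_vec 5"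
  by (rule carrier_vecI) simp

lemma less_5_iff: "(i::nat) < 5 \<longleftrightarrow> i = 0 \<or> i = 1 \<or> i = 2 \<or> i = 3 \<or> i = 4" by auto

lemma vec5_eqI:
  assumes "x \<in> carrier_vec 5" "y \<in> carrier_vec 5" "x $ 0 = y $ 0" "x $ 1 = y $ 1" "x $ 2 = y $ 2"
    "x $ 3 = y $ 3" "x $ 4 = y $ 4"
  shows "x = y"
  using assms by (intro eq_vecI) (auto simp: less_5_iff)

lemma vec5_cases:
  assumes "x \<in> carrier_vec 5" obtains a b c d e where "x = vec5 a b c d e"
proof (rule that)
  show "x = vec5 (x $ 0) (x $ 1) (x $ 2) (x $ 3) (x $ 4)"
    by (rule vec5_eqI[OF assms]) simp_all
qed

lemma vec5_inject [simp]:
  "vec5 a b c d e = vec5 a' b' c' d' e' \<longleftrightarrow> a = a' \<and> b = b' \<and> c = c' \<and> d = d' \<and> e = e'"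
  by (metis vec5_index)

lemma vec5_arith [simp]:
  "vec5 a b c d e + vec5 a' b' c' d' e' = vec5 (a + a') (b + b') (c + c') (d + d') (e + e')"
  "vec5 a b c d e - vec5 a' b' c' d' e' = vec5 (a - a') (b - b') (c - c') (d - d') (e - e')"
  "x \<cdot>\<^sub>v vec5 a b c d e = vec5 (x * a) (x * b) (x * c) (x * d) (x * e)"
  "0\<^sub>v 5 = vec5 0 0 0 0 0"
  by (auto intro!: vec5_eqI)

lemma quad_form_vec5 [simp]: "quad_form 2 (vec5 a b c d e) = a * c + b * d + e * e"
proof -
  have "{..<2::nat} = {0, 1}" by auto
  then show ?thesis by (simp add: quad_form_def power2_eq_square flip: numeral_2_eq_2 numeral_3_eq_3)
qed

lemma polar_form_vec5 [simp]:
  "polar_form 2 (vec5 a b c d e) (vec5 a' b' c' d' e') =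
     a * c' + c * a' + b * d' + d * b' + 2 * e * e'"
  by (simp add: polar_form_def algebra_simps)

lemma siegel_vec5 [simp]:
  fixes a0 :: "'a::field"
  shows "siegel 2 (vec5 a0 a1 a2 a3 a4) (vec5 b0 b1 b2 b3 b4) (vec5 x0 x1 x2 x3 x4) =
    (let p = polar_form 2 (vec5 x0 x1 x2 x3 x4) (vec5 a0 a1 a2 a3 a4);
         q = polar_form 2 (vec5 x0 x1 x2 x3 x4) (vec5 b0 b1 b2 b3 b4)
             + quad_form 2 (vec5 b0 b1 b2 b3 b4) * p
     in vec5 (x0 + p * b0 - q * a0) (x1 + p * b1 - q * a1) (x2 + p * b2 - q * a2)
          (x3 + p * b3 - q * a3) (x4 + p * b4 - q * a4))"
  by (simp add: siegel_def Let_def algebra_simps)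

lemma polar_form_add:
  assumes "x \<in> carrier_vec 5" "y \<in> carrier_vec 5" "z \<in> carrier_vec 5"
  shows "polar_form 2 (x + y) z = polar_form 2 x z + polar_form 2 y z"
    and "polar_form 2 (x - y) z = polar_form 2 x z - polar_form 2 y z"
    and "polar_form 2 (c \<cdot>\<^sub>v x) z = c * polar_form 2 x z"
  using assms by (auto elim!: vec5_cases simp: algebra_simps)

lemma polar_form_commute:
  assumes "x \<in> carrier_vec 5" "y \<in> carrier_vec 5"
  shows "polar_form 2 x y = polar_form 2 y x"
  using assms by (auto elim!: vec5_cases simp: algebra_simps)

lemma polar_form_self:
  assumes "x \<in> carrier_vec 5"
  shows "polar_form 2 x x = 2 * quad_form 2 x"
  using assms by (auto elim!: vec5_cases simp: algebra_simps)

lemma polar_form_add_right: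
  assumes "x \<in> carrier_vec 5" "y \<in> carrier_vec 5" "z \<in> carrier_vec 5"
  shows "polar_form 2 z (x + y) = polar_form 2 z x + polar_form 2 z y"
    and "polar_form 2 z (x - y) = polar_form 2 z x - polar_form 2 z y"
    and "polar_form 2 z (c \<cdot>\<^sub>v x) = c * polar_form 2 z x"
  using assms by (auto elim!: vec5_cases simp: algebra_simps)

lemma quad_form_add:
  assumes "x \<in> carrier_vec 5" "y \<in> carrier_vec 5"
  shows "quad_form 2 (x + y) = quad_form 2 x + quad_form 2 y + polar_form 2 x y"
    and "quad_form 2 (x - y) = quad_form 2 x + quad_form 2 y - polar_form 2 x y"
    and "quad_form 2 (c \<cdot>\<^sub>v x) = c * c * quad_form 2 x"
  using assms by (auto elim!: vec5_cases simp: algebra_simps)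

section \<open>Siegel transformations as isometries\<close>

lemma siegel_eq:
  "x \<in> carrier_vec 5 \<Longrightarrow> siegel 2 u w x =
     x + polar_form 2 x u \<cdot>\<^sub>v w - polar_form 2 x w \<cdot>\<^sub>v u - (quad_form 2 w * polar_form 2 x u) \<cdot>\<^sub>v u"
  by (simp add: siegel_def)

lemma siegel_closed:
  "u \<in> carrier_vec 5 \<Longrightarrow> w \<in> carrier_vec 5 \<Longrightarrow> x \<in> carrier_vec 5 \<Longrightarrow> siegel 2 u w x \<in> carrier_vec 5"
  by (simp add: siegel_eq)

text \<open>Expanding by the polar form, the extra terms cancel because \<open>u\<close> is singular
  and orthogonal to \<open>w\<close> and to itself; this holds in every characteristic.\<close>

lemma siegel_isometry:
  assumes u: "u \<in> carrier_vec 5" "quad_form 2 u = 0" and w: "w \<in> carrier_vec 5" "polar_form 2 u w = 0"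
    and x: "x \<in> carrier_vec 5"
  shows "quad_form 2 (siegel 2 u w x) = quad_form 2 x"
proof -
  have "polar_form 2 w u = 0" "polar_form 2 u u = 0"
    using u w polar_form_commute[OF w(1) u(1)] polar_form_self[OF u(1)] by simp_all
  then show ?thesis
    using u w x
    by (simp add: siegel_eq quad_form_add polar_form_add polar_form_add_right algebra_simps)
qed

lemma siegel_linear:
  assumes "u \<in> carrier_vec 5" "w \<in> carrier_vec 5" "x \<in> carrier_vec 5" "y \<in> carrier_vec 5"
  shows "siegel 2 u w (x + y) = siegel 2 u w x + siegel 2 u w y"
    and "siegel 2 u w (x - y) = siegel 2 u w x - siegel 2 u w y"
    and "siegel 2 u w (c \<cdot>\<^sub>v x) = c \<cdot>\<^sub>v siegel 2 u w x"
  using assms by (auto elim!: vec5_cases simp: Let_def algebra_simps)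

lemma siegel_polar:
  assumes u: "u \<in> carrier_vec 5" "quad_form 2 u = 0" and w: "w \<in> carrier_vec 5" "polar_form 2 u w = 0"
    and x: "x \<in> carrier_vec 5" and y: "y \<in> carrier_vec 5"
  shows "polar_form 2 (siegel 2 u w x) (siegel 2 u w y) = polar_form 2 x y"
  using x y u(1) w(1) siegel_isometry[OF u w, of "x + y"] siegel_isometry[OF u w x] siegel_isometry[OF u w y]
  by (simp add: polar_form_def siegel_linear)

text \<open>An isometry conjugates the Siegel transformation of \<open>(u, w)\<close> into the one
  of the image pair. This transports statements from one singular vector to another.\<close>

lemma siegel_siegel:
  assumes u: "u \<in> carrier_vec 5" "quad_form 2 u = 0" and w: "w \<in> carrier_vec 5" "polar_form 2 u w = 0"
    and x: "x \<in> carrier_vec 5"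
    and a: "a \<in> carrier_vec 5" "quad_form 2 a = 0" and b: "b \<in> carrier_vec 5" "polar_form 2 a b = 0"
  shows "siegel 2 a b (siegel 2 u w x) = siegel 2 (siegel 2 a b u) (siegel 2 a b w) (siegel 2 a b x)"
proof -
  show ?thesis
    using u w x a b
    by (simp add: siegel_eq[of "siegel 2 a b x"] siegel_eq[of x u w] siegel_closed siegel_polar siegel_isometry siegel_linear)
qed

text \<open>For fixed \<open>u\<close> Siegel transformations compose by adding the vectors
  \<open>w\<close>, so \<open>- w\<close> gives the inverse.\<close>

lemma siegel_inverse:
  assumes u: "u \<in> carrier_vec 5" "quad_form 2 u = 0" and w: "w \<in> carrier_vec 5" "polar_form 2 u w = 0"
    and x: "x \<in> carrier_vec 5"
  shows "siegel 2 u ((-1) \<cdot>\<^sub>v w) (siegel 2 u w x) = x"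
proof -
  define p where "p = polar_form 2 x u"
  define r where "r = polar_form 2 x w"
  define q where "q = quad_form 2 w"
  have y: "siegel 2 u w x = x + p \<cdot>\<^sub>v w - r \<cdot>\<^sub>v u - (q * p) \<cdot>\<^sub>v u" (is "_ = ?y")
    using x by (simp add: siegel_eq p_def q_def r_def)
  have yC: "?y \<in> carrier_vec 5" using u w x by simp
  have uw: "polar_form 2 w u = 0" using w polar_form_commute[OF w(1) u(1)] by simp
  have 1: "polar_form 2 ?y u = p"
    using u w x uw polar_form_self[OF u(1)] by (simp add: polar_form_add p_def)
  have 2: "polar_form 2 ?y ((-1) \<cdot>\<^sub>v w) = - (r + 2 * q * p)"
    using u w x uw polar_form_self[OF w(1)]
    by (simp add: polar_form_add polar_form_add_right r_def[symmetric] q_def[symmetric] algebra_simps)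
  have 3: "quad_form 2 ((-1) \<cdot>\<^sub>v w) = q" using w by (simp add: quad_form_add q_def)
  have "siegel 2 u ((-1) \<cdot>\<^sub>v w) ?y =
      ?y + p \<cdot>\<^sub>v ((-1) \<cdot>\<^sub>v w) - (- (r + 2 * q * p)) \<cdot>\<^sub>v u - (q * p) \<cdot>\<^sub>v u"
    by (subst siegel_eq[OF yC]) (simp only: 1 2 3)
  also have "\<dots> = x"
    using u(1) w(1) x by (auto elim!: vec5_cases simp: algebra_simps)
  finally show ?thesis unfolding y .
qed

lemma siegel_set_subset: "siegel_set 2 \<subseteq> Bij (carrier_vec 5 :: 'a::field vec set)"
proof
  fix f :: "'a vec \<Rightarrow> 'a vec" assume "f \<in> siegel_set 2"
  then obtain u w where f: "f = siegel 2 u w" and u: "u \<in> carrier_vec 5" "quad_form 2 u = 0"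
    and w: "w \<in> carrier_vec 5" "polar_form 2 u w = 0"
    by (auto simp: siegel_set_def)
  define v where "v = (-1) \<cdot>\<^sub>v w"
  have v: "v \<in> carrier_vec 5" "polar_form 2 u v = 0"
    using u w polar_form_commute[OF u(1)] by (auto simp: v_def polar_form_add)
  have "(-1) \<cdot>\<^sub>v v = w" using w(1) by (auto elim!: vec5_cases simp: v_def)
  then have "bij_betw f (carrier_vec 5) (carrier_vec 5)"
    using siegel_inverse[OF u w] siegel_inverse[OF u v] u(1) w(1) v(1)
    by (intro bij_betwI[of _ _ _ "siegel 2 u v"]) (auto simp: f siegel_closed v_def[symmetric])
  moreover have "f \<in> extensional (carrier_vec 5)" by (simp add: f siegel_def)
  ultimately show "f \<in> Bij (carrier_vec 5)" by (simp add: Bij_def)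
qed

text \<open>Bivectors on which the contraction with the symplectic form vanishes; the quadratic form
  becomes the Pfaffian.\<close>

definition bivector :: "'a::field vec \<Rightarrow> 'a mat" where
  "bivector x = mat4 0 (x $ 0) (x $ 4) (x $ 1)  (- x $ 0) 0 (x $ 3) (- x $ 4)
     (- x $ 4) (- x $ 3) 0 (x $ 2)  (- x $ 1) (x $ 4) (- x $ 2) 0"

lemma bivector_carrier [simp]: "bivector x \<in> carrier_mat 4 4"
  by (simp add: bivector_def)

lemma bivector_inject:
  assumes "x \<in> carrier_vec 5" "y \<in> carrier_vec 5" "bivector x = bivector y"
  shows "x = y"
  using assms by (auto simp: bivector_def intro!: vec5_eqI)

text \<open>On alternating matrices this is the exterior square action, the bivector of two columns
  \<open>x\<close> and \<open>y\<close> being \<open>x y^T - y x^T\<close>.\<close>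

definition congr :: "'a::field mat \<Rightarrow> 'a mat \<Rightarrow> 'a mat" where
  "congr A X = A * X * transpose_mat A"

lemma congr_carrier [simp]:
  "A \<in> carrier_mat n n \<Longrightarrow> X \<in> carrier_mat n n \<Longrightarrow> congr A X \<in> carrier_mat n n"
  by (simp add: congr_def)

lemma congr_one: "X \<in> carrier_mat n n \<Longrightarrow> congr (1\<^sub>m n) X = X"
  by (simp add: congr_def)

lemma congr_mult:
  assumes "A \<in> carrier_mat n n" "B \<in> carrier_mat n n" "X \<in> carrier_mat n n"
  shows "congr (A * B) X = congr A (congr B X)"
  using assms by (simp add: congr_def transpose_mult[of A n n B n] assoc_mult_mat[of _ n n _ n _ n])

text \<open>The row \<open>(pk, qk)\<close> is proportional to two linearly independent rows, hence
  zero.\<close>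

lemma proportional_pair_zero:
  fixes p0 :: "'a::field"
  assumes "p0 * q1 - p1 * q0 \<noteq> 0" "p0 * qk = pk * q0" "p1 * qk = pk * q1"
  shows "pk = 0" "qk = 0"
proof -
  have "qk * (p0 * q1 - p1 * q0) = q1 * (p0 * qk) - q0 * (p1 * qk)" by (simp add: algebra_simps)
  also have "\<dots> = 0" unfolding assms(2,3) by (simp add: algebra_simps)
  finally show "qk = 0" using assms(1) by simp
  then show "pk = 0" using assms by auto
qed

text \<open>The first four vectors are the decomposable bivectors of four coordinate planes.
  \<open>A\<close> preserves these planes, and every coordinate axis is the intersection of two of
  them, so \<open>A\<close> is diagonal. The products of cyclically adjacent diagonal entries and,
  from the fifth vector, of an opposite pair all equal \<open>c\<close>, so the entries
  agree.\<close>

lemma scalar_if_congr_bivector: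
  assumes A: "A \<in> carrier_mat 4 4" and c: "c \<noteq> (0::'a::field)"
    and eq: "\<And>x. x \<in> {vec5 1 0 0 0 0, vec5 0 1 0 0 0, vec5 0 0 1 0 0, vec5 0 0 0 1 0, vec5 0 0 0 0 1} \<Longrightarrow>
      congr A (bivector x) = c \<cdot>\<^sub>m bivector x"
  obtains d where "A = d \<cdot>\<^sub>m 1\<^sub>m 4"
proof -
  obtain a00 a01 a02 a03 a10 a11 a12 a13 a20 a21 a22 a23 a30 a31 a32 a33
    where Aeq: "A = mat4 a00 a01 a02 a03 a10 a11 a12 a13 a20 a21 a22 a23 a30 a31 a32 a33"
    using A by (rule mat4_cases)
  have entry: "X $$ (i,j) = Y $$ (i,j)" if "X = Y" for X Y :: "'a mat" and i j using that by simp
  note ev = Aeq congr_def bivector_def algebra_simps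
  have eq0: "congr A (bivector (vec5 1 0 0 0 0)) = c \<cdot>\<^sub>m bivector (vec5 1 0 0 0 0)"
    by (rule eq) simp
  have eq1: "congr A (bivector (vec5 0 1 0 0 0)) = c \<cdot>\<^sub>m bivector (vec5 0 1 0 0 0)"
    by (rule eq) simp
  have eq2: "congr A (bivector (vec5 0 0 1 0 0)) = c \<cdot>\<^sub>m bivector (vec5 0 0 1 0 0)"
    by (rule eq) simp
  have eq3: "congr A (bivector (vec5 0 0 0 1 0)) = c \<cdot>\<^sub>m bivector (vec5 0 0 0 1 0)"
    by (rule eq) simp
  have eq4: "congr A (bivector (vec5 0 0 0 0 1)) = c \<cdot>\<^sub>m bivector (vec5 0 0 0 0 1)"
    by (rule eq) simp
  have m0: "a00 * a11 - a10 * a01 = c"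
    using entry[OF eq0, of 0 "Suc 0"]
    by (simp add: ev)
  have "a00 * a21 = a20 * a01"
    using entry[OF eq0, of 0 2]
    by (simp add: ev)
  moreover have "a10 * a21 = a20 * a11"
    using entry[OF eq0, of "Suc 0" 2]
    by (simp add: ev)
  ultimately have z02: "a20 = 0" "a21 = 0"
    using proportional_pair_zero[of a00 a11 a10 a01 a21 a20] m0 c by simp_all
  have "a00 * a31 = a30 * a01"
    using entry[OF eq0, of 0 3]
    by (simp add: ev)
  moreover have "a10 * a31 = a30 * a11"
    using entry[OF eq0, of "Suc 0" 3]
    by (simp add: ev)
  ultimately have z03: "a30 = 0" "a31 = 0"
    using proportional_pair_zero[of a00 a11 a10 a01 a31 a30] m0 c by simp_all
  have m1: "a00 * a33 - a30 * a03 = c"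
    using entry[OF eq1, of 0 3]
    by (simp add: ev)
  have "a00 * a13 = a10 * a03"
    using entry[OF eq1, of 0 "Suc 0"]
    by (simp add: ev)
  moreover have "a30 * a13 = a10 * a33"
    using entry[OF eq1, of 3 "Suc 0"]
    by (simp add: ev)
  ultimately have z11: "a10 = 0" "a13 = 0"
    using proportional_pair_zero[of a00 a33 a30 a03 a13 a10] m1 c by simp_all
  have "a00 * a23 = a20 * a03"
    using entry[OF eq1, of 0 2]
    by (simp add: ev)
  moreover have "a30 * a23 = a20 * a33"
    using entry[OF eq1, of 3 2]
    by (simp add: ev)
  ultimately have z12: "a20 = 0" "a23 = 0"
    using proportional_pair_zero[of a00 a33 a30 a03 a23 a20] m1 c by simp_all
  have m2: "a22 * a33 - a32 * a23 = c"
    using entry[OF eq2, of 2 3]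
    by (simp add: ev)
  have "a22 * a03 = a02 * a23"
    using entry[OF eq2, of 2 0]
    by (simp add: ev)
  moreover have "a32 * a03 = a02 * a33"
    using entry[OF eq2, of 3 0]
    by (simp add: ev)
  ultimately have z20: "a02 = 0" "a03 = 0"
    using proportional_pair_zero[of a22 a33 a32 a23 a03 a02] m2 c by simp_all
  have "a22 * a13 = a12 * a23"
    using entry[OF eq2, of 2 "Suc 0"]
    by (simp add: ev)
  moreover have "a32 * a13 = a12 * a33"
    using entry[OF eq2, of 3 "Suc 0"]
    by (simp add: ev)
  ultimately have z21: "a12 = 0" "a13 = 0"
    using proportional_pair_zero[of a22 a33 a32 a23 a13 a12] m2 c by simp_all
  have m3: "a11 * a22 - a21 * a12 = c"
    using entry[OF eq3, of "Suc 0" 2]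
    by (simp add: ev)
  have "a11 * a02 = a01 * a12"
    using entry[OF eq3, of "Suc 0" 0]
    by (simp add: ev)
  moreover have "a21 * a02 = a01 * a22"
    using entry[OF eq3, of 2 0]
    by (simp add: ev)
  ultimately have z30: "a01 = 0" "a02 = 0"
    using proportional_pair_zero[of a11 a22 a21 a12 a02 a01] m3 c by simp_all
  have "a11 * a32 = a31 * a12"
    using entry[OF eq3, of "Suc 0" 3]
    by (simp add: ev)
  moreover have "a21 * a32 = a31 * a22"
    using entry[OF eq3, of 2 3]
    by (simp add: ev)
  ultimately have z33: "a31 = 0" "a32 = 0"
    using proportional_pair_zero[of a11 a22 a21 a12 a32 a31] m3 c by simp_all
  note z = z02 z03 z11 z12 z20 z21 z30 z33
  have m4: "a00 * a22 = c"
    using entry[OF eq4, of 0 2]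
    by (simp add: Aeq congr_def bivector_def z)
  have "a00 * a11 = c" "a00 * a33 = c" "a22 * a33 = c" "a11 * a22 = c"
    using m0 m1 m2 m3 by (simp_all add: z)
  moreover have "a00 \<noteq> 0" "a22 \<noteq> 0" using m4 c by auto
  ultimately have "a11 = a22" "a33 = a22" "a11 = a00" using m4 by (metis mult_cancel_left mult_cancel_right)+
  then have "A = a00 \<cdot>\<^sub>m 1\<^sub>m 4" by (simp add: Aeq z)
  then show ?thesis by (rule that)
qed

section \<open>Lifting Siegel transformations to the symplectic group\<close>

definition lifts :: "'a::field vec \<Rightarrow> bool" where
  "lifts u \<longleftrightarrow> (\<forall>w\<in>carrier_vec 5. polar_form 2 u w = 0 \<longrightarrow>
     (\<exists>h\<in>carrier (Sp 2 TYPE('a)). \<forall>x\<in>carrier_vec 5. bivector (siegel 2 u w x) = congr h (bivector x)))"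

text \<open>\<open>upper s t u\<close> fixes the first two basis vectors, hence their bivector,
  which is the singular vector of the Siegel transformation; the entries of the block give
  \<open>w\<close>. \<open>congr_lower\<close> is the same for the last two basis vectors.\<close>

lemma congr_upper:
  assumes "x \<in> carrier_vec 5"
  shows "congr (upper s t u) (bivector x) = bivector (siegel 2 (vec5 1 0 0 0 0) (vec5 0 s 0 (- u) (- t)) x)"
  using assms by (rule vec5_cases) (simp add: congr_def upper_def bivector_def Let_def algebra_simps)

lemma congr_lower:
  assumes "x \<in> carrier_vec 5"
  shows "congr (lower s t u) (bivector x) = bivector (siegel 2 (vec5 0 0 1 0 0) (vec5 0 u 0 (- s) t) x)"
  using assms by (rule vec5_cases) (simp add: congr_def lower_def bivector_def Let_def algebra_simps)

lemma lifts_first: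
  assumes "c \<noteq> 0" shows "lifts (vec5 c 0 0 0 0)"
  unfolding lifts_def
proof (intro ballI impI)
  fix w :: "'a vec" assume "w \<in> carrier_vec 5" and p: "polar_form 2 (vec5 c 0 0 0 0) w = 0"
  then obtain w0 w1 w2 w3 w4 where w: "w = vec5 w0 w1 w2 w3 w4" by (blast elim: vec5_cases)
  have w2: "w2 = 0" using p assms by (simp add: w)
  \<comment> \<open>A factor \<open>c\<close> moves from the singular vector to \<open>w\<close>,
    and the component of \<open>w\<close> along the singular vector cancels.\<close>
  have "bivector (siegel 2 (vec5 c 0 0 0 0) w x) = congr (upper (c * w1) (- c * w4) (- c * w3)) (bivector x)"
    if "x \<in> carrier_vec 5" for x
    using that unfolding congr_upper[OF that]
    by (rule vec5_cases) (simp add: w w2 Let_def algebra_simps)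
  then show "\<exists>h\<in>carrier (Sp 2 TYPE('a)). \<forall>x\<in>carrier_vec 5.
      bivector (siegel 2 (vec5 c 0 0 0 0) w x) = congr h (bivector x)"
    using upper_lower_in_Sp(1) by blast
qed

lemma lifts_third:
  assumes "c \<noteq> 0" shows "lifts (vec5 0 0 c 0 0)"
  unfolding lifts_def
proof (intro ballI impI)
  fix w :: "'a vec" assume "w \<in> carrier_vec 5" and p: "polar_form 2 (vec5 0 0 c 0 0) w = 0"
  then obtain w0 w1 w2 w3 w4 where w: "w = vec5 w0 w1 w2 w3 w4" by (blast elim: vec5_cases)
  have w0: "w0 = 0" using p assms by (simp add: w)
  have "bivector (siegel 2 (vec5 0 0 c 0 0) w x) = congr (lower (- c * w3) (c * w4) (c * w1)) (bivector x)"
    if "x \<in> carrier_vec 5" for x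
    using that unfolding congr_lower[OF that]
    by (rule vec5_cases) (simp add: w w0 Let_def algebra_simps)
  then show "\<exists>h\<in>carrier (Sp 2 TYPE('a)). \<forall>x\<in>carrier_vec 5.
      bivector (siegel 2 (vec5 0 0 c 0 0) w x) = congr h (bivector x)"
    using upper_lower_in_Sp(2) by blast
qed

text \<open>If \<open>g\<close> lifts the isometry and \<open>h\<close> the transported
  transformation, then \<open>inv g * h * g\<close> lifts the original one. Since
  \<open>lifts\<close> quantifies over all \<open>w\<close>, it is a property of the singular vector
  alone and can be moved in this way.\<close>

lemma lifts_if_lifts_siegel:
  fixes u :: "'a::field vec"
  assumes u: "u \<in> carrier_vec 5" "quad_form 2 u = 0"
    and a: "a \<in> carrier_vec 5" "quad_form 2 a = 0" and b: "b \<in> carrier_vec 5" "polar_form 2 a b = 0"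
    and g: "g \<in> carrier (Sp 2 TYPE('a))"
      "\<And>x. x \<in> carrier_vec 5 \<Longrightarrow> congr g (bivector x) = bivector (siegel 2 a b x)"
    and l: "lifts (siegel 2 a b u)"
  shows "lifts u"
  unfolding lifts_def
proof (intro ballI impI)
  interpret group "Sp 2 TYPE('a)" by (rule group_Sp_2)
  let ?\<phi> = "siegel 2 a b"
  fix w :: "'a vec" assume w: "w \<in> carrier_vec 5" "polar_form 2 u w = 0"
  then have "polar_form 2 (?\<phi> u) (?\<phi> w) = 0" using siegel_polar[OF a b u(1) w(1)] by simp
  then obtain h where h: "h \<in> carrier (Sp 2 TYPE('a))"
    and hx: "\<And>x. x \<in> carrier_vec 5 \<Longrightarrow> bivector (siegel 2 (?\<phi> u) (?\<phi> w) x) = congr h (bivector x)"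
    using l siegel_closed[OF a(1) b(1) w(1)] unfolding lifts_def by blast
  define k where "k = inv\<^bsub>Sp 2 TYPE('a)\<^esub> g"
  have k: "k \<in> carrier (Sp 2 TYPE('a))" and kg: "k * g = 1\<^sub>m 4"
    using g(1) l_inv[OF g(1)] inv_closed[OF g(1)] by (simp_all add: k_def)
  have c: "k \<in> carrier_mat 4 4" "g \<in> carrier_mat 4 4" "h \<in> carrier_mat 4 4" using k g(1) h by simp_all
  have "bivector (siegel 2 u w x) = congr (k * (h * g)) (bivector x)" if x: "x \<in> carrier_vec 5" for x
  proof -
    have "bivector (siegel 2 u w x) = congr (k * g) (bivector (siegel 2 u w x))"
      unfolding kg by (simp add: congr_one del: mat4_arith)
    also have "\<dots> = congr k (congr g (bivector (siegel 2 u w x)))"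
      using c by (simp add: congr_mult)
    also have "\<dots> = congr k (bivector (siegel 2 (?\<phi> u) (?\<phi> w) (?\<phi> x)))"
      using g(2) siegel_siegel[OF u w x a b] siegel_closed[OF u(1) w(1) x] by simp
    also have "\<dots> = congr k (congr h (congr g (bivector x)))"
      using hx[OF siegel_closed[OF a(1) b(1) x]] g(2)[OF x] by simp
    finally show ?thesis using c by (simp add: congr_mult)
  qed
  moreover have "k * (h * g) \<in> carrier (Sp 2 TYPE('a))"
    using m_closed[OF k m_closed[OF h g(1)]] by simp
  ultimately show "\<exists>h\<in>carrier (Sp 2 TYPE('a)). \<forall>x\<in>carrier_vec 5.
      bivector (siegel 2 u w x) = congr h (bivector x)" by blast
qed

lemma lifts_upper:
  fixes u :: "'a::field vec"
  assumes u: "u \<in> carrier_vec 5" "quad_form 2 u = 0"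
    and l: "lifts (siegel 2 (vec5 1 0 0 0 0) (vec5 0 r 0 s t) u)"
  shows "lifts u"
proof (rule lifts_if_lifts_siegel[OF u _ _ _ _ upper_lower_in_Sp(1) _ l])
  show "congr (upper r (- t) (- s)) (bivector x) =
      bivector (siegel 2 (vec5 1 0 0 0 0) (vec5 0 r 0 s t) x)" if "x \<in> carrier_vec 5" for x
    using congr_upper[OF that] by simp
qed simp_all

lemma lifts_lower:
  fixes u :: "'a::field vec"
  assumes u: "u \<in> carrier_vec 5" "quad_form 2 u = 0"
    and l: "lifts (siegel 2 (vec5 0 0 1 0 0) (vec5 0 r 0 s t) u)"
  shows "lifts u"
proof (rule lifts_if_lifts_siegel[OF u _ _ _ _ upper_lower_in_Sp(2) _ l])
  show "congr (lower (- s) t r) (bivector x) =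
      bivector (siegel 2 (vec5 0 0 1 0 0) (vec5 0 r 0 s t) x)" if "x \<in> carrier_vec 5" for x
    using congr_lower[OF that] by simp
qed simp_all

text \<open>A singular vector with nonzero third coordinate is moved by an upper Siegel
  transformation to a multiple of the third basis vector, and symmetrically for the first. If both
  coordinates are zero, it is first moved to a vector with nonzero first coordinate.\<close>

lemma lifts_singular:
  fixes u :: "'a::field vec"
  assumes u: "u \<in> carrier_vec 5" "quad_form 2 u = 0" "u \<noteq> 0\<^sub>v 5"
  shows "lifts u"
proof -
  have third: "lifts v" if v: "v = vec5 a b c d e" and q: "quad_form 2 v = 0" and c: "c \<noteq> 0"
    for v :: "'a vec" and a b c d e
  \<comment> \<open>The parameters cancel the second, fourth and fifth coordinates; the first then
    vanishes by itself, because the result is still singular.\<close>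
  proof (rule lifts_upper[of _ "- b / c" "- d / c" "- e / c"])
    obtain a' where eq: "siegel 2 (vec5 1 0 0 0 0) (vec5 0 (- b / c) 0 (- d / c) (- e / c)) v = vec5 a' 0 c 0 0"
      using c by (simp add: v Let_def)
    have "quad_form 2 (vec5 a' 0 c 0 0) = quad_form 2 v"
      unfolding eq[symmetric] by (rule siegel_isometry) (simp_all add: v)
    then have "a' = 0" using q c by simp
    then show "lifts (siegel 2 (vec5 1 0 0 0 0) (vec5 0 (- b / c) 0 (- d / c) (- e / c)) v)"
      using eq lifts_third[OF c] by simp
  qed (use v q in simp_all)
  have first: "lifts v" if v: "v = vec5 a b c d e" and q: "quad_form 2 v = 0" and a: "a \<noteq> 0"
    for v :: "'a vec" and a b c d e
  proof (rule lifts_lower[of _ "- b / a" "- d / a" "- e / a"])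
    obtain c' where eq: "siegel 2 (vec5 0 0 1 0 0) (vec5 0 (- b / a) 0 (- d / a) (- e / a)) v = vec5 a 0 c' 0 0"
      using a by (simp add: v Let_def)
    have "quad_form 2 (vec5 a 0 c' 0 0) = quad_form 2 v"
      unfolding eq[symmetric] by (rule siegel_isometry) (simp_all add: v)
    then have "c' = 0" using q a by simp
    then show "lifts (siegel 2 (vec5 0 0 1 0 0) (vec5 0 (- b / a) 0 (- d / a) (- e / a)) v)"
      using eq lifts_first[OF a] by simp
  qed (use v q in simp_all)
  obtain a b c d e where v: "u = vec5 a b c d e" using u(1) by (rule vec5_cases)
  consider "c \<noteq> 0" | "a \<noteq> 0" | "a = 0" "c = 0" by blast
  then show ?thesis
  proof cases
    case 1 then show ?thesis using third[OF v u(2)] by blast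
  next
    case 2 then show ?thesis using first[OF v u(2)] by blast
  next
    case 3
    \<comment> \<open>Otherwise the quadratic form reduces to the square of \<open>e\<close>, so
      \<open>u\<close> would be 0.\<close>
    have "b \<noteq> 0 \<or> d \<noteq> 0" using u(2,3) 3 by (auto simp: v)
    then obtain r s where rs: "b * s + d * r \<noteq> 0" by (metis add_0 add_0_right mult.right_neutral mult_zero_right)
    let ?w = "siegel 2 (vec5 1 0 0 0 0) (vec5 0 r 0 s 0) u"
    have w: "?w = vec5 (- (b * s + d * r)) b 0 d e" using 3 by (simp add: v Let_def algebra_simps)
    have "quad_form 2 ?w = 0"
      by (subst siegel_isometry) (use u in simp_all)
    then have "lifts ?w"
      using rs by (intro first[OF w]) (simp_all add: neg_eq_iff_add_eq_0)
    then show ?thesis by (rule lifts_upper[OF u(1,2)])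
  qed
qed

lemma siegel_group_simps:
  "carrier (siegel_group 2 F) = generate (BijGroup (carrier_vec 5)) (siegel_set 2)"
  "mult (siegel_group 2 F) = mult (BijGroup (carrier_vec 5))"
  "one (siegel_group 2 F) = (\<lambda>x\<in>carrier_vec 5. x)"
  by (simp_all add: siegel_group_def BijGroup_def)

text \<open>Both kernels come from one fact: a symplectic matrix related to a scalar map is scalar.
  The group property of type B is a by-product, since Goursat's lemma also yields normality of the
  subgroup of scalar maps.\<close>

theorem type_C_2_iso_type_B_2:
  shows "type_C 2 TYPE('a::field) \<cong> type_B 2 TYPE('a)" and "group (type_B 2 TYPE('a))"
proof -
  let ?C = "carrier_vec 5 :: 'a vec set"
  let ?B = "BijGroup ?C" and ?G = "Sp 2 TYPE('a)" and ?S = "siegel_group 2 TYPE('a)"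
  interpret B: group ?B by (rule group_BijGroup)
  interpret G: group ?G by (rule group_Sp_2)
  have sub: "siegel_set 2 \<subseteq> carrier ?B"
    using siegel_set_subset by (simp add: BijGroup_def)
  have sg: "subgroup (generate ?B (siegel_set 2)) ?B" by (rule B.generate_is_subgroup[OF sub])
  have S: "?S = ?B\<lparr>carrier := generate ?B (siegel_set 2)\<rparr>" by (simp add: siegel_group_def)
  have groupS: "group ?S" unfolding S by (rule B.subgroup_imp_group[OF sg])
  interpret S: group ?S by (rule groupS)
  have SB: "f \<in> Bij ?C" if "f \<in> carrier ?S" for f
    using that subgroup.subset[OF sg] by (auto simp: siegel_group_simps BijGroup_def)
  have Sgen: "carrier ?S = generate ?S (siegel_set 2)"
    using B.generate_consistent[OF _ sg, of "siegel_set 2"] generate.incl[of _ "siegel_set 2" ?B]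
    by (auto simp: siegel_group_simps(1) S)
  define R where "R = intertwiners ?G ?S congr (\<lambda>f x. f x) ?C bivector"
  have R: "subgroup R (?G \<times>\<times> ?S)"
    unfolding R_def
  proof (rule subgroup_intertwiners[OF G.is_group groupS, where V = "carrier_mat 4 4"])
    show "f x \<in> ?C" if "f \<in> carrier ?S" "x \<in> ?C" for f x
      using Bij_imp_funcset[OF SB[OF that(1)]] that(2) by auto
    show "(f \<otimes>\<^bsub>?S\<^esub> f') x = f (f' x)" if "f \<in> carrier ?S" "f' \<in> carrier ?S" "x \<in> ?C" for f f' x
      using that SB by (simp add: siegel_group_simps(2) BijGroup_def compose_def)
  qed (auto simp: congr_one congr_mult siegel_group_simps(3) simp del: mat4_arith)
  have lift: "\<exists>h. (h, f) \<in> R" if "f \<in> siegel_set 2" for f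
  proof -
    obtain u w where f: "f = siegel 2 u w" and u: "u \<in> ?C" "quad_form 2 u = 0" "u \<noteq> 0\<^sub>v 5"
      and w: "w \<in> ?C" "polar_form 2 u w = 0"
      using \<open>f \<in> _\<close> by (auto simp: siegel_set_def)
    have "f \<in> carrier ?S" using that by (simp add: siegel_group_simps(1) generate.incl)
    moreover obtain h where "h \<in> carrier ?G" "\<forall>x\<in>?C. bivector (siegel 2 u w x) = congr h (bivector x)"
      using lifts_singular[OF u] w unfolding lifts_def by blast
    ultimately have "(h, f) \<in> R" by (simp add: R_def intertwiners_def f)
    then show ?thesis ..
  qed
  have drop: "\<exists>f. (h, f) \<in> R" if hU: "h \<in> unipotents" for h
  proof -
    have hG: "h \<in> carrier ?G" using hU unipotents_subset by blast
    consider s t u where "h = upper s t u" | s t u where "h = lower s t u"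
      using hU by (auto simp: unipotents_def)
    then obtain u w where f: "\<forall>x\<in>?C. congr h (bivector x) = bivector (siegel 2 u w x)" "siegel 2 u w \<in> siegel_set 2"
    proof cases
      case 1
      have "siegel 2 (vec5 1 0 0 0 0) (vec5 0 s 0 (- u) (- t)) \<in> siegel_set 2"
        unfolding siegel_set_def
        by (rule CollectI, intro exI[of _ "vec5 1 0 0 0 0"] exI[of _ "vec5 0 s 0 (- u) (- t)"]) simp
      then show ?thesis using that congr_upper unfolding 1 by blast
    next
      case 2
      have "siegel 2 (vec5 0 0 1 0 0) (vec5 0 u 0 (- s) t) \<in> siegel_set 2"
        unfolding siegel_set_def
        by (rule CollectI, intro exI[of _ "vec5 0 0 1 0 0"] exI[of _ "vec5 0 u 0 (- s) t"]) simp
      then show ?thesis using that congr_lower unfolding 2 by blast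
    qed
    then have "siegel 2 u w \<in> carrier ?S" by (simp add: siegel_group_simps(1) generate.incl)
    then have "(h, siegel 2 u w) \<in> R" using f hG by (simp add: R_def intertwiners_def)
    then show ?thesis by blast
  qed
  have proj: "fst ` R = carrier ?G" "snd ` R = carrier ?S"
    by (rule generated_projections[OF G.is_group groupS R Sp_2_generated_by_unipotents drop Sgen lift]; assumption)+
  have scalar: "\<exists>d. h = d \<cdot>\<^sub>m 1\<^sub>m 4 \<and> d\<^sup>2 = 1"
    if hf: "(h, f) \<in> R" and c: "\<And>x. x \<in> ?C \<Longrightarrow> f x = c \<cdot>\<^sub>v x" for h f c
  proof -
    have h: "h \<in> carrier_mat 4 4" "transpose_mat h * J4 * h = J4"
      and e: "\<And>x. x \<in> ?C \<Longrightarrow> congr h (bivector x) = bivector (f x)" and f: "f \<in> carrier ?S"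
      using hf by (auto simp: R_def intertwiners_def)
    have "c \<noteq> 0"
    proof
      assume "c = 0"
      then have "f (vec5 1 0 0 0 0) = f (vec5 0 0 0 0 0)" by (simp add: c)
      moreover have "inj_on f ?C" using SB[OF f] by (simp add: Bij_def bij_betw_def)
      ultimately have "vec5 1 0 0 0 0 = vec5 0 0 0 0 (0::'a)"
        by (elim inj_onD) simp_all
      then show False by simp
    qed
    moreover have "congr h (bivector x) = c \<cdot>\<^sub>m bivector x" if "x \<in> ?C" for x
      using e[OF that] that c[OF that] by (auto simp: bivector_def)
    ultimately obtain d where d: "h = d \<cdot>\<^sub>m 1\<^sub>m 4" using scalar_if_congr_bivector[OF h(1), of c] vec5_carrier by (metis insertE singletonD)
    moreover have "d\<^sup>2 = 1" using h(2) by (simp add: d J4_def power2_eq_square)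
    ultimately show ?thesis by blast
  qed
  have scalarR: "(d \<cdot>\<^sub>m 1\<^sub>m 4, \<one>\<^bsub>?S\<^esub>) \<in> R" if "d\<^sup>2 = 1" for d
  proof -
    have dd: "d * (d * y) = y" for y
      using that by (simp add: power2_eq_square flip: mult.assoc)
    have "d \<cdot>\<^sub>m 1\<^sub>m 4 \<in> carrier ?G" using that by (simp add: J4_def dd power2_eq_square)
    moreover have "congr (d \<cdot>\<^sub>m 1\<^sub>m 4) (bivector x) = bivector x" for x
      by (simp add: congr_def bivector_def dd mult.commute[of _ d])
    ultimately show ?thesis
      using S.one_closed by (simp add: R_def intertwiners_def siegel_group_simps(3))
  qed
  have kerG: "{h. (h, \<one>\<^bsub>?S\<^esub>) \<in> R} = group_center ?G"
    unfolding Sp_2_center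
  proof (intro equalityI subsetI)
    fix h assume "h \<in> {h. (h, \<one>\<^bsub>?S\<^esub>) \<in> R}"
    then have hR: "(h, \<one>\<^bsub>?S\<^esub>) \<in> R" by blast
    have "\<exists>d. h = d \<cdot>\<^sub>m 1\<^sub>m 4 \<and> d\<^sup>2 = 1"
      by (rule scalar[OF hR, of 1]) (auto simp: siegel_group_simps(3))
    then show "h \<in> {c \<cdot>\<^sub>m 1\<^sub>m 4 |c. c\<^sup>2 = 1}" by blast
  qed (use scalarR in blast)
  have kerS: "{f. (\<one>\<^bsub>?G\<^esub>, f) \<in> R} = carrier ?S \<inter> scalar_maps (2 * 2 + 1)"
  proof (intro equalityI subsetI)
    fix f assume "f \<in> {f. (\<one>\<^bsub>?G\<^esub>, f) \<in> R}"
    then have f: "f \<in> carrier ?S" and e: "\<And>x. x \<in> ?C \<Longrightarrow> bivector x = bivector (f x)"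
      by (auto simp: R_def intertwiners_def congr_one simp del: mat4_arith)
    have "f x = x" if x: "x \<in> ?C" for x
    proof -
      have fx: "f x \<in> ?C" using Bij_imp_funcset[OF SB[OF f]] x by blast
      show ?thesis by (rule bivector_inject[OF x fx e[OF x], symmetric])
    qed
    then have "f = (\<lambda>x\<in>?C. 1 \<cdot>\<^sub>v x)"
      using Bij_imp_extensional[OF SB[OF f]] by (auto simp: extensional_def)
    then have "f \<in> scalar_maps 5" unfolding scalar_maps_def by blast
    then show "f \<in> carrier ?S \<inter> scalar_maps (2 * 2 + 1)" using f by simp
  next
    fix f assume "f \<in> carrier ?S \<inter> scalar_maps (2 * 2 + 1)"
    then obtain c where f: "f \<in> carrier ?S" and c: "f = (\<lambda>x\<in>?C. c \<cdot>\<^sub>v x)"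
      by (auto simp: scalar_maps_def)
    obtain h where hf: "(h, f) \<in> R" using f proj(2) by force
    \<comment> \<open>Since \<open>d\<close> squares to 1, the partner \<open>h\<close> acts
      trivially on bivectors, so \<open>f\<close> is the identity: the Siegel group contains no
      other scalar map.\<close>
    obtain d where d: "h = d \<cdot>\<^sub>m 1\<^sub>m 4" "d\<^sup>2 = 1" using scalar[OF hf, of c] c by auto
    have fC: "f x \<in> ?C" if "x \<in> ?C" for x using that by (simp add: c)
    have "f x = x" if x: "x \<in> ?C" for x
      using hf scalarR[OF d(2)] x bivector_inject[OF fC[OF x] x]
      by (simp add: R_def intertwiners_def siegel_group_simps(3) d(1))
    then have "f = \<one>\<^bsub>?S\<^esub>" using c by (auto simp: siegel_group_simps(3))
    then show "f \<in> {f. (\<one>\<^bsub>?G\<^esub>, f) \<in> R}" using subgroup.one_closed[OF R] by simp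
  qed
  show "type_C 2 TYPE('a) \<cong> type_B 2 TYPE('a)"
    using goursat_iso[OF G.is_group groupS R proj] unfolding type_C_def type_B_def kerG kerS .
  show "group (type_B 2 TYPE('a))"
    using normal.factorgroup_is_group[OF goursat_normal(2)[OF G.is_group groupS R proj]]
    unfolding type_B_def kerS .
qed

section \<open>Permutation groups and simplices of matrices\<close>

definition transpositions :: "(nat \<times> nat) list \<Rightarrow> nat \<Rightarrow> nat" where
  "transpositions ts = foldr (\<lambda>(a, b) p. transpose a b \<circ> p) ts id"

lemma transpositions_simps [simp]:
  "transpositions [] = id"
  "transpositions ((a, b) # ts) = transpose a b \<circ> transpositions ts"
  by (simp_all add: transpositions_def)

lemma transpositions_permutes:
  assumes "list_all (\<lambda>(a, b). a \<in> S \<and> b \<in> S) ts"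
  shows "transpositions ts permutes S"
  using assms by (induction ts) (auto intro!: permutes_compose permutes_swap_id permutes_id)

text \<open>With permutations given as lists of transpositions, the rightmost acting first, parity
  is read off the length and the tables below are evaluated by rewriting.\<close>

lemma evenperm_transpositions:
  assumes "list_all (\<lambda>(a, b). a \<noteq> b) ts"
  shows "evenperm (transpositions ts) \<longleftrightarrow> even (length ts)"
proof -
  have "permutation (transpositions ts)" for ts
  proof -
    have "finite (\<Union>(a, b)\<in>set ts. {a, b})" by auto
    moreover have "transpositions ts permutes (\<Union>(a, b)\<in>set ts. {a, b})"
      by (rule transpositions_permutes) (auto simp: list_all_iff)
    ultimately show ?thesis unfolding permutation_permutes by blast
  qed
  then show ?thesis using assms
    by (induction ts) (auto simp: evenperm_comp permutation_swap_id evenperm_swap)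
qed

lemma transpositions_in_alt_group:
  assumes "list_all (\<lambda>(a, b). a \<in> {1..n} \<and> b \<in> {1..n} \<and> a \<noteq> b) ts" "even (length ts)"
  shows "transpositions ts \<in> carrier (alt_group n)"
  using assms unfolding alt_group_carrier
  by (auto simp: list_all_iff evenperm_transpositions split: prod.splits intro!: transpositions_permutes)

lemma transpositions_in_sym_group:
  assumes "list_all (\<lambda>(a, b). a \<in> {1..n} \<and> b \<in> {1..n}) ts"
  shows "transpositions ts \<in> carrier (sym_group n)"
  using assms unfolding sym_group_carrier by (rule transpositions_permutes)

text \<open>Three-cycles generate the alternating group, and each is built from the cycles
  \<open>(1 2 k)\<close>, according to which of the points 1 and 2 it moves.\<close>

lemma alt_group_generated_by_cycles_12k:
  assumes "2 \<le> n"
  shows "carrier (alt_group n) =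
    generate (alt_group n) {transpositions [(1, 2), (2, k)] | k. k \<in> {3..n}}" (is "_ = generate _ ?T")
proof -
  interpret group "alt_group n" by (rule alt_group_is_group)
  let ?H = "generate (alt_group n) ?T"
  have TC: "?T \<subseteq> carrier (alt_group n)"
    using assms by (auto intro!: transpositions_in_alt_group simp del: transpositions_simps)
  have m: "p \<circ> q \<in> ?H" if "p \<in> ?H" "q \<in> ?H" for p q
    using generate.eng[OF that] by (simp add: alt_group_mult)
  \<comment> \<open>This is the cycle sending \<open>a\<close> to \<open>b\<close>, \<open>b\<close>
    to \<open>d\<close> and \<open>d\<close> to \<open>a\<close>, when the three points are
    distinct.\<close>
  define c where "c a b d = transpose a b \<circ> transpose b d" for a b d :: nat
  have c12: "c 1 2 k \<in> ?H" if "k \<in> {3..n}" for k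
    using that by (intro generate.incl) (auto simp: c_def)
  have rot: "c a b d = c b d a" if "a \<noteq> b" "a \<noteq> d" "b \<noteq> d" for a b d
    using that by (auto simp: c_def fun_eq_iff transpose_def)
  have inv: "c a d b = c a b d \<circ> c a b d" if "a \<noteq> b" "a \<noteq> d" "b \<noteq> d" for a b d
    using that by (auto simp: c_def fun_eq_iff transpose_def)
  have c21: "c 1 k 2 \<in> ?H" if "k \<in> {3..n}" for k
    using inv[of 1 2 k] m[OF c12 c12] that by simp
  have c1: "c 1 a b \<in> ?H" if "a \<in> {3..n}" "b \<in> {3..n}" "a \<noteq> b" for a b
  proof -
    have "c 1 a b = c 1 2 b \<circ> c 1 a 2" using that by (auto simp: c_def fun_eq_iff transpose_def)
    then show ?thesis using m c12 c21 that by simp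
  qed
  have c2: "c 2 a b \<in> ?H" if "a \<in> {3..n}" "b \<in> {3..n}" "a \<noteq> b" for a b
  proof -
    have "c 2 a b = c 1 b 2 \<circ> c 1 2 a" using that by (auto simp: c_def fun_eq_iff transpose_def)
    then show ?thesis using m c12 c21 that by simp
  qed
  have c3: "c a b d \<in> ?H" if "a \<in> {3..n}" "b \<in> {3..n}" "d \<in> {3..n}" "a \<noteq> b" "a \<noteq> d" "b \<noteq> d" for a b d
  proof -
    have "c a b d = c 1 a b \<circ> c 1 b d" using that by (auto simp: c_def fun_eq_iff transpose_def)
    then show ?thesis using m c1 that by simp
  qed
  have ge3: "x \<in> {3..n}" if "x \<in> {2..n}" "x \<noteq> 2" for x using that by auto
  have with_1: "c 1 b d \<in> ?H" if b: "b \<in> {2..n}" and d: "d \<in> {2..n}" and bd: "b \<noteq> d" for b d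
  proof -
    consider "b = 2" "d \<noteq> 2" | "b \<noteq> 2" "d = 2" | "b \<noteq> 2" "d \<noteq> 2" using bd by blast
    then show ?thesis
    proof cases
      case 1 then show ?thesis using c12[OF ge3[OF d]] by simp
    next
      case 2 then show ?thesis using c21[OF ge3[OF b]] by simp
    next
      case 3 then show ?thesis by (intro c1 ge3 b d bd)
    qed
  qed
  have without_1: "c a b d \<in> ?H" if "a \<in> {2..n}" "b \<in> {2..n}" "d \<in> {2..n}" "a \<noteq> b" "a \<noteq> d" "b \<noteq> d" for a b d
  proof -
    consider "a = 2" | "b = 2" | "d = 2" | "a \<noteq> 2" "b \<noteq> 2" "d \<noteq> 2" by blast
    then show ?thesis
    proof cases
      case 1 then show ?thesis using c2 ge3 that by simp
    next
      case 2 then show ?thesis using c2[of d a] ge3 that rot[of a b d] by simp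
    next
      case 3 then show ?thesis using c2[of a b] ge3 that rot[of d a b] by simp
    next
      case 4 show ?thesis by (intro c3 ge3 that 4)
    qed
  qed
  have all: "c a b d \<in> ?H" if "a \<in> {1..n}" "b \<in> {1..n}" "d \<in> {1..n}" "a \<noteq> b" "a \<noteq> d" "b \<noteq> d" for a b d
  proof -
    have ge2: "x \<in> {2..n}" if "x \<in> {1..n}" "x \<noteq> 1" for x using that by auto
    consider "a = 1" | "b = 1" | "d = 1" | "a \<noteq> 1" "b \<noteq> 1" "d \<noteq> 1" by blast
    then show ?thesis
    proof cases
      case 1 then show ?thesis using with_1 ge2 that by simp
    next
      case 2 then show ?thesis using with_1[of d a] ge2 that rot[of a b d] by simp
    next
      case 3 then show ?thesis using with_1[of a b] ge2 that rot[of d a b] by simp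
    next
      case 4 show ?thesis by (intro without_1 ge2 that 4)
    qed
  qed
  have "three_cycles n \<subseteq> ?H"
  proof
    fix p assume "p \<in> three_cycles n"
    then obtain cs where cs: "p = cycle_of_list cs" "distinct cs" "length cs = 3" "set cs \<subseteq> {1..n}"
      by auto
    then obtain a b d where "cs = [a, b, d]" using stupid_lemma by blast
    then show "p \<in> ?H" using all[of a b d] cs by (auto simp: c_def)
  qed
  then have "generate (alt_group n) (three_cycles n) \<subseteq> ?H"
    by (rule generate_subgroup_incl[OF _ generate_is_subgroup[OF TC]])
  then show ?thesis
    using generate_incl[OF TC] unfolding alt_group_carrier_as_three_cycles by blast
qed

lemma sym_group_generated_by_transpositions_1k:
  "carrier (sym_group n) = generate (sym_group n) {transpositions [(1, k)] | k. k \<in> {2..n}}"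
    (is "_ = generate _ ?T")
proof -
  interpret group "sym_group n" by (rule sym_group_is_group)
  let ?H = "generate (sym_group n) ?T"
  have TC: "?T \<subseteq> carrier (sym_group n)"
    by (auto intro!: transpositions_in_sym_group simp del: transpositions_simps)
  have m: "p \<circ> q \<in> ?H" if "p \<in> ?H" "q \<in> ?H" for p q
    using generate.eng[OF that] by (simp add: sym_group_mult)
  have t1: "transpose 1 k \<in> ?H" if "k \<in> {2..n}" for k
    using that by (intro generate.incl) auto
  have t: "transpose a b \<in> ?H" if "a \<in> {1..n}" "b \<in> {1..n}" "a \<noteq> b" for a b
  proof (cases "a = 1 \<or> b = 1")
    case True
    then show ?thesis using t1[of a] t1[of b] that transpose_commute[of a 1] by (auto simp del: One_nat_def)
  next
    case False
    then have "transpose a b = transpose 1 a \<circ> (transpose 1 b \<circ> transpose 1 a)"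
      using that by (auto simp: fun_eq_iff transpose_def)
    then show ?thesis using m t1 that False by auto
  qed
  have "p \<in> ?H" if "p permutes {1..n}" for p
    using that finite_atLeastAtMost
  proof (induction rule: permutes_induct)
    case id
    then show ?case using generate.one[of "sym_group n" ?T] unfolding sym_group_one .
  next
    case (swap a b p)
    then show ?case using m t by blast
  qed
  then show ?thesis using generate_incl[OF TC] by (auto simp: sym_group_carrier)
qed

text \<open>Commutators are even; conversely the alternating group is perfect from degree 5 on, so
  it lies in the derived subgroup.\<close>

lemma derived_subgroup_sym_group:
  assumes "5 \<le> n"
  shows "derived_subgroup (sym_group n) = alt_group n"
proof -
  interpret group "sym_group n" by (rule sym_group_is_group)
  let ?D = "derived (sym_group n) (carrier (sym_group n))"
  have "?D = carrier (alt_group n)"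
  proof
    show "?D \<subseteq> carrier (alt_group n)"
      unfolding derived_def
    proof (rule generate_subgroup_incl[OF _ alt_group_is_subgroup])
      show "derived_set (sym_group n) (carrier (sym_group n)) \<subseteq> carrier (alt_group n)"
        using sym_group_carrier'[of _ n] permutation_inverse
        by (auto simp: alt_group_carrier sym_group_carrier sym_group_mult evenperm_comp evenperm_inv
            permutation_compose permutes_inv intro!: permutes_compose)
    qed
    have "carrier (alt_group n) = derived (alt_group n) (carrier (alt_group n))"
      using derived_alt_group_const[OF assms] by simp
    also have "\<dots> = derived (sym_group n) (carrier (alt_group n))"
      using derived_consistent[OF _ alt_group_is_subgroup, of "carrier (alt_group n)"]
      by (simp add: alt_group_def)
    also have "\<dots> \<subseteq> ?D"
      using subgroup.subset[OF alt_group_is_subgroup] by (intro mono_derived) auto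
    finally show "carrier (alt_group n) \<subseteq> ?D" .
  qed
  then show ?thesis
    by (simp add: derived_subgroup_def alt_group_def sym_group_def)
qed

section \<open>Simplices of matrices\<close>

lemma minus_zero_mat: "A \<in> carrier_mat n m \<Longrightarrow> A - 0\<^sub>m n m = (A :: 'a::group_add mat)"
  by (intro eq_matI) auto

text \<open>With \<open>b 1 = 0\<close> and additive \<open>\<phi>\<close> these \<open>n\<close>
  equations imply the equivariance of all differences \<open>b i - b j\<close>.\<close>

definition induces ::
  "nat \<Rightarrow> ('a::field mat \<Rightarrow> 'a mat \<Rightarrow> 'a mat) \<Rightarrow> (nat \<Rightarrow> 'a mat) \<Rightarrow> 'a mat \<Rightarrow> (nat \<Rightarrow> nat) \<Rightarrow> bool" where
  "induces n \<phi> b g p \<longleftrightarrow> (\<forall>i\<in>{1..n}. \<phi> g (b i) = b (p i) - b (p 1))"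

text \<open>Ordered pairs of vertices serve as labels and their differences as vectors.
  \<open>N\<close> consists of the matrices fixing every vertex; on the permutation side only
  translations of the simplex could be lost, and \<open>no_translation\<close> excludes
  them.\<close>

lemma frame_iso:
  fixes G :: "'a::field mat monoid" and H :: "(nat \<Rightarrow> nat) monoid" and b :: "nat \<Rightarrow> 'a mat"
  assumes G: "group G" "carrier G \<subseteq> carrier_mat m m" "mult G = (*)" "one G = 1\<^sub>m m"
    and H: "group H" "\<And>p. p \<in> carrier H \<Longrightarrow> p permutes {1..n}" "mult H = (\<circ>)" "one H = id"
    and n: "3 \<le> n"
    and b: "\<And>i. i \<in> {1..n} \<Longrightarrow> b i \<in> carrier_mat m m" "b 1 = 0\<^sub>m m m"
    and \<phi>C: "\<And>A X. A \<in> carrier_mat m m \<Longrightarrow> X \<in> carrier_mat m m \<Longrightarrow> \<phi> A X \<in> carrier_mat m m"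
    and \<phi>1: "\<And>X. X \<in> carrier_mat m m \<Longrightarrow> \<phi> (1\<^sub>m m) X = X"
    and \<phi>mult: "\<And>A B X. A \<in> carrier_mat m m \<Longrightarrow> B \<in> carrier_mat m m \<Longrightarrow> X \<in> carrier_mat m m \<Longrightarrow>
        \<phi> (A * B) X = \<phi> A (\<phi> B X)"
    and \<phi>diff: "\<And>A X Y. A \<in> carrier_mat m m \<Longrightarrow> X \<in> carrier_mat m m \<Longrightarrow> Y \<in> carrier_mat m m \<Longrightarrow>
        \<phi> A (X - Y) = \<phi> A X - \<phi> A Y"
    and S: "carrier G = generate G S"
      "\<And>g. g \<in> S \<Longrightarrow> \<exists>p\<in>carrier H. induces n \<phi> b g p"
    and T: "carrier H = generate H T"
      "\<And>p. p \<in> T \<Longrightarrow> \<exists>g\<in>carrier G. induces n \<phi> b g p"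
    and N: "\<And>g. g \<in> carrier G \<Longrightarrow> (\<forall>i\<in>{1..n}. \<phi> g (b i) = b i) \<longleftrightarrow> g \<in> N" "N \<subseteq> carrier G"
    and inj: "inj_on b {1..n}"
    and no_translation: "\<forall>s\<in>{3..n}. \<forall>k\<in>{1..n}. b 2 + b s \<noteq> b k"
  shows "G Mod N \<cong> H"
proof -
  define R where "R = intertwiners G H \<phi> (\<lambda>p (i, j). (p i, p j)) ({1..n} \<times> {1..n}) (\<lambda>(i, j). b i - b j)"
  have pI: "p i \<in> {1..n}" if "p \<in> carrier H" "i \<in> {1..n}" for p i
    using permutes_in_image[OF H(2)[OF that(1)], of i] that(2) by simp
  have R: "subgroup R (G \<times>\<times> H)"
    unfolding R_def
    by (rule subgroup_intertwiners[OF G(1) H(1), where V = "carrier_mat m m"])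
      (use G(2) pI in \<open>auto simp: G(3,4) H(3,4) b \<phi>1 subset_iff minus_carrier_mat intro!: \<phi>mult simp del: atLeastAtMost_iff\<close>)
  have memR: "(g, p) \<in> R" if g: "g \<in> carrier G" and p: "p \<in> carrier H"
    and e: "induces n \<phi> b g p" for g p
  proof -
    have "\<phi> g (b i - b j) = b (p i) - b (p j)" if "i \<in> {1..n}" "j \<in> {1..n}" for i j
    proof -
      have "\<phi> g (b i - b j) = (b (p i) - b (p 1)) - (b (p j) - b (p 1))"
        using \<phi>diff[of g "b i" "b j"] g G(2) b that e[unfolded induces_def] by auto
      also have "\<dots> = b (p i) - b (p j)"
        using b(1)[OF pI[OF p that(1)]] b(1)[OF pI[OF p that(2)]] b(1)[OF pI[OF p, of 1]] n
        by (intro eq_matI) auto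
      finally show ?thesis .
    qed
    then show ?thesis using g p by (auto simp: R_def intertwiners_def)
  qed
  have eqR: "\<phi> g (b i) = b (p i) - b (p 1)" if "(g, p) \<in> R" "i \<in> {1..n}" for g p i
  proof -
    have "\<phi> g (b i - b 1) = b (p i) - b (p 1)" using that n by (auto simp: R_def intertwiners_def)
    then show ?thesis using b that(2) by (simp add: minus_zero_mat[of _ m m])
  qed
  show ?thesis
  proof (rule quotient_iso_of_relation[OF G(1) H(1) R S(1) _ T(1)])
    show "\<exists>p. (g, p) \<in> R" if "g \<in> S" for g
      using S(2)[OF that] memR S(1) generate.incl[OF that, of G] by blast
    show "\<exists>g. (g, p) \<in> R" if "p \<in> T" for p
      using T(2)[OF that] memR T(1) generate.incl[OF that, of H] by blast
    have oneH: "id \<in> carrier H" using monoid.one_closed[of H] H(1,4) by (simp add: group_def)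
    have b0: "b i - b 1 = b i" if "i \<in> {1..n}" for i using b that by (simp add: minus_zero_mat[of _ m m])
    show "(g, \<one>\<^bsub>H\<^esub>) \<in> R \<longleftrightarrow> g \<in> N" for g
    proof
      assume g: "(g, \<one>\<^bsub>H\<^esub>) \<in> R"
      then have "g \<in> carrier G" by (auto simp: R_def intertwiners_def)
      moreover have "\<forall>i\<in>{1..n}. \<phi> g (b i) = b i"
        using eqR[OF g] b0 unfolding H(4) id_apply by metis
      ultimately show "g \<in> N" using N(1) by blast
    next
      assume g: "g \<in> N"
      then have "\<forall>i\<in>{1..n}. \<phi> g (b i) = b i" using N by blast
      then show "(g, \<one>\<^bsub>H\<^esub>) \<in> R" using g N(2) oneH b0
        by (intro memR) (auto simp: H(4) induces_def)
    qed
    show "p = \<one>\<^bsub>H\<^esub>" if pR: "(\<one>\<^bsub>G\<^esub>, p) \<in> R" for p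
    proof -
      have p: "p \<in> carrier H" using pR by (auto simp: R_def intertwiners_def)
      have e: "b i + b (p 1) = b (p i)" if i: "i \<in> {1..n}" for i
      proof -
        have "b i = b (p i) - b (p 1)" using eqR[OF pR i] b i by (simp add: G(4) \<phi>1)
        then show ?thesis
          using b(1)[OF pI[OF p i]] b(1)[OF pI[OF p, of 1]] n by (auto intro!: eq_matI)
      qed
      \<comment> \<open>\<open>p\<close> translates the simplex by \<open>b (p 1)\<close>. If this
        is \<open>b 2\<close>, then \<open>b 3\<close> moves to \<open>b 2 + b 3\<close>; otherwise
        \<open>b 2\<close> moves to \<open>b 2 + b (p 1)\<close>. Neither sum is a vertex.\<close>
      have "p 1 = 1"
      proof (rule ccontr)
        assume "p 1 \<noteq> 1"
        then have p1: "p 1 = 2 \<or> p 1 \<in> {3..n}" using pI[OF p, of 1] n by auto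
        have "b 3 + b 2 = b 2 + b 3" using b(1)[of 2] b(1)[of 3] n by (intro comm_add_mat) auto
        moreover have "b 2 + b (p 1) = b (p 2)" "b 3 + b (p 1) = b (p 3)" using e n by auto
        moreover have "p 2 \<in> {1..n}" "p 3 \<in> {1..n}" "3 \<in> {3..n}" using pI[OF p] n by auto
        ultimately show False using no_translation p1 by metis
      qed
      then have "b (p i) = b i" if "i \<in> {1..n}" for i using e[OF that] b that by (simp add: right_add_zero_mat[of _ m m])
      then have "p i = i" if "i \<in> {1..n}" for i using inj_onD[OF inj] pI[OF p that] that by blast
      then show ?thesis using permutes_not_in[OF H(2)[OF p]] unfolding H(4) by (metis eq_id_iff)
    qed
  qed
qed

section \<open>Small finite fields\<close>

lemma CHAR_eq_if_card_prime_power: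
  assumes "prime p" "card (UNIV :: 'a::field set) = p ^ k"
  shows "CHAR('a) = p"
proof -
  have fin: "finite (UNIV :: 'a set)"
    using assms by (metis card.infinite not_prime_0 power_not_zero)
  then have "prime CHAR('a)" by (intro prime_CHAR_semidom finite_imp_CHAR_pos)
  moreover have "CHAR('a) dvd p ^ k" using CHAR_dvd_CARD[where 'a = 'a] assms(2) by simp
  ultimately show ?thesis using assms(1) prime_dvd_power primes_dvd_imp_eq by metis
qed

lemma of_int_eq_iff_dvd:
  "of_int x = (of_int y :: 'a::ring_1) \<longleftrightarrow> int CHAR('a) dvd x - y"
  by (metis eq_iff_diff_eq_0 of_int_diff of_int_eq_0_iff_char_dvd)

lemma prime_field_of_nat_surj:
  assumes "prime p" "card (UNIV :: 'a::field set) = p"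
  obtains k where "x = (of_nat k :: 'a::field)"
proof -
  have char: "CHAR('a) = p" using CHAR_eq_if_card_prime_power[of p 1] assms by simp
  have fin: "finite (UNIV :: 'a set)" using assms by (metis card.infinite not_prime_0)
  have "inj_on (of_nat :: nat \<Rightarrow> 'a) {..<p}"
  proof (rule inj_onI)
    fix i j assume "i \<in> {..<p}" "j \<in> {..<p}" "(of_nat i :: 'a) = of_nat j"
    then have "int p dvd int i - int j" "\<bar>int i - int j\<bar> < int p"
      using of_int_eq_iff_dvd[of "int i" "int j", where 'a = 'a] by (auto simp: char)
    then show "i = j" using zdvd_imp_le[of "int p" "\<bar>int i - int j\<bar>"] by (cases "i = j") auto
  qed
  then have "card (of_nat ` {..<p} :: 'a set) = card (UNIV :: 'a set)"
    using assms(2) by (simp add: card_image)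
  then have "of_nat ` {..<p} = (UNIV :: 'a set)" by (intro card_subset_eq fin) auto
  then show ?thesis using that by (metis UNIV_I imageE)
qed

lemma prime_field_additive_generator:
  assumes p: "prime p" "card (UNIV :: 'a::field set) = p"
    and X: "(0 :: 'a) \<in> X" "\<And>x a. x \<in> X \<Longrightarrow> a \<in> {1} \<Longrightarrow> x + a \<in> X"
  shows "X = UNIV"
proof -
  have "of_nat k \<in> X" for k
    by (induction k) (use X(1) X(2)[of _ 1] in \<open>simp_all add: add.commute[of 1]\<close>)
  then show ?thesis using prime_field_of_nat_surj[OF p] by (metis UNIV_eq_I)
qed

text \<open>\<open>1\<close> and \<open>w\<close> are linearly independent over the prime field
  because \<open>w\<close> lies outside it; their \<open>p * p\<close> combinations are therefore
  distinct and exhaust the field.\<close>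

lemma quadratic_field_coordinates:
  fixes w :: "'a::field"
  assumes p: "prime p" "card (UNIV :: 'a set) = p\<^sup>2" and w: "w \<notin> range of_int"
  shows "of_int x + of_int y * w = 0 \<longleftrightarrow> int p dvd x \<and> int p dvd y"
    and "\<exists>k l :: nat. z = of_nat k + of_nat l * w"
proof -
  have char: "CHAR('a) = p" using CHAR_eq_if_card_prime_power p by blast
  have 0: "of_int n = (0 :: 'a) \<longleftrightarrow> int p dvd n" for n
    using of_int_eq_iff_dvd[of n 0, where 'a = 'a] by (simp add: char)
  have iff: "of_int x + of_int y * w = 0 \<longleftrightarrow> int p dvd x \<and> int p dvd y" for x y
  proof
    assume e: "of_int x + of_int y * w = 0"
    have "int p dvd y"
    proof (rule ccontr)
      assume "\<not> int p dvd y"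
      then have "coprime y (int p)"
        using p(1) prime_imp_coprime[of "int p" y] by (simp add: coprime_commute)
      \<comment> \<open>An inverse of \<open>y\<close> modulo \<open>p\<close> expresses
        \<open>w\<close> as an element of the prime field.\<close>
      then obtain m where "[y * m = 1] (mod int p)" using cong_solve_coprime_int by blast
      then have "of_int (y * m) = (1 :: 'a)"
        using of_int_eq_iff_dvd[of "y * m" 1, where 'a = 'a] by (simp add: char cong_iff_dvd_diff)
      then have one: "of_int m * of_int y = (1 :: 'a)" by (simp add: mult.commute)
      have "w = (of_int m * of_int y) * w" by (simp only: one mult_1)
      also have "\<dots> = of_int m * (of_int y * w)" by (simp only: mult.assoc)
      also have "of_int y * w = - of_int x" using e by (simp only: add_eq_0_iff)
      also have "of_int m * - of_int x = of_int (- (m * x))" by simp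
      finally show False using w by blast
    qed
    moreover from this have "of_int x = (0 :: 'a)" using e 0[of y] by simp
    ultimately show "int p dvd x \<and> int p dvd y" using 0[of x] by simp
  next
    assume "int p dvd x \<and> int p dvd y"
    then have "of_int x = (0 :: 'a)" "of_int y = (0 :: 'a)" using 0[of x] 0[of y] by simp_all
    then show "of_int x + of_int y * w = 0" by simp
  qed
  then show "of_int x + of_int y * w = 0 \<longleftrightarrow> int p dvd x \<and> int p dvd y" .
  let ?f = "\<lambda>(k, l). of_nat k + of_nat l * w"
  have fin: "finite (UNIV :: 'a set)" using p by (metis card.infinite not_prime_0 power_not_zero)
  have "inj_on ?f ({..<p} \<times> {..<p})"
  proof (rule inj_onI, clarsimp)
    fix k l k' l' assume b: "k < p" "l < p" "k' < p" "l' < p"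
      and e: "of_nat k + of_nat l * w = of_nat k' + of_nat l' * w"
    then have "of_int (int k - int k') + of_int (int l - int l') * w = 0" by (simp add: algebra_simps)
    then have "int p dvd int k - int k'" "int p dvd int l - int l'" using iff by blast+
    moreover have "i = j" if "int p dvd int i - int j" "i < p" "j < p" for i j
      using that zdvd_imp_le[of "int p" "\<bar>int i - int j\<bar>"] by (cases "i = j") auto
    ultimately show "k = k' \<and> l = l'" using b by blast
  qed
  then have "card (?f ` ({..<p} \<times> {..<p})) = card (UNIV :: 'a set)"
    using p(2) by (simp add: card_image power2_eq_square)
  then have "?f ` ({..<p} \<times> {..<p}) = UNIV" by (intro card_subset_eq fin) auto
  then show "\<exists>k l :: nat. z = of_nat k + of_nat l * w" by fastforce
qed

lemma quadratic_field_additive_generators: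
  fixes w :: "'a::field"
  assumes p: "prime p" "card (UNIV :: 'a set) = p\<^sup>2" and w: "w \<notin> range of_int"
    and X: "0 \<in> X" "\<And>x a. x \<in> X \<Longrightarrow> a \<in> {1, w} \<Longrightarrow> x + a \<in> X"
  shows "X = UNIV"
proof -
  have k: "of_nat k \<in> X" for k
    by (induction k) (use X(1) X(2)[of _ 1] in \<open>simp_all add: add.commute[of 1]\<close>)
  have "of_nat k + of_nat l * w \<in> X" for k l
  proof (induction l)
    case (Suc l)
    have "of_nat k + of_nat (Suc l) * w = of_nat k + of_nat l * w + w" by (simp add: algebra_simps)
    then show ?case using X(2)[OF Suc, of w] by (simp only: insert_iff simp_thms)
  qed (use k in simp)
  then show ?thesis using quadratic_field_coordinates(2)[OF p w] by (metis UNIV_eq_I)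
qed

text \<open>Field elements become pairs of integers read modulo \<open>p\<close>, so that the
  entrywise identities below turn into divisibility of numerals.\<close>

definition coord :: "'a::field \<Rightarrow> int \<Rightarrow> int \<Rightarrow> 'a" where
  "coord w x y = of_int x + of_int y * w"

lemma coord_add: "coord w x y + coord w x' y' = coord w (x + x') (y + y')"
  and coord_diff: "coord w x y - coord w x' y' = coord w (x - x') (y - y')"
  by (simp_all add: coord_def algebra_simps)

lemma coord_mult:
  assumes "w * w = of_int s + of_int t * w"
  shows "coord w x y * coord w x' y' = coord w (x * x' + s * (y * y')) (x * y' + y * x' + t * (y * y'))"
proof -
  have "coord w x y * coord w x' y' = of_int (x * x') + of_int (x * y' + y * x') * w + of_int (y * y') * (w * w)"
    by (simp add: coord_def algebra_simps)
  then show ?thesis by (simp add: assms coord_def algebra_simps)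
qed

lemma coord_eq_iff:
  fixes w :: "'a::field"
  assumes "prime p" "card (UNIV :: 'a set) = p\<^sup>2" "w \<notin> range of_int"
  shows "coord w x y = coord w x' y' \<longleftrightarrow> int p dvd x - x' \<and> int p dvd y - y'"
  using quadratic_field_coordinates(1)[OF assms, of "x - x'" "y - y'"]
  by (simp add: coord_def algebra_simps)

lemma coord_surj:
  fixes w :: "'a::field"
  assumes "prime p" "card (UNIV :: 'a set) = p\<^sup>2" "w \<notin> range of_int"
  obtains x y where "z = coord w x y"
proof -
  obtain k l :: nat where "z = of_nat k + of_nat l * w"
    using quadratic_field_coordinates(2)[OF assms] by blast
  then show ?thesis using that[of "int k" "int l"] by (simp add: coord_def)
qed

lemma exists_not_prime_field:
  assumes p: "prime p" "card (UNIV :: 'a::field set) = p\<^sup>2"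
  shows "\<exists>w :: 'a. w \<notin> range of_int"
proof (rule ccontr)
  assume "\<not> ?thesis"
  then have surj: "\<exists>n. z = of_int n" for z :: 'a by blast
  have char: "CHAR('a) = p" using CHAR_eq_if_card_prime_power p by blast
  have "UNIV \<subseteq> (of_int ` {0..<int p} :: 'a set)"
  proof
    fix z :: 'a
    obtain n where "z = of_int n" using surj by blast
    then have "z = of_int (n mod int p)"
      using of_int_eq_iff_dvd[of n "n mod int p", where 'a = 'a] by (simp add: char minus_mod_eq_mult_div)
    moreover have "n mod int p \<in> {0..<int p}" using prime_gt_0_nat[OF p(1)] by simp
    ultimately show "z \<in> of_int ` {0..<int p}" by blast
  qed
  then have "card (UNIV :: 'a set) \<le> card {0..<int p}" by (meson card_image_le card_mono finite_atLeastLessThan_int finite_imageI le_trans)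
  then show False using p prime_gt_1_nat[OF p(1)] by (simp add: power2_eq_square)
qed

text \<open>In \<open>w * w = k + l * w\<close> with coefficients modulo 2, \<open>k = 0\<close>
  gives \<open>w = 0\<close> or \<open>w = l\<close>, and \<open>k = 1\<close>, \<open>l = 0\<close>
  gives \<open>w = 1\<close>; both contradict the choice of \<open>w\<close>.\<close>

lemma field_4_generator:
  assumes "card (UNIV :: 'a::field set) = 4"
  obtains w :: "'a::field" where "w \<notin> range of_int" "w * w = 1 + w"
proof -
  have p: "prime (2::nat)" "card (UNIV :: 'a set) = 2\<^sup>2" using assms by simp_all
  have char: "CHAR('a) = 2" using CHAR_eq_if_card_prime_power p by blast
  obtain w :: 'a where w: "w \<notin> range of_int" using exists_not_prime_field[OF p] by blast
  obtain k l :: nat where kl: "w * w = of_nat k + of_nat l * w"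
    using quadratic_field_coordinates(2)[OF p w] by blast
  have ev: "of_nat n = (if even n then 0 else 1 :: 'a)" for n
    using of_int_eq_iff_dvd[of "int n" 0, where 'a = 'a] of_int_eq_iff_dvd[of "int n" 1, where 'a = 'a]
    by (auto simp: char)
  have "w \<noteq> of_int n" for n using w by blast
  from this[of 0] this[of 1] this[of "-1"] have "w \<noteq> 0" "w \<noteq> 1" "w \<noteq> -1" by simp_all
  then have "odd k \<and> odd l" using kl by (auto simp: ev square_eq_1_iff split: if_splits)
  then show ?thesis using kl that[OF w] by (simp add: ev)
qed

text \<open>Completing the square: \<open>- 1/2 = 1\<close> in characteristic 3, so
  \<open>v = w + l\<close> has its square in the prime field. The values 0 and 1 would put
  \<open>v\<close> itself there, which leaves \<open>2 = - 1\<close>.\<close>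

lemma field_9_generator:
  assumes "card (UNIV :: 'a::field set) = 9"
  obtains w :: "'a::field" where "w \<notin> range of_int" "w * w = - 1"
proof -
  have p: "prime (3::nat)" "card (UNIV :: 'a set) = 3\<^sup>2" using assms by simp_all
  have char: "CHAR('a) = 3" using CHAR_eq_if_card_prime_power p by blast
  obtain w :: 'a where w: "w \<notin> range of_int" using exists_not_prime_field[OF p] by blast
  obtain k l :: nat where kl: "w * w = of_nat k + of_nat l * w"
    using quadratic_field_coordinates(2)[OF p w] by blast
  define v where "v = w + of_nat l"
  have v: "v \<noteq> of_int n" for n
  proof
    assume "v = of_int n"
    then have "w = of_int (n - int l)" by (simp add: v_def eq_diff_eq)
    then show False using w by blast
  qed
  have three: "(3 :: 'a) = 0" using of_nat_CHAR[where 'a = 'a] by (simp add: char)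
  define m where "m = int k + int l * int l"
  have "v * v = of_nat k + of_nat l * of_nat l + 3 * of_nat l * w"
    by (simp add: v_def kl algebra_simps)
  then have vv: "v * v = of_int m" by (simp add: three m_def)
  have "m mod 3 = 0 \<or> m mod 3 = 1 \<or> m mod 3 = 2" by auto
  moreover have mm: "of_int m = (of_int (m mod 3) :: 'a)"
    by (subst of_int_eq_iff_dvd) (simp add: char minus_mod_eq_mult_div)
  ultimately consider "v * v = 0" | "v * v = 1" | "v * v = 2" using vv by auto
  then have "v * v = -1"
  proof cases
    case 1 then show ?thesis using v[of 0] by simp
  next
    case 2 then show ?thesis using v[of 1] v[of "-1"] by (auto simp: square_eq_1_iff)
  next
    case 3
    moreover have "(2 :: 'a) = -1" using three by (simp add: eq_neg_iff_add_eq_0)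
    ultimately show ?thesis by simp
  qed
  then show ?thesis using that v by blast
qed

section \<open>Hermitian and symmetric simplices for PSL_2\<close>

definition hcongr :: "('a::field \<Rightarrow> 'a) \<Rightarrow> 'a mat \<Rightarrow> 'a mat \<Rightarrow> 'a mat" where
  "hcongr \<sigma> A X = A * X * map_mat \<sigma> (transpose_mat A)"

lemma elementary_mats_2:
  "elementary_mats 2 S = {mat2 1 a 0 1 | a. a \<in> S} \<union> {mat2 1 0 a 1 | a. a \<in> S}"
proof -
  have *: "addrow_mat 2 a 0 1 = mat2 1 a 0 1" "addrow_mat 2 a 1 0 = mat2 1 0 a 1" for a :: 'a
    by (auto intro!: mat2_eqI)
  have "elementary_mats 2 S = {addrow_mat 2 a 0 1 | a. a \<in> S} \<union> {addrow_mat 2 a 1 0 | a. a \<in> S}"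
    by (auto simp: elementary_mats_def less_2_iff)
  then show ?thesis unfolding * .
qed

lemma SL_2_center: "group_center (SL 2 TYPE('a::field)) = {mat2 c 0 0 c | c. c * c = 1}"
  by (simp add: SL_center power2_eq_square)

text \<open>\<open>T\<close> supplies permutations for the generating transvections,
  \<open>C\<close> matrices for the cycles \<open>(1 2 k)\<close>, and \<open>span\<close>
  combinations of vertices. A matrix fixing both diagonal units is diagonal, and fixing an
  antidiagonal matrix as well makes it scalar.\<close>

lemma PSL_2_frame_iso:
  fixes \<sigma> :: "'a::field \<Rightarrow> 'a" and S :: "'a set" and b :: "nat \<Rightarrow> 'a mat"
  assumes \<sigma>: "\<And>x y. \<sigma> (x + y) = \<sigma> x + \<sigma> y" "\<And>x y. \<sigma> (x * y) = \<sigma> x * \<sigma> y" "\<sigma> 1 = 1"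
    and n: "3 \<le> n"
    and b: "\<forall>i\<in>{1..n}. b i \<in> carrier_mat 2 2" "b 1 = mat2 0 0 0 0"
    and S: "\<And>X. 0 \<in> X \<Longrightarrow> (\<And>x a. x \<in> X \<Longrightarrow> a \<in> S \<Longrightarrow> x + a \<in> X) \<Longrightarrow> X = UNIV"
    and T: "{mat2 1 a 0 1 | a. a \<in> S} \<union> {mat2 1 0 a 1 | a. a \<in> S} \<subseteq> fst ` set T"
      "list_all (\<lambda>(g, ts). induces n (hcongr \<sigma>) b g (transpositions ts)) T"
      "list_all (\<lambda>(g, ts). list_all (\<lambda>(i, j). i \<in> {1..n} \<and> j \<in> {1..n} \<and> i \<noteq> j) ts \<and> even (length ts)) T"
    and C: "{3..n} \<subseteq> fst ` set C" "list_all (\<lambda>(k, g). g \<in> carrier (SL 2 TYPE('a))) C"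
      "list_all (\<lambda>(k, g). induces n (hcongr \<sigma>) b g (transpositions [(1, 2), (2, k)])) C"
    and span: "\<And>V. (\<And>i. i \<in> {1..n} \<Longrightarrow> b i \<in> V) \<Longrightarrow>
        (\<And>X Y. X \<in> V \<Longrightarrow> Y \<in> V \<Longrightarrow> X + Y \<in> V) \<Longrightarrow> (\<And>X Y. X \<in> V \<Longrightarrow> Y \<in> V \<Longrightarrow> X - Y \<in> V) \<Longrightarrow>
        mat2 1 0 0 0 \<in> V \<and> mat2 0 0 0 1 \<in> V \<and> (\<exists>y z. y \<noteq> 0 \<and> mat2 0 y z 0 \<in> V)"
    and inj: "inj_on b {1..n}"
    and no_translation: "\<forall>s\<in>{3..n}. \<forall>k\<in>{1..n}. b 2 + b s \<noteq> b k"
  shows "PSL 2 TYPE('a) \<cong> alt_group n"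
proof -
  have \<sigma>0: "\<sigma> 0 = 0" using \<sigma>(1)[of 0 0] by (metis add_0 add_cancel_left_left)
  have \<sigma>neg: "\<sigma> (- x) = - \<sigma> x" for x using \<sigma>(1)[of x "- x"] by (simp add: \<sigma>0 eq_neg_iff_add_eq_0 add.commute)
  have \<sigma>diff: "\<sigma> (x - y) = \<sigma> x - \<sigma> y" for x y using \<sigma>(1)[of x "- y"] by (simp add: \<sigma>neg)
  have \<sigma>zero: "x = 0" if "\<sigma> x = 0" for x
    using \<sigma>(2)[of x "inverse x"] that \<sigma>(3) by (cases "x = 0") auto
  note hc = hcongr_def
  show ?thesis
    unfolding PSL_def
  proof (rule frame_iso[where m = 2 and b = b and \<phi> = "hcongr \<sigma>", OF group_SL _ _ _ alt_group_is_group _ alt_group_mult alt_group_one])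
    fix A B X Y :: "'a mat"
    assume A: "A \<in> carrier_mat 2 2" and B: "B \<in> carrier_mat 2 2"
      and X: "X \<in> carrier_mat 2 2" and Y: "Y \<in> carrier_mat 2 2"
    show "hcongr \<sigma> (A * B) X = hcongr \<sigma> A (hcongr \<sigma> B X)"
      using A B X by (auto elim!: mat2_cases simp: hc \<sigma> algebra_simps)
    show "hcongr \<sigma> A (X - Y) = hcongr \<sigma> A X - hcongr \<sigma> A Y"
      using A X Y by (auto elim!: mat2_cases simp: hc \<sigma> algebra_simps)
  next
    fix A X :: "'a mat" assume "A \<in> carrier_mat 2 2" "X \<in> carrier_mat 2 2"
    then show "hcongr \<sigma> A X \<in> carrier_mat 2 2" by (auto elim!: mat2_cases simp: hc)
  next
    fix X :: "'a mat" assume "X \<in> carrier_mat 2 2"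
    then show "hcongr \<sigma> (1\<^sub>m 2) X = X" by (auto elim!: mat2_cases simp: hc \<sigma> \<sigma>0)
  next
    show "carrier (SL 2 TYPE('a)) = generate (SL 2 TYPE('a)) (elementary_mats 2 S)"
      by (rule SL_generated_by_additive_generators[OF S])
    show "carrier (alt_group n) = generate (alt_group n) {transpositions [(1, 2), (2, k)] | k. k \<in> {3..n}}"
      by (rule alt_group_generated_by_cycles_12k) (use n in simp)
  next
    fix g assume "g \<in> elementary_mats 2 S"
    then have "g \<in> fst ` set T" using T(1) unfolding elementary_mats_2 by blast
    then obtain ts where ts: "(g, ts) \<in> set T" by auto
    show "\<exists>p\<in>carrier (alt_group n). induces n (hcongr \<sigma>) b g p"
    proof
      show "induces n (hcongr \<sigma>) b g (transpositions ts)"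
        using T(2) ts unfolding list_all_iff by blast
      show "transpositions ts \<in> carrier (alt_group n)"
        using T(3) ts unfolding list_all_iff[of _ T] by (intro transpositions_in_alt_group) auto
    qed
  next
    fix p assume "p \<in> {transpositions [(1, 2), (2, k)] | k. k \<in> {3..n}}"
    then obtain k where k: "p = transpositions [(1, 2), (2, k)]" "k \<in> {3..n}" by blast
    then obtain g where "(k, g) \<in> set C" using C(1) by auto
    then show "\<exists>g\<in>carrier (SL 2 TYPE('a)). induces n (hcongr \<sigma>) b g p"
      using C(2,3) unfolding list_all_iff k(1) by blast
  next
    fix g assume g: "g \<in> carrier (SL 2 TYPE('a))"
    obtain a0 a1 a2 a3 where geq: "g = mat2 a0 a1 a2 a3" using g by (auto elim: mat2_cases)
    have det: "a0 * a3 - a1 * a2 = 1" using g by (simp add: geq)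
    show "(\<forall>i\<in>{1..n}. hcongr \<sigma> g (b i) = b i) \<longleftrightarrow> g \<in> group_center (SL 2 TYPE('a))"
    proof
      assume fix_b: "\<forall>i\<in>{1..n}. hcongr \<sigma> g (b i) = b i"
      \<comment> \<open>Since \<open>span\<close> speaks of arbitrary additively closed sets, it
        applies to the set of matrices fixed by \<open>g\<close>.\<close>
      let ?V = "{X \<in> carrier_mat 2 2. hcongr \<sigma> g X = X}"
      have "mat2 1 0 0 0 \<in> ?V \<and> mat2 0 0 0 1 \<in> ?V \<and> (\<exists>y z. y \<noteq> 0 \<and> mat2 0 y z 0 \<in> ?V)"
      proof (rule span)
        show "b i \<in> ?V" if "i \<in> {1..n}" for i using fix_b b that by blast
        show "X + Y \<in> ?V" "X - Y \<in> ?V" if "X \<in> ?V" "Y \<in> ?V" for X Y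
          using that by (auto elim!: mat2_cases simp: hc geq algebra_simps)
      qed
      then obtain y z where e: "hcongr \<sigma> g (mat2 1 0 0 0) = mat2 1 0 0 0"
        "hcongr \<sigma> g (mat2 0 0 0 1) = mat2 0 0 0 1" "y \<noteq> 0" "hcongr \<sigma> g (mat2 0 y z 0) = mat2 0 y z 0" by auto
      have "a2 * \<sigma> a2 = 0" "a0 * \<sigma> a0 = 1" using e(1) by (simp_all add: geq hc)
      moreover have "a1 * \<sigma> a1 = 0" using e(2) by (simp add: geq hc)
      ultimately have a: "a2 = 0" "a1 = 0" "a0 * \<sigma> a0 = 1" using \<sigma>zero by auto
      then have "a0 * y * \<sigma> a3 = y" using e(4) by (simp add: geq hc \<sigma>0)
      then have "y * (a0 * \<sigma> a3) = y * 1" by (simp add: mult.commute mult.left_commute)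
      then have "a0 * \<sigma> a3 = a0 * \<sigma> a0" using e(3) a(3) by simp
      then have "\<sigma> a3 = \<sigma> a0" using a(3) by (metis mult_cancel_left mult_zero_left zero_neq_one)
      then have "a3 = a0" using \<sigma>zero[of "a3 - a0"] by (simp add: \<sigma>diff)
      then show "g \<in> group_center (SL 2 TYPE('a))" using det by (simp add: SL_2_center geq a)
    next
      assume "g \<in> group_center (SL 2 TYPE('a))"
      then obtain c where c: "g = mat2 c 0 0 c" "c * c = 1" by (auto simp: SL_2_center)
      \<comment> \<open>\<open>\<sigma>\<close> fixes 1 and -1, so
        \<open>c * \<sigma> c = c * c\<close>.\<close>
      then have "c = 1 \<or> c = -1" by (simp add: square_eq_1_iff)
      then have "c * \<sigma> c = 1" by (auto simp: \<sigma> \<sigma>neg)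
      then have c1: "c * (x * \<sigma> c) = x" "c * x * \<sigma> c = x" for x by (simp_all add: mult.commute mult.left_commute)
      have "hcongr \<sigma> g X = X" if "X \<in> carrier_mat 2 2" for X
        using that by (auto elim!: mat2_cases simp: hc c(1) \<sigma>0 c1)
      then show "\<forall>i\<in>{1..n}. hcongr \<sigma> g (b i) = b i" using b by blast
    qed
  next
    show "group_center (SL 2 TYPE('a)) \<subseteq> carrier (SL 2 TYPE('a))" by (auto simp: group_center_def)
  qed (use n b inj no_translation in \<open>auto simp: alt_group_carrier\<close>)
qed

section \<open>The field with two elements\<close>

text \<open>Over the field with two elements, the differences of these eight matrices are exactly the 28
  invertible alternating matrices. The last two differ by \<open>J4\<close>, so the symplectic group permutes
  the first six.\<close>

definition kerdock :: "nat \<Rightarrow> 'a::field mat" where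
  "kerdock i = [mat4 0 0 0 0 0 0 0 0 0 0 0 0 0 0 0 0,
    mat4 0 0 0 1 0 0 1 0 0 1 0 0 1 0 0 0,
    mat4 0 0 1 0 0 0 1 1 1 1 0 1 0 1 1 0,
    mat4 0 0 1 1 0 0 0 1 1 0 0 0 1 1 0 0,
    mat4 0 1 0 0 1 0 1 0 0 1 0 1 0 0 1 0,
    mat4 0 1 1 0 1 0 1 1 1 1 0 0 0 1 0 0,
    mat4 0 1 1 1 1 0 0 0 1 0 0 1 1 0 1 0,
    mat4 0 1 0 1 1 0 0 1 0 0 0 1 1 1 1 0] ! (i - 1)"

lemma kerdock_simps [simp]:
  "kerdock 1 = mat4 0 0 0 0 0 0 0 0 0 0 0 0 0 0 0 0"
  "kerdock 2 = mat4 0 0 0 1 0 0 1 0 0 1 0 0 1 0 0 0"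
  "kerdock 3 = mat4 0 0 1 0 0 0 1 1 1 1 0 1 0 1 1 0"
  "kerdock 4 = mat4 0 0 1 1 0 0 0 1 1 0 0 0 1 1 0 0"
  "kerdock 5 = mat4 0 1 0 0 1 0 1 0 0 1 0 1 0 0 1 0"
  "kerdock 6 = mat4 0 1 1 0 1 0 1 1 1 1 0 0 0 1 0 0"
  "kerdock 7 = mat4 0 1 1 1 1 0 0 0 1 0 0 1 1 0 1 0"
  "kerdock 8 = mat4 0 1 0 1 1 0 0 1 0 0 0 1 1 1 1 0"
  "kerdock (Suc 0) = 0\<^sub>m 4 4"
  by (simp_all add: kerdock_def)

lemma atLeastAtMost_1_6: "{1..6::nat} = {1, 2, 3, 4, 5, 6}" by auto
lemma atLeastAtMost_1_8: "{1..8::nat} = {1, 2, 3, 4, 5, 6, 7, 8}" by auto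
lemma atLeastAtMost_3_8: "{3..8::nat} = {3, 4, 5, 6, 7, 8}" by auto
lemma atLeastAtMost_2_6: "{2..6::nat} = {2, 3, 4, 5, 6}" by auto

lemma field_2_simps:
  assumes "card (UNIV :: 'a::field set) = 2"
  shows "(numeral (num.Bit0 k) :: 'a) = 0" "(numeral (num.Bit1 k) :: 'a) = 1" "- x = (x :: 'a)"
    "(x :: 'a) = 0 \<or> x = 1"
proof -
  have char: "CHAR('a) = 2" using CHAR_eq_if_card_prime_power[of 2 1] assms by simp
  have 0: "(2 :: 'a) = 0" using of_nat_CHAR[where 'a = 'a] by (simp add: char)
  have "numeral (num.Bit0 k) = (2 :: 'a) * numeral k" by (metis mult_2 numeral_Bit0)
  then show bit0: "(numeral (num.Bit0 k) :: 'a) = 0" by (simp add: 0)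
  have "numeral (num.Bit1 k) = (numeral (num.Bit0 k) :: 'a) + 1" by (simp add: numeral_Bit1 numeral_Bit0)
  then show "(numeral (num.Bit1 k) :: 'a) = 1" by (simp add: bit0)
  show "- x = x" using 0 by (metis add_eq_0_iff mult_2 mult_zero_left)
  obtain y z :: 'a where yz: "UNIV = {y, z}" using assms by (meson card_2_iff)
  have "(0::'a) \<in> {y, z}" "(1::'a) \<in> {y, z}" "x \<in> {y, z}" unfolding yz[symmetric] by simp_all
  then show "x = 0 \<or> x = 1" by (metis emptyE insertE zero_neq_one)
qed

lemma congr_diff:
  assumes "A \<in> carrier_mat n n" "X \<in> carrier_mat n n" "Y \<in> carrier_mat n n"
  shows "congr A (X - Y) = congr A X - congr A Y"
  using assms by (simp add: congr_def mult_minus_distrib_mat[of _ n n] minus_mult_distrib_mat[of _ n n])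

lemma congr_add:
  assumes "A \<in> carrier_mat n n" "X \<in> carrier_mat n n" "Y \<in> carrier_mat n n"
  shows "congr A (X + Y) = congr A X + congr A Y"
  using assms by (simp add: congr_def mult_add_distrib_mat[of _ n n] add_mult_distrib_mat[of _ n n])

context
  assumes card2: "card (UNIV :: 'a::field set) = 2"
begin

lemmas F2 = field_2_simps[OF card2]

lemma kerdock_carrier: "i \<in> {1..8} \<Longrightarrow> (kerdock i :: 'a mat) \<in> carrier_mat 4 4"
  unfolding atLeastAtMost_1_8 by auto

text \<open>Over two elements the nonzero vertices among the first six form a basis of the
  bivectors, and the matrices fixed by \<open>A\<close> are closed under sums; so \<open>A\<close>
  fixes every bivector.\<close>

lemma scalar_if_congr_kerdock:
  assumes A: "A \<in> carrier_mat 4 4" and e: "\<And>i. i \<in> {1..6} \<Longrightarrow> congr A (kerdock i) = (kerdock i :: 'a mat)"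
  obtains d where "A = d \<cdot>\<^sub>m 1\<^sub>m 4"
proof -
  let ?V = "{X \<in> carrier_mat 4 4. congr A X = X}"
  have V: "kerdock i \<in> ?V" if "i \<in> {1..6}" for i using e[OF that] kerdock_carrier[of i] that by auto
  have add: "X + Y \<in> ?V" if "X \<in> ?V" "Y \<in> ?V" for X Y using that A by (auto simp: congr_add)
  have k: "kerdock 2 \<in> ?V" "kerdock 3 \<in> ?V" "kerdock 4 \<in> ?V" "kerdock 5 \<in> ?V" "kerdock 6 \<in> ?V"
    by (rule V; simp)+
  have "bivector (vec5 1 0 0 0 0) = (kerdock 2 + (kerdock 4 + (kerdock 6)) :: 'a mat)"
    by (simp add: bivector_def F2)
  moreover have "(kerdock 2 + (kerdock 4 + (kerdock 6))) \<in> ?V" by (intro add k)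
  ultimately have v0: "bivector (vec5 1 0 0 0 0) \<in> ?V" by (simp only:)
  have "bivector (vec5 0 1 0 0 0) = (kerdock 2 + (kerdock 3 + (kerdock 5 + (kerdock 6))) :: 'a mat)"
    by (simp add: bivector_def F2)
  moreover have "(kerdock 2 + (kerdock 3 + (kerdock 5 + (kerdock 6)))) \<in> ?V" by (intro add k)
  ultimately have v1: "bivector (vec5 0 1 0 0 0) \<in> ?V" by (simp only:)
  have "bivector (vec5 0 0 1 0 0) = (kerdock 2 + (kerdock 3 + (kerdock 4)) :: 'a mat)"
    by (simp add: bivector_def F2)
  moreover have "(kerdock 2 + (kerdock 3 + (kerdock 4))) \<in> ?V" by (intro add k)
  ultimately have v2: "bivector (vec5 0 0 1 0 0) \<in> ?V" by (simp only:)
  have "bivector (vec5 0 0 0 1 0) = (kerdock 3 + (kerdock 5 + (kerdock 6)) :: 'a mat)"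
    by (simp add: bivector_def F2)
  moreover have "(kerdock 3 + (kerdock 5 + (kerdock 6))) \<in> ?V" by (intro add k)
  ultimately have v3: "bivector (vec5 0 0 0 1 0) \<in> ?V" by (simp only:)
  have "bivector (vec5 0 0 0 0 1) = (kerdock 2 + (kerdock 3 + (kerdock 4 + (kerdock 5 + (kerdock 6)))) :: 'a mat)"
    by (simp add: bivector_def F2)
  moreover have "(kerdock 2 + (kerdock 3 + (kerdock 4 + (kerdock 5 + (kerdock 6))))) \<in> ?V" by (intro add k)
  ultimately have v4: "bivector (vec5 0 0 0 0 1) \<in> ?V" by (simp only:)
  have "congr A (bivector x) = 1 \<cdot>\<^sub>m bivector x"
    if "x \<in> {vec5 1 0 0 0 0, vec5 0 1 0 0 0, vec5 0 0 1 0 0, vec5 0 0 0 1 0, vec5 0 0 0 0 1}" for x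
    using that v0 v1 v2 v3 v4 by auto
  from scalar_if_congr_bivector[OF A _ this] that show ?thesis by auto
qed

lemma inj_on_kerdock: "inj_on (kerdock :: nat \<Rightarrow> 'a mat) {1..8}"
  unfolding inj_on_def atLeastAtMost_1_8 by (simp add: F2)

lemma kerdock_no_translation: "\<forall>s\<in>{3..8}. \<forall>k\<in>{1..8}. kerdock 2 + kerdock s \<noteq> (kerdock k :: 'a mat)"
  unfolding atLeastAtMost_1_8 atLeastAtMost_3_8 by (simp add: F2)

text \<open>1 is the only field element with cube 1. The matrices paired with three-cycles have
  order 3, so no determinant of size four has to be expanded.\<close>

lemma det_1_if_cube_1:
  assumes "A \<in> carrier_mat n n" "A * (A * A) = 1\<^sub>m n" shows "det A = (1 :: 'a)"
proof -
  have "det A * (det A * det A) = 1"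
    using arg_cong[OF assms(2), of det] assms(1) by (simp add: det_mult[of _ n])
  then show ?thesis using F2(4)[of "det A"] by auto
qed

lemmas evaluate = congr_def F2 transpose_def

section \<open>The degree eight action of SL_4(2)\<close>

lemma addrow_mat_4:
  "addrow_mat 4 1 0 (Suc 0) = (mat4 1 1 0 0 0 1 0 0 0 0 1 0 0 0 0 1 :: 'a mat)"
  "addrow_mat 4 1 0 2 = (mat4 1 0 1 0 0 1 0 0 0 0 1 0 0 0 0 1 :: 'a mat)"
  "addrow_mat 4 1 0 3 = (mat4 1 0 0 1 0 1 0 0 0 0 1 0 0 0 0 1 :: 'a mat)"
  "addrow_mat 4 1 (Suc 0) 0 = (mat4 1 0 0 0 1 1 0 0 0 0 1 0 0 0 0 1 :: 'a mat)"
  "addrow_mat 4 1 (Suc 0) 2 = (mat4 1 0 0 0 0 1 1 0 0 0 1 0 0 0 0 1 :: 'a mat)"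
  "addrow_mat 4 1 (Suc 0) 3 = (mat4 1 0 0 0 0 1 0 1 0 0 1 0 0 0 0 1 :: 'a mat)"
  "addrow_mat 4 1 2 0 = (mat4 1 0 0 0 0 1 0 0 1 0 1 0 0 0 0 1 :: 'a mat)"
  "addrow_mat 4 1 2 (Suc 0) = (mat4 1 0 0 0 0 1 0 0 0 1 1 0 0 0 0 1 :: 'a mat)"
  "addrow_mat 4 1 2 3 = (mat4 1 0 0 0 0 1 0 0 0 0 1 1 0 0 0 1 :: 'a mat)"
  "addrow_mat 4 1 3 0 = (mat4 1 0 0 0 0 1 0 0 0 0 1 0 1 0 0 1 :: 'a mat)"
  "addrow_mat 4 1 3 (Suc 0) = (mat4 1 0 0 0 0 1 0 0 0 0 1 0 0 1 0 1 :: 'a mat)"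
  "addrow_mat 4 1 3 2 = (mat4 1 0 0 0 0 1 0 0 0 0 1 0 0 0 1 1 :: 'a mat)"
  by - (rule mat4_eqI; simp; (elim disjE)?; simp)+

lemma elementary_kerdock:
  assumes "k < 4" "l < 4" "k \<noteq> l"
  shows "\<exists>p\<in>carrier (alt_group 8). induces 8 congr kerdock (addrow_mat 4 1 k l :: 'a mat) p"
proof -
  \<comment> \<open>Each transvection becomes a product of four disjoint transpositions, a
    fixed-point-free involution of \<open>Alt_8\<close>.\<close>
  let ?table = "[(0, 1, [(1, 7), (2, 5), (3, 6), (4, 8)]),
     (0, 2, [(1, 4), (2, 6), (3, 5), (7, 8)]),
     (0, 3, [(1, 2), (3, 8), (4, 6), (5, 7)]),
     (1, 0, [(1, 5), (2, 8), (3, 6), (4, 7)]),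
     (1, 2, [(1, 2), (3, 7), (4, 6), (5, 8)]),
     (1, 3, [(1, 6), (2, 4), (3, 5), (7, 8)]),
     (2, 0, [(1, 3), (2, 4), (5, 6), (7, 8)]),
     (2, 1, [(1, 2), (3, 4), (5, 7), (6, 8)]),
     (2, 3, [(1, 5), (2, 7), (3, 6), (4, 8)]),
     (3, 0, [(1, 2), (3, 4), (5, 8), (6, 7)]),
     (3, 1, [(1, 4), (2, 3), (5, 6), (7, 8)]),
     (3, 2, [(1, 8), (2, 5), (3, 6), (4, 7)])]
      :: (nat \<times> nat \<times> (nat \<times> nat) list) list"
  have "list_all (\<lambda>(k, l, ts). induces 8 congr kerdock (addrow_mat 4 1 k l :: 'a mat) (transpositions ts)) ?table"
    unfolding induces_def atLeastAtMost_1_8 by (simp add: addrow_mat_4 evaluate)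
  moreover have "list_all (\<lambda>(k, l, ts). transpositions ts \<in> carrier (alt_group 8)) ?table"
    by (simp add: transpositions_in_alt_group del: transpositions_simps)
  moreover have "(k, l) \<in> (\<lambda>(k, l, ts). (k, l)) ` set ?table"
    using assms by (auto simp: less_4_iff)
  ultimately show ?thesis unfolding list_all_iff by fastforce
qed

lemma three_cycle_kerdock:
  assumes "k \<in> {3..8}"
  shows "\<exists>g\<in>carrier (SL 4 TYPE('a)). induces 8 congr kerdock g (transpositions [(1, 2), (2, k)])"
proof -
  let ?table = "[(3, mat4 0 1 0 0 1 1 0 0 1 0 1 1 0 1 1 0),
     (4, mat4 1 1 0 0 1 0 0 0 0 0 0 1 0 0 1 1),
     (5, mat4 0 0 1 0 0 1 0 1 1 0 1 0 0 1 0 0),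
     (6, mat4 0 1 1 0 1 1 0 1 0 0 1 1 0 0 1 0),
     (7, mat4 1 1 1 0 0 0 0 1 1 0 0 1 0 1 0 1),
     (8, mat4 1 0 1 0 1 0 0 1 1 0 0 0 0 1 1 1)]
      :: (nat \<times> 'a mat) list"
  have "list_all (\<lambda>(k, g). induces 8 congr kerdock g (transpositions [(1, 2), (2, k)])) ?table"
    unfolding induces_def atLeastAtMost_1_8 by (simp add: evaluate)
  moreover have "list_all (\<lambda>(k, g). g \<in> carrier (SL 4 TYPE('a))) ?table"
    by (simp add: det_1_if_cube_1[of _ 4] F2)
  moreover have "k \<in> fst ` set ?table"
    using assms unfolding atLeastAtMost_3_8 by simp
  ultimately show ?thesis unfolding list_all_iff by fastforce
qed

theorem PSL_4_2_iso: "PSL 4 TYPE('a) \<cong> alt_group 8"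
  unfolding PSL_def
proof (rule frame_iso[where m = 4 and b = kerdock and \<phi> = congr, OF group_SL _ _ _ alt_group_is_group _ alt_group_mult alt_group_one])
  show "carrier (SL 4 TYPE('a)) = generate (SL 4 TYPE('a)) (elementary_mats 4 {1})"
  proof (rule SL_generated_by_additive_generators)
    fix X :: "'a set" assume X0: "0 \<in> X" and X: "\<And>x a. x \<in> X \<Longrightarrow> a \<in> {1} \<Longrightarrow> x + a \<in> X"
    show "X = UNIV" by (rule prime_field_additive_generator[OF two_is_prime_nat card2 X0], erule (1) X)
  qed
  show "carrier (alt_group 8) = generate (alt_group 8) {transpositions [(1, 2), (2, k)] | k. k \<in> {3..8}}"
    by (rule alt_group_generated_by_cycles_12k) simp
  show "\<exists>p\<in>carrier (alt_group 8). induces 8 congr (kerdock :: nat \<Rightarrow> 'a mat) g p"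
    if "g \<in> elementary_mats 4 {1}" for g
    using that elementary_kerdock unfolding elementary_mats_def by blast
  show "\<exists>g\<in>carrier (SL 4 TYPE('a)). induces 8 congr (kerdock :: nat \<Rightarrow> 'a mat) g p"
    if "p \<in> {transpositions [(1, 2), (2, k)] | k. k \<in> {3..8}}" for p
    using that three_cycle_kerdock by blast
  show "(\<forall>i\<in>{1..8}. congr g (kerdock i) = kerdock i) \<longleftrightarrow> g \<in> group_center (SL 4 TYPE('a))"
    if g: "g \<in> carrier (SL 4 TYPE('a))" for g
  proof
    assume "\<forall>i\<in>{1..8}. congr g (kerdock i) = kerdock i"
    then obtain d where "g = d \<cdot>\<^sub>m 1\<^sub>m 4" using scalar_if_congr_kerdock[of g] g by auto
    moreover from this have "d ^ 4 = 1" using g by (simp del: mat4_arith)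
    ultimately show "g \<in> group_center (SL 4 TYPE('a))" unfolding SL_center by blast
  next
    assume "g \<in> group_center (SL 4 TYPE('a))"
    then obtain c where "g = c \<cdot>\<^sub>m 1\<^sub>m 4" "c ^ 4 = (1 :: 'a)" unfolding SL_center by blast
    moreover from this have "c = 1" using F2(4)[of c] by auto
    ultimately have "g = 1\<^sub>m 4" by simp
    then show "\<forall>i\<in>{1..8}. congr g (kerdock i) = kerdock i"
      using kerdock_carrier by (simp add: congr_one del: mat4_arith)
  qed
  show "group_center (SL 4 TYPE('a)) \<subseteq> carrier (SL 4 TYPE('a))" by (auto simp: group_center_def)
qed (use kerdock_carrier kerdock_no_translation inj_on_kerdock in
    \<open>auto simp: alt_group_carrier congr_one congr_mult congr_diff simp del: mat4_arith\<close>)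

section \<open>The degree six action of Sp_4(2)\<close>

lemma upper_kerdock:
  "\<exists>p\<in>carrier (sym_group 6). induces 6 congr kerdock (upper s t u :: 'a mat) p"
proof -
  \<comment> \<open>The eight matrices form an elementary abelian group, seen here as a Klein
    four-group on 1, 2, 4, 6 times the transposition of 3 and 5. Transvections become products of
    three transpositions, so this labelling differs by an outer automorphism of \<open>Sym_6\<close>
    from the one that makes them transpositions.\<close>
  let ?table = "[(0, 0, 0, []),
     (0, 0, 1, [(1, 6), (2, 4), (3, 5)]),
     (0, 1, 0, [(3, 5)]),
     (0, 1, 1, [(1, 6), (2, 4)]),
     (1, 0, 0, [(1, 4), (2, 6), (3, 5)]),
     (1, 0, 1, [(1, 2), (4, 6)]),
     (1, 1, 0, [(1, 4), (2, 6)]),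
     (1, 1, 1, [(1, 2), (3, 5), (4, 6)])]
      :: ('a \<times> 'a \<times> 'a \<times> (nat \<times> nat) list) list"
  have "list_all (\<lambda>(s, t, u, ts). induces 6 congr kerdock (upper s t u) (transpositions ts)) ?table"
    unfolding induces_def atLeastAtMost_1_6 by (simp add: upper_def evaluate)
  moreover have "list_all (\<lambda>(s, t, u, ts). transpositions ts \<in> carrier (sym_group 6)) ?table"
    by (simp add: transpositions_in_sym_group del: transpositions_simps)
  moreover have "(s, t, u) \<in> (\<lambda>(s, t, u, ts). (s, t, u)) ` set ?table"
    using F2(4)[of s] F2(4)[of t] F2(4)[of u] by auto
  ultimately show ?thesis unfolding list_all_iff by fastforce
qed

lemma lower_kerdock:
  "\<exists>p\<in>carrier (sym_group 6). induces 6 congr kerdock (lower s t u :: 'a mat) p"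
proof -
  let ?table = "[(0, 0, 0, []),
     (0, 0, 1, [(1, 4), (2, 3), (5, 6)]),
     (0, 1, 0, [(5, 6)]),
     (0, 1, 1, [(1, 4), (2, 3)]),
     (1, 0, 0, [(1, 3), (2, 4), (5, 6)]),
     (1, 0, 1, [(1, 2), (3, 4)]),
     (1, 1, 0, [(1, 3), (2, 4)]),
     (1, 1, 1, [(1, 2), (3, 4), (5, 6)])]
      :: ('a \<times> 'a \<times> 'a \<times> (nat \<times> nat) list) list"
  have "list_all (\<lambda>(s, t, u, ts). induces 6 congr kerdock (lower s t u) (transpositions ts)) ?table"
    unfolding induces_def atLeastAtMost_1_6 by (simp add: lower_def evaluate)
  moreover have "list_all (\<lambda>(s, t, u, ts). transpositions ts \<in> carrier (sym_group 6)) ?table"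
    by (simp add: transpositions_in_sym_group del: transpositions_simps)
  moreover have "(s, t, u) \<in> (\<lambda>(s, t, u, ts). (s, t, u)) ` set ?table"
    using F2(4)[of s] F2(4)[of t] F2(4)[of u] by auto
  ultimately show ?thesis unfolding list_all_iff by fastforce
qed

lemma transposition_kerdock:
  assumes "k \<in> {2..6}"
  shows "\<exists>g\<in>carrier (Sp 2 TYPE('a)). induces 6 congr kerdock g (transpositions [(1, k)])"
proof -
  let ?table = "[(2, mat4 0 1 0 0 1 0 0 0 0 0 0 1 0 0 1 0),
     (3, mat4 1 0 0 0 1 1 0 0 0 1 1 1 1 0 0 1),
     (4, mat4 1 1 0 0 0 1 0 0 0 0 1 0 0 0 1 1),
     (5, mat4 0 0 0 1 1 0 1 0 0 1 0 1 1 0 0 0),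
     (6, mat4 1 0 0 1 1 1 1 0 0 0 1 1 0 0 0 1)]
      :: (nat \<times> 'a mat) list"
  have "list_all (\<lambda>(k, g). induces 6 congr kerdock g (transpositions [(1, k)])) ?table"
    unfolding induces_def atLeastAtMost_1_6 by (simp add: evaluate)
  moreover have "list_all (\<lambda>(k, g). g \<in> carrier (Sp 2 TYPE('a))) ?table"
    by (simp add: J4_def F2)
  moreover have "k \<in> fst ` set ?table"
    using assms unfolding atLeastAtMost_2_6 by simp
  ultimately show ?thesis unfolding list_all_iff by fastforce
qed

theorem type_C_2_2_iso: "type_C 2 TYPE('a) \<cong> sym_group 6"
  unfolding type_C_def
proof (rule frame_iso[where m = 4 and b = kerdock and \<phi> = congr, OF group_Sp_2 _ _ _ sym_group_is_group _ sym_group_mult sym_group_one])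
  show "\<exists>p\<in>carrier (sym_group 6). induces 6 congr (kerdock :: nat \<Rightarrow> 'a mat) g p" if "g \<in> unipotents" for g
    using that upper_kerdock lower_kerdock unfolding unipotents_def by blast
  show "carrier (Sp 2 TYPE('a)) = generate (Sp 2 TYPE('a)) unipotents"
    by (rule Sp_2_generated_by_unipotents)
  show "carrier (sym_group 6) = generate (sym_group 6) {transpositions [(1, k)] | k. k \<in> {2..6}}"
    by (rule sym_group_generated_by_transpositions_1k)
  show "\<exists>g\<in>carrier (Sp 2 TYPE('a)). induces 6 congr (kerdock :: nat \<Rightarrow> 'a mat) g p"
    if "p \<in> {transpositions [(1, k)] | k. k \<in> {2..6}}" for p
    using that transposition_kerdock by blast
  show "(\<forall>i\<in>{1..6}. congr g (kerdock i) = kerdock i) \<longleftrightarrow> g \<in> group_center (Sp 2 TYPE('a))"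
    if g: "g \<in> carrier (Sp 2 TYPE('a))" for g
  proof
    assume "\<forall>i\<in>{1..6}. congr g (kerdock i) = kerdock i"
    then obtain d where d: "g = d \<cdot>\<^sub>m 1\<^sub>m 4" using scalar_if_congr_kerdock[of g] g by auto
    moreover have "d\<^sup>2 = 1" using g by (simp add: d J4_def power2_eq_square)
    ultimately show "g \<in> group_center (Sp 2 TYPE('a))" unfolding Sp_2_center by blast
  next
    assume "g \<in> group_center (Sp 2 TYPE('a))"
    then obtain c where "g = c \<cdot>\<^sub>m 1\<^sub>m 4" "c\<^sup>2 = (1 :: 'a)" unfolding Sp_2_center by blast
    moreover from this have "c = 1" using F2(4)[of c] by auto
    ultimately have "g = 1\<^sub>m 4" by simp
    then show "\<forall>i\<in>{1..6}. congr g (kerdock i) = kerdock i"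
      using kerdock_carrier by (simp add: congr_one del: mat4_arith)
  qed
  show "group_center (Sp 2 TYPE('a)) \<subseteq> carrier (Sp 2 TYPE('a))" by (auto simp: group_center_def)
  show "inj_on (kerdock :: nat \<Rightarrow> 'a mat) {1..6}" by (rule inj_on_subset[OF inj_on_kerdock]) auto
qed (use kerdock_carrier kerdock_no_translation in
    \<open>auto simp: sym_group_carrier congr_one congr_mult congr_diff simp del: mat4_arith\<close>)

end

section \<open>Linear groups of dimension two as alternating groups\<close>

lemma interval_simps:
  "{1..5::nat} = {1, 2, 3, 4, 5}" "{3..5::nat} = {3, 4, 5}"
  "{1..6::nat} = {1, 2, 3, 4, 5, 6}" "{3..6::nat} = {3, 4, 5, 6}"
  by auto

text \<open>In the next three proofs the matrices \<open>b i\<close> span a quadratic space with the determinant as its form: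
  Hermitian matrices for \<open>q = 4\<close> and \<open>q = 9\<close> (with \<open>\<sigma>\<close> the Frobenius involution),
  symmetric ones for \<open>q = 5\<close>. All differences \<open>b i - b j\<close> have the same determinant, so the \<open>b i\<close>
  form a regular simplex.\<close>

theorem PSL_2_4_iso:
  assumes card: "card (UNIV :: 'a::field set) = 4"
  shows "PSL 2 TYPE('a) \<cong> alt_group 5"
proof -
  have p: "prime (2::nat)" "card (UNIV :: 'a set) = 2\<^sup>2" using card by simp_all
  have char: "CHAR('a) = 2" using CHAR_eq_if_card_prime_power p by blast
  have char0: "(2 :: 'a) = 0" using of_nat_CHAR[where 'a = 'a] by (simp add: char)
  obtain w :: 'a where w: "w \<notin> range of_int" and ww: "w * w = 1 + w"
    using field_4_generator[OF card] by blast
  define e where "e = coord w"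
  have w_eq: "w = e 0 1" by (simp add: e_def coord_def)
  \<comment> \<open>Writing even 0 and 1 in coordinates keeps all entries in the form
    \<open>e x y\<close>, on which \<open>arith\<close> computes.\<close>
  have e01: "0 = e 0 0" "1 = e 1 0" by (simp_all add: e_def coord_def)
  have mult: "e x y * e x' y' = e (x * x' + 1 * (y * y')) (x * y' + y * x' + 1 * (y * y'))" for x y x' y'
    unfolding e_def by (rule coord_mult) (simp add: ww)
  note arith = mult coord_add[of w, folded e_def] coord_diff[of w, folded e_def]
    coord_eq_iff[OF p w, folded e_def, simplified]
  define \<sigma> where "\<sigma> x = x * x" for x :: 'a
  \<comment> \<open>\<open>w\<close> has trace 1, so its Frobenius conjugate is
    \<open>1 - w\<close>.\<close>
  have \<sigma>e: "\<sigma> (e x y) = e (x + 1 * y) (- y)" for x y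
  proof -
    have sq: "of_int x * of_int x = (of_int x :: 'a)" for x
      using of_int_eq_iff_dvd[of "x * x" x, where 'a = 'a] by (simp add: char)
    have "(e x y) * (e x y) = of_int x * of_int x + of_int y * of_int y * (w * w) + 2 * (of_int x * of_int y * w)"
      by (simp add: e_def coord_def algebra_simps)
    also have "\<dots> = of_int x + of_int y * (1 + w)" by (simp add: char0 sq ww)
    also have "\<dots> = of_int (x + 1 * y) + of_int (- y) * w + 2 * (of_int y * w)" by (simp add: algebra_simps)
    finally show ?thesis by (simp add: \<sigma>_def e_def coord_def char0)
  qed
  have \<sigma>: "\<sigma> (x + y) = \<sigma> x + \<sigma> y" "\<sigma> (x * y) = \<sigma> x * \<sigma> y" "\<sigma> 1 = 1" for x y
  proof -
    obtain x0 x1 y0 y1 where xy: "x = e x0 x1" "y = e y0 y1"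
      unfolding e_def using coord_surj[OF p w] by metis
    show "\<sigma> (x + y) = \<sigma> x + \<sigma> y" by (simp add: xy arith(2) \<sigma>e algebra_simps)
    show "\<sigma> (x * y) = \<sigma> x * \<sigma> y" "\<sigma> 1 = 1" by (simp_all add: \<sigma>_def mult_ac)
  qed
  define b where "b = (\<lambda>i. [mat2 (e 0 0) (e 0 0) (e 0 0) (e 0 0),
    mat2 (e 0 0) (e 0 1) (e 1 1) (e 0 0),
    mat2 (e 0 0) (e 1 0) (e 1 0) (e 0 0),
    mat2 (e 0 0) (e 1 1) (e 0 1) (e 1 0),
    mat2 (e 1 0) (e 1 1) (e 0 1) (e 0 0)] ! (i - 1))"
  have b: "b 1 = mat2 (e 0 0) (e 0 0) (e 0 0) (e 0 0)"
    "b 2 = mat2 (e 0 0) (e 0 1) (e 1 1) (e 0 0)"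
    "b 3 = mat2 (e 0 0) (e 1 0) (e 1 0) (e 0 0)"
    "b 4 = mat2 (e 0 0) (e 1 1) (e 0 1) (e 1 0)"
    "b 5 = mat2 (e 1 0) (e 1 1) (e 0 1) (e 0 0)"
    "b (Suc 0) = mat2 (e 0 0) (e 0 0) (e 0 0) (e 0 0)"
    by (simp_all add: b_def)
  note ev = b hcongr_def transpose_def arith \<sigma>e e01
  show ?thesis
  \<comment> \<open>Transvections have order 2 here and become double transpositions.\<close>
  proof (rule PSL_2_frame_iso[where \<sigma> = \<sigma> and b = b and S = "{1, e 0 1}" and
      T = "[(mat2 1 1 0 1, [(1, 3), (2, 5)]),
        (mat2 1 0 1 1, [(1, 3), (2, 4)]),
        (mat2 1 (e 0 1) 0 1, [(1, 2), (3, 5)]),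
        (mat2 1 0 (e 0 1) 1, [(1, 4), (2, 3)])]" and
      C = "[(3, mat2 (e 1 1) (e 0 0) (e 0 0) (e 0 1)),
        (4, mat2 (e 0 1) (e 0 0) (e 1 1) (e 1 1)),
        (5, mat2 (e 0 1) (e 0 1) (e 0 0) (e 1 1))]", OF \<sigma>])
    fix X :: "'a set" assume X0: "0 \<in> X" and X: "\<And>x a. x \<in> X \<Longrightarrow> a \<in> {1, e 0 1} \<Longrightarrow> x + a \<in> X"
    show "X = UNIV" by (rule quadratic_field_additive_generators[OF p w, unfolded w_eq, OF X0], erule (1) X)
  next
    fix V
    assume V: "\<And>i. i \<in> {1..5} \<Longrightarrow> b i \<in> V" and add: "\<And>X Y. X \<in> V \<Longrightarrow> Y \<in> V \<Longrightarrow> X + Y \<in> V"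
      and diff: "\<And>X Y. X \<in> V \<Longrightarrow> Y \<in> V \<Longrightarrow> X - Y \<in> V"
    have k: "b 1 \<in> V" "b 2 \<in> V" "b 3 \<in> V" "b 4 \<in> V" "b 5 \<in> V" by (rule V; simp)+
    \<comment> \<open>The off-diagonal entries of \<open>b 2\<close>, \<open>b 3\<close> and
      \<open>b 5\<close> add up to 0, which isolates a diagonal unit; likewise with
      \<open>b 4\<close> in place of \<open>b 5\<close>.\<close>
    have "b 2 + (b 3 + b 5) \<in> V" "b 2 + (b 3 + b 4) \<in> V" "b 2 \<in> V"
      by (intro add diff k)+
    moreover have "b 2 + (b 3 + b 5) = mat2 1 0 0 0" "b 2 + (b 3 + b 4) = mat2 0 0 0 1"
      "b 2 = mat2 0 (e 0 1) (e 1 1) 0" "e 0 1 \<noteq> 0"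
      by (simp_all add: ev)
    ultimately show "mat2 1 0 0 0 \<in> V \<and> mat2 0 0 0 1 \<in> V \<and> (\<exists>y z. y \<noteq> 0 \<and> mat2 0 y z 0 \<in> V)"
      by metis
  qed (unfold induces_def inj_on_def interval_simps, auto simp: ev)
qed

theorem PSL_2_9_iso:
  assumes card: "card (UNIV :: 'a::field set) = 9"
  shows "PSL 2 TYPE('a) \<cong> alt_group 6"
proof -
  have p: "prime (3::nat)" "card (UNIV :: 'a set) = 3\<^sup>2" using card by simp_all
  have char: "CHAR('a) = 3" using CHAR_eq_if_card_prime_power p by blast
  have char0: "(3 :: 'a) = 0" using of_nat_CHAR[where 'a = 'a] by (simp add: char)
  obtain w :: 'a where w: "w \<notin> range of_int" and ww: "w * w = - 1"
    using field_9_generator[OF card] by blast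
  define e where "e = coord w"
  have w_eq: "w = e 0 1" by (simp add: e_def coord_def)
  have e01: "0 = e 0 0" "1 = e 1 0" by (simp_all add: e_def coord_def)
  have mult: "e x y * e x' y' = e (x * x' + (- 1) * (y * y')) (x * y' + y * x' + 0 * (y * y'))" for x y x' y'
    unfolding e_def by (rule coord_mult) (simp add: ww)
  note arith = mult coord_add[of w, folded e_def] coord_diff[of w, folded e_def]
    coord_eq_iff[OF p w, folded e_def, simplified]
  define \<sigma> where "\<sigma> x = x * x * x" for x :: 'a
  have \<sigma>e: "\<sigma> (e x y) = e (x + 0 * y) (- y)" for x y
  proof -
    have cube: "of_int x * of_int x * of_int x = (of_int x :: 'a)" for x
    proof -
      \<comment> \<open>\<open>x * x * x - x\<close> is the product of three consecutive
        integers.\<close>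
      have "3 dvd x \<or> 3 dvd x - 1 \<or> 3 dvd x + 1" by presburger
      then have "3 dvd x * ((x - 1) * (x + 1))" by (auto intro: dvd_mult dvd_mult2)
      also have "x * ((x - 1) * (x + 1)) = x * x * x - x" by (simp add: algebra_simps)
      finally show ?thesis
        using of_int_eq_iff_dvd[of "x * x * x" x, where 'a = 'a] by (simp add: char)
    qed
    have "e x y * e x y * e x y = of_int x * of_int x * of_int x + of_int y * of_int y * of_int y * (w * (w * w))
        + 3 * (of_int x * of_int x * of_int y * w + of_int x * of_int y * of_int y * (w * w))"
      by (simp add: e_def coord_def algebra_simps)
    also have "\<dots> = of_int x - of_int y * w" by (simp add: char0 cube ww)
    finally show ?thesis by (simp add: \<sigma>_def e_def coord_def)
  qed
  have \<sigma>: "\<sigma> (x + y) = \<sigma> x + \<sigma> y" "\<sigma> (x * y) = \<sigma> x * \<sigma> y" "\<sigma> 1 = 1" for x y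
  proof -
    obtain x0 x1 y0 y1 where xy: "x = e x0 x1" "y = e y0 y1"
      unfolding e_def using coord_surj[OF p w] by metis
    show "\<sigma> (x + y) = \<sigma> x + \<sigma> y" by (simp add: xy arith(2) \<sigma>e algebra_simps)
    show "\<sigma> (x * y) = \<sigma> x * \<sigma> y" "\<sigma> 1 = 1" by (simp_all add: \<sigma>_def mult_ac)
  qed
  define b where "b = (\<lambda>i. [mat2 (e 0 0) (e 0 0) (e 0 0) (e 0 0),
    mat2 (e 0 0) (e 1 1) (e 1 2) (e 0 0),
    mat2 (e 0 0) (e 2 2) (e 2 1) (e 1 0),
    mat2 (e 2 0) (e 0 1) (e 0 2) (e 1 0),
    mat2 (e 2 0) (e 1 0) (e 1 0) (e 1 0),
    mat2 (e 2 0) (e 2 2) (e 2 1) (e 0 0)] ! (i - 1))"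
  have b: "b 1 = mat2 (e 0 0) (e 0 0) (e 0 0) (e 0 0)"
    "b 2 = mat2 (e 0 0) (e 1 1) (e 1 2) (e 0 0)"
    "b 3 = mat2 (e 0 0) (e 2 2) (e 2 1) (e 1 0)"
    "b 4 = mat2 (e 2 0) (e 0 1) (e 0 2) (e 1 0)"
    "b 5 = mat2 (e 2 0) (e 1 0) (e 1 0) (e 1 0)"
    "b 6 = mat2 (e 2 0) (e 2 2) (e 2 1) (e 0 0)"
    "b (Suc 0) = mat2 (e 0 0) (e 0 0) (e 0 0) (e 0 0)"
    by (simp_all add: b_def)
  note ev = b hcongr_def transpose_def arith \<sigma>e e01
  show ?thesis
  \<comment> \<open>Transvections have order 3 here and become products of two disjoint
    three-cycles.\<close>
  proof (rule PSL_2_frame_iso[where \<sigma> = \<sigma> and b = b and S = "{1, e 0 1}" and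
      T = "[(mat2 1 1 0 1, [(1, 2), (2, 6), (3, 5), (5, 4)]),
        (mat2 1 0 1 1, [(1, 3), (3, 2), (4, 5), (5, 6)]),
        (mat2 1 (e 0 1) 0 1, [(1, 2), (2, 6), (3, 4), (4, 5)]),
        (mat2 1 0 (e 0 1) 1, [(1, 2), (2, 3), (4, 5), (5, 6)])]" and
      C = "[(3, mat2 (e 1 0) (e 0 0) (e 1 2) (e 1 0)),
        (4, mat2 (e 1 1) (e 2 2) (e 1 2) (e 1 2)),
        (5, mat2 (e 1 2) (e 2 2) (e 1 2) (e 1 1)),
        (6, mat2 (e 1 0) (e 2 2) (e 0 0) (e 1 0))]", OF \<sigma>])
    fix X :: "'a set" assume X0: "0 \<in> X" and X: "\<And>x a. x \<in> X \<Longrightarrow> a \<in> {1, e 0 1} \<Longrightarrow> x + a \<in> X"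
    show "X = UNIV" by (rule quadratic_field_additive_generators[OF p w, unfolded w_eq, OF X0], erule (1) X)
  next
    fix V
    assume V: "\<And>i. i \<in> {1..6} \<Longrightarrow> b i \<in> V" and add: "\<And>X Y. X \<in> V \<Longrightarrow> Y \<in> V \<Longrightarrow> X + Y \<in> V"
      and diff: "\<And>X Y. X \<in> V \<Longrightarrow> Y \<in> V \<Longrightarrow> X - Y \<in> V"
    have k: "b 1 \<in> V" "b 2 \<in> V" "b 3 \<in> V" "b 4 \<in> V" "b 5 \<in> V" "b 6 \<in> V" by (rule V; simp)+
    \<comment> \<open>\<open>b 2 + b 6\<close> is twice a diagonal unit, and
      \<open>- 2 = 1\<close>.\<close>
    have "b 1 - b 2 - b 6 \<in> V" "b 2 + b 3 \<in> V" "b 2 \<in> V"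
      by (intro add diff k)+
    moreover have "b 1 - b 2 - b 6 = mat2 1 0 0 0" "b 2 + b 3 = mat2 0 0 0 1"
      "b 2 = mat2 0 (e 1 1) (e 1 2) 0" "e 1 1 \<noteq> 0"
      by (simp_all add: ev)
    ultimately show "mat2 1 0 0 0 \<in> V \<and> mat2 0 0 0 1 \<in> V \<and> (\<exists>y z. y \<noteq> 0 \<and> mat2 0 y z 0 \<in> V)"
      by metis
  qed (unfold induces_def inj_on_def interval_simps, auto simp: ev)
qed

theorem PSL_2_5_iso:
  assumes card: "card (UNIV :: 'a::field set) = 5"
  shows "PSL 2 TYPE('a) \<cong> alt_group 5"
proof -
  have p: "prime (5::nat)" by simp
  have char: "CHAR('a) = 5" using CHAR_eq_if_card_prime_power[of 5 1] p card by simp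
  define e where "e x = (of_int x :: 'a)" for x :: int
  have e01: "0 = e 0" "1 = e 1" by (simp_all add: e_def)
  have eq: "e x = e y \<longleftrightarrow> 5 dvd x - y" for x y
    unfolding e_def of_int_eq_iff_dvd by (simp add: char)
  have arith: "e x + e y = e (x + y)" "e x - e y = e (x - y)" "e x * e y = e (x * y)" for x y
    by (simp_all add: e_def)
  \<comment> \<open>The identity takes the place of the involution: the simplex lies in the
    symmetric matrices over the prime field.\<close>
  define \<sigma> where "\<sigma> x = x" for x :: 'a
  have \<sigma>: "\<sigma> (x + y) = \<sigma> x + \<sigma> y" "\<sigma> (x * y) = \<sigma> x * \<sigma> y" "\<sigma> 1 = 1" for x y
    by (simp_all add: \<sigma>_def)
  define b where "b = (\<lambda>i. [mat2 (e 0) (e 0) (e 0) (e 0),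
    mat2 (e 1) (e 0) (e 0) (e 2),
    mat2 (e 2) (e 2) (e 2) (e 3),
    mat2 (e 3) (e 1) (e 1) (e 1),
    mat2 (e 4) (e 2) (e 2) (e 4)] ! (i - 1))"
  have b: "b 1 = mat2 (e 0) (e 0) (e 0) (e 0)"
    "b 2 = mat2 (e 1) (e 0) (e 0) (e 2)"
    "b 3 = mat2 (e 2) (e 2) (e 2) (e 3)"
    "b 4 = mat2 (e 3) (e 1) (e 1) (e 1)"
    "b 5 = mat2 (e 4) (e 2) (e 2) (e 4)"
    "b (Suc 0) = mat2 (e 0) (e 0) (e 0) (e 0)"
    by (simp_all add: b_def)
  note ev = b hcongr_def transpose_def arith eq \<sigma>_def e01
  show ?thesis
  \<comment> \<open>Transvections have order 5 here and become five-cycles.\<close>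
  proof (rule PSL_2_frame_iso[where \<sigma> = \<sigma> and b = b and S = "{1}" and
      T = "[(mat2 1 1 0 1, [(1, 2), (2, 5), (5, 4), (4, 3)]),
        (mat2 1 0 1 1, [(1, 4), (4, 2), (2, 5), (5, 3)])]" and
      C = "[(3, mat2 (e 2) (e 1) (e 2) (e 4)),
        (4, mat2 (e 2) (e 2) (e 4) (e 2)),
        (5, mat2 (e 1) (e 4) (e 3) (e 3))]", OF \<sigma>])
    fix X :: "'a set" assume X0: "0 \<in> X" and X: "\<And>x a. x \<in> X \<Longrightarrow> a \<in> {1} \<Longrightarrow> x + a \<in> X"
    show "X = UNIV" by (rule prime_field_additive_generator[OF p card X0], erule (1) X)
  next
    fix V
    assume V: "\<And>i. i \<in> {1..5} \<Longrightarrow> b i \<in> V" and add: "\<And>X Y. X \<in> V \<Longrightarrow> Y \<in> V \<Longrightarrow> X + Y \<in> V"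
      and diff: "\<And>X Y. X \<in> V \<Longrightarrow> Y \<in> V \<Longrightarrow> X - Y \<in> V"
    have k: "b 1 \<in> V" "b 2 \<in> V" "b 3 \<in> V" "b 4 \<in> V" "b 5 \<in> V" by (rule V; simp)+
    have "b 3 - b 2 - b 2 - b 5 \<in> V" "b 4 - b 3 - b 3 - b 5 \<in> V" "b 2 + b 5 + (b 3 + b 3 + b 5 - b 4) \<in> V"
      by (intro add diff k)+
    moreover have "b 3 - b 2 - b 2 - b 5 = mat2 1 0 0 0" "b 4 - b 3 - b 3 - b 5 = mat2 0 0 0 1"
      "b 2 + b 5 + (b 3 + b 3 + b 5 - b 4) = mat2 0 (e 2) (e 2) 0" "e 2 \<noteq> 0"
      by (simp_all add: ev)
    ultimately show "mat2 1 0 0 0 \<in> V \<and> mat2 0 0 0 1 \<in> V \<and> (\<exists>y z. y \<noteq> 0 \<and> mat2 0 y z 0 \<in> V)"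
      by metis
  qed (unfold induces_def inj_on_def interval_simps, auto simp: ev)
qed

section \<open>The simple group of order 168\<close>

definition mat3 :: "'a::field \<Rightarrow> 'a \<Rightarrow> 'a \<Rightarrow> 'a \<Rightarrow> 'a \<Rightarrow> 'a \<Rightarrow> 'a \<Rightarrow> 'a \<Rightarrow> 'a \<Rightarrow> 'a mat" where
  "mat3 a00 a01 a02 a10 a11 a12 a20 a21 a22 =
     mat_of_rows_list 3 [[a00, a01, a02], [a10, a11, a12], [a20, a21, a22]]"

lemma mat3_carrier [simp]: "mat3 a00 a01 a02 a10 a11 a12 a20 a21 a22 \<in> carrier_mat 3 3"
  by (simp add: mat3_def mat_of_rows_list_def numeral_eq_Suc)

lemma mat3_dim [simp]:
  "dim_row (mat3 a00 a01 a02 a10 a11 a12 a20 a21 a22) = 3"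
  "dim_col (mat3 a00 a01 a02 a10 a11 a12 a20 a21 a22) = 3"
  by (simp_all add: mat3_def mat_of_rows_list_def)

lemma mat3_index [simp]:
  fixes a00 a01 a02 a10 a11 a12 a20 a21 a22 :: "'a::field"
  defines "M \<equiv> mat3 a00 a01 a02 a10 a11 a12 a20 a21 a22"
  shows "M $$ (0,0) = a00" "M $$ (0,Suc 0) = a01" "M $$ (0,2) = a02"
    "M $$ (Suc 0,0) = a10" "M $$ (Suc 0,Suc 0) = a11" "M $$ (Suc 0,2) = a12"
    "M $$ (2,0) = a20" "M $$ (2,Suc 0) = a21" "M $$ (2,2) = a22"
  by (simp_all add: M_def mat3_def mat_of_rows_list_def)

lemma less_3_iff: "(i::nat) < 3 \<longleftrightarrow> i = 0 \<or> i = 1 \<or> i = 2" by auto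

lemma mat3_eqI:
  assumes "A \<in> carrier_mat 3 3" "B \<in> carrier_mat 3 3"
    and "\<And>i j. i \<in> {0, Suc 0, 2} \<Longrightarrow> j \<in> {0, Suc 0, 2} \<Longrightarrow> A $$ (i,j) = B $$ (i,j)"
  shows "A = B"
  using assms by (intro eq_matI) (simp_all add: less_3_iff)

lemma index_mult_mat3:
  assumes "A \<in> carrier_mat 3 3" "B \<in> carrier_mat 3 3" "i < 3" "j < 3"
  shows "(A * B) $$ (i,j) = A $$ (i,0) * B $$ (0,j) + A $$ (i,Suc 0) * B $$ (Suc 0,j) + A $$ (i,2) * B $$ (2,j)"
proof -
  have "{0..<3} = {0, 1, 2::nat}" by auto
  then show ?thesis using assms by (simp add: scalar_prod_def add.assoc)
qed

section \<open>The projective line and the affine space of triples\<close>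

definition act2 :: "'a::field mat \<Rightarrow> 'a \<times> 'a \<Rightarrow> 'a \<times> 'a" where
  "act2 A = (\<lambda>(x, y). (A $$ (0,0) * x + A $$ (0,1) * y, A $$ (1,0) * x + A $$ (1,1) * y))"

definition act3 :: "'a::field mat \<Rightarrow> 'a \<times> 'a \<times> 'a \<Rightarrow> 'a \<times> 'a \<times> 'a" where
  "act3 A = (\<lambda>(x, y, z). (A $$ (0,0) * x + A $$ (0,1) * y + A $$ (0,2) * z,
     A $$ (1,0) * x + A $$ (1,1) * y + A $$ (1,2) * z, A $$ (2,0) * x + A $$ (2,1) * y + A $$ (2,2) * z))"

definition plus3 :: "'a::field \<times> 'a \<times> 'a \<Rightarrow> 'a \<times> 'a \<times> 'a \<Rightarrow> 'a \<times> 'a \<times> 'a" where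
  "plus3 = (\<lambda>(x, y, z) (x', y', z'). (x + x', y + y', z + z'))"

text \<open>Equality of points of the projective line, expressed on homogeneous coordinates.\<close>

definition proportional :: "'a::field \<times> 'a \<Rightarrow> 'a \<times> 'a \<Rightarrow> bool" where
  "proportional u v \<longleftrightarrow> (\<exists>c. c \<noteq> 0 \<and> u = (c * fst v, c * snd v))"

lemma act2_mult:
  assumes "A \<in> carrier_mat 2 2" "B \<in> carrier_mat 2 2"
  shows "act2 (A * B) u = act2 A (act2 B u)"
  using assms by (cases u) (auto elim!: mat2_cases simp: act2_def algebra_simps simp del: index_mult_mat(1))

lemma act2_one: "act2 (1\<^sub>m 2) u = u"
  by (cases u) (simp add: act2_def)

lemma act3_mult:
  assumes "A \<in> carrier_mat 3 3" "B \<in> carrier_mat 3 3"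
  shows "act3 (A * B) x = act3 A (act3 B x)"
  using assms by (cases x) (simp add: act3_def index_mult_mat3 algebra_simps del: index_mult_mat(1))

lemma act3_one: "act3 (1\<^sub>m 3) x = x"
  by (cases x) (simp add: act3_def)

lemma act3_plus3: "act3 A (plus3 x y) = plus3 (act3 A x) (act3 A y)"
  by (cases x; cases y) (simp add: act3_def plus3_def algebra_simps)

lemma plus3_assoc: "plus3 (plus3 x y) z = plus3 x (plus3 y z)"
  by (cases x; cases y; cases z) (simp add: plus3_def add.assoc)

lemma proportional_refl: "proportional u u"
  unfolding proportional_def by (rule exI[of _ 1]) simp

lemma proportional_sym: "proportional u v \<Longrightarrow> proportional v u"
  unfolding proportional_def
  by (elim exE conjE, rule_tac x = "inverse c" in exI) (simp flip: mult.assoc)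

lemma proportional_trans: "proportional u v \<Longrightarrow> proportional v w \<Longrightarrow> proportional u w"
  unfolding proportional_def
  by (elim exE conjE, rule_tac x = "c * ca" in exI) (simp add: mult.assoc)

lemma proportional_act2: "proportional u v \<Longrightarrow> proportional (act2 A u) (act2 A v)"
  unfolding proportional_def
  by (elim exE conjE, rule_tac x = c in exI) (cases v, simp add: act2_def algebra_simps)

lemma proportional_cross: "proportional (a, b) (c, d) \<Longrightarrow> a * d = b * c"
  unfolding proportional_def by auto

lemma proportionalI:
  assumes "a * d = b * c" "a \<noteq> 0 \<or> b \<noteq> 0" "c \<noteq> 0 \<or> d \<noteq> (0::'a::field)"
  shows "proportional (a, b) (c, d)"
proof (cases "c = 0")
  case True
  then have "a = 0" using assms by auto
  then show ?thesis using True assms unfolding proportional_def by (intro exI[of _ "b / d"]) auto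
next
  case False
  then have "b = a / c * d" using assms(1) by (simp add: field_simps)
  moreover have "a \<noteq> 0" using calculation assms(2) by auto
  ultimately show ?thesis using False unfolding proportional_def by (intro exI[of _ "a / c"]) auto
qed

text \<open>The first two premises say that the fractional linear map of \<open>a b c d\<close>
  exchanges infinity and \<open>q\<close>. Every further pair with \<open>x\<close> sent to
  \<open>y\<close> then satisfies \<open>b = c * (x * y - q * (x + y))\<close>, so two pairs with
  different values of the bracket force \<open>c = 0\<close>.\<close>

lemma swap_image_of_infinity:
  fixes a b c d q x y x' y' :: "'a::field"
  assumes "a = c * q" "c * q + d = 0" "a * x + b = (c * x + d) * y" "a * x' + b = (c * x' + d) * y'"
    and "x * y - q * (x + y) \<noteq> x' * y' - q * (x' + y')"
  shows "c = 0"
proof -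
  have d: "d = - (c * q)" using assms(2) by (simp add: eq_neg_iff_add_eq_0 add.commute)
  have "b = c * (x * y - q * (x + y))" "b = c * (x' * y' - q * (x' + y'))"
    using assms(3,4) unfolding assms(1) d by (simp_all add: algebra_simps eq_diff_eq)
  then show ?thesis using assms(5) by auto
qed

text \<open>The projective line over the field with seven elements carries the structure of an affine
  space over the field with two elements, on which the special linear group acts by affine maps
  (not fixing a point); passing to the linear parts gives the isomorphism.\<close>

definition affine_point :: "'b::field \<times> 'b \<times> 'b \<Rightarrow> 'a::field \<times> 'a" where
  "affine_point x = (if x = (0, 0, 0) then (1, 0) else if x = (1, 0, 0) then (0, 1)
     else if x = (0, 1, 0) then (1, 1) else if x = (0, 0, 1) then (2, 1)
     else if x = (1, 1, 0) then (3, 1) else if x = (0, 1, 1) then (4, 1)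
     else if x = (1, 1, 1) then (5, 1) else (6, 1))"

text \<open>\<open>g\<close> permutes the projective line as the affine map with linear part
  \<open>h\<close> and translation part \<open>t\<close>.\<close>

definition linked :: "'a::field mat \<Rightarrow> 'b::field mat \<Rightarrow> 'b \<times> 'b \<times> 'b \<Rightarrow> bool" where
  "linked g h t \<longleftrightarrow> (\<forall>x. proportional (act2 g (affine_point x)) (affine_point (plus3 (act3 h x) t)))"

text \<open>The relation forgets the translation part, so the crux is that no nontrivial translation
  of the affine space is induced by a matrix: only then is the kernel in \<open>SL_2\<close> the
  centre.\<close>

theorem PSL_2_7_iso_PSL_3_2:
  assumes card7: "card (UNIV :: 'a::field set) = 7" and card2: "card (UNIV :: 'b::field set) = 2"
  shows "PSL 2 TYPE('a) \<cong> PSL 3 TYPE('b)"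
proof -
  note F2 = field_2_simps[OF card2]
  have p: "prime (7::nat)" by simp
  have char: "CHAR('a) = 7" using CHAR_eq_if_card_prime_power[of 7 1] p card7 by simp
  define e where "e x = (of_int x :: 'a)" for x :: int
  have e01: "0 = e 0" "1 = e 1" by (simp_all add: e_def)
  have eq: "e x = e y \<longleftrightarrow> 7 dvd x - y" for x y
    unfolding e_def of_int_eq_iff_dvd by (simp add: char)
  have arith: "e x + e y = e (x + y)" "e x - e y = e (x - y)" "e x * e y = e (x * y)" for x y
    by (simp_all add: e_def)
  let ?P = "affine_point :: 'b \<times> 'b \<times> 'b \<Rightarrow> 'a \<times> 'a"
  \<comment> \<open>\<open>(1, 0, 1)\<close> is the one triple left for the last branch of
    \<open>affine_point\<close>.\<close>
  have P: "?P (0, 0, 0) = (e 1, e 0)"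
    "?P (1, 0, 0) = (e 0, e 1)"
    "?P (0, 1, 0) = (e 1, e 1)"
    "?P (0, 0, 1) = (e 2, e 1)"
    "?P (1, 1, 0) = (e 3, e 1)"
    "?P (0, 1, 1) = (e 4, e 1)"
    "?P (1, 1, 1) = (e 5, e 1)"
    "?P (1, 0, 1) = (e 6, e 1)"
    by (simp_all add: affine_point_def e_def)
  have all3: "(\<forall>x :: 'b \<times> 'b \<times> 'b. Q x) \<longleftrightarrow> Q (0, 0, 0) \<and> Q (1, 0, 0) \<and> Q (0, 1, 0) \<and> Q (1, 1, 0) \<and> Q (0, 0, 1) \<and> Q (1, 0, 1) \<and> Q (0, 1, 1) \<and> Q (1, 1, 1)" for Q
  proof -
    have all: "(\<forall>x. S x) \<longleftrightarrow> S 0 \<and> S 1" for S :: "'b \<Rightarrow> bool" using F2(4) by metis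
    show ?thesis unfolding split_paired_All all by blast
  qed
  let ?G = "SL 2 TYPE('a)" and ?H = "SL 3 TYPE('b)"
  interpret G: group ?G by (rule group_SL)
  interpret H: group ?H by (rule group_SL)
  define R where "R = {(g, h). g \<in> carrier ?G \<and> h \<in> carrier ?H \<and> (\<exists>t. linked g h t)}"
  have RI: "(g, h) \<in> R" if "g \<in> carrier ?G" "h \<in> carrier ?H"
    "\<forall>x. proportional (act2 g (?P x)) (?P (plus3 (act3 h x) t))" for g h t
    using that unfolding R_def linked_def by blast
  have plus3_self: "plus3 (plus3 x t) t = x" for x t :: "'b \<times> 'b \<times> 'b"
  proof -
    have "s + s = 0" for s :: 'b using F2(3)[of s] by (metis add.right_inverse)
    then show ?thesis by (cases x; cases t) (simp add: plus3_def add.assoc)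
  qed
  have R: "subgroup R (?G \<times>\<times> ?H)"
  proof (rule group.subgroupI[OF DirProd_group[OF G.is_group H.is_group]])
    show "R \<subseteq> carrier (?G \<times>\<times> ?H)" by (auto simp: R_def)
    have "(\<one>\<^bsub>?G\<^esub>, \<one>\<^bsub>?H\<^esub>) \<in> R"
    proof (rule RI[where t = "(0, 0, 0)"])
      have "plus3 x (0, 0, 0) = x" for x :: "'b \<times> 'b \<times> 'b" by (cases x) (simp add: plus3_def)
      then show "\<forall>x. proportional (act2 \<one>\<^bsub>?G\<^esub> (?P x)) (?P (plus3 (act3 \<one>\<^bsub>?H\<^esub> x) (0, 0, 0)))"
        by (simp add: act2_one act3_one proportional_refl del: mat2_arith)
    qed simp_all
    then show "R \<noteq> {}" by blast
  next
    fix r assume "r \<in> R"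
    then obtain g h t where r: "r = (g, h)" and g: "g \<in> carrier ?G" and h: "h \<in> carrier ?H"
      and t: "\<And>x. proportional (act2 g (?P x)) (?P (plus3 (act3 h x) t))" unfolding R_def linked_def by blast
    let ?g = "inv\<^bsub>?G\<^esub> g" and ?h = "inv\<^bsub>?H\<^esub> h"
    have gC: "?g \<in> carrier_mat 2 2" "g \<in> carrier_mat 2 2" "?g * g = 1\<^sub>m 2"
      using G.inv_closed[OF g] g G.l_inv[OF g] by simp_all
    have hC: "?h \<in> carrier_mat 3 3" "h \<in> carrier_mat 3 3" "h * ?h = 1\<^sub>m 3"
      using H.inv_closed[OF h] h H.r_inv[OF h] by simp_all
    have "(?g, ?h) \<in> R"
    \<comment> \<open>The inverse affine map has translation part \<open>- inv h t\<close>, and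
      signs disappear over two elements.\<close>
    proof (rule RI[OF G.inv_closed[OF g] H.inv_closed[OF h], where t = "act3 ?h t"], rule allI)
      fix x
      let ?y = "plus3 (act3 ?h x) (act3 ?h t)"
      have "act3 h ?y = plus3 x t"
        using hC by (simp add: act3_plus3 act3_one flip: act3_mult)
      then have "plus3 (act3 h ?y) t = x" by (simp add: plus3_self)
      then have "proportional (act2 ?g (act2 g (?P ?y))) (act2 ?g (?P x))"
        using t[of ?y] by (intro proportional_act2) simp
      moreover have "act2 ?g (act2 g (?P ?y)) = ?P ?y"
        unfolding act2_mult[OF gC(1,2), symmetric] gC(3) by (rule act2_one)
      ultimately show "proportional (act2 ?g (?P x)) (?P ?y)" by (simp add: proportional_sym)
    qed
    then show "inv\<^bsub>?G \<times>\<times> ?H\<^esub> r \<in> R" using g h by (simp add: r inv_DirProd[OF G.is_group H.is_group] del: SL_simps)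
  next
    fix r r' assume "r \<in> R" "r' \<in> R"
    then obtain g h t g' h' t' where r: "r = (g, h)" "r' = (g', h')"
      and g: "g \<in> carrier ?G" "g' \<in> carrier ?G" and h: "h \<in> carrier ?H" "h' \<in> carrier ?H"
      and t: "\<And>x. proportional (act2 g (?P x)) (?P (plus3 (act3 h x) t))"
      and t': "\<And>x. proportional (act2 g' (?P x)) (?P (plus3 (act3 h' x) t'))" unfolding R_def linked_def by blast
    have "(g \<otimes>\<^bsub>?G\<^esub> g', h \<otimes>\<^bsub>?H\<^esub> h') \<in> R"
    \<comment> \<open>The composite is \<open>x \<mapsto> h (h' x + t') + t\<close>.\<close>
    proof (rule RI[OF G.m_closed[OF g] H.m_closed[OF h], where t = "plus3 (act3 h t') t"], rule allI)
      fix x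
      have "proportional (act2 g (act2 g' (?P x))) (act2 g (?P (plus3 (act3 h' x) t')))"
        by (rule proportional_act2[OF t'])
      from proportional_trans[OF this t]
      show "proportional (act2 (g \<otimes>\<^bsub>?G\<^esub> g') (?P x)) (?P (plus3 (act3 (h \<otimes>\<^bsub>?H\<^esub> h') x) (plus3 (act3 h t') t)))"
        using g h by (simp add: act2_mult act3_mult act3_plus3 plus3_assoc)
    qed
    then show "r \<otimes>\<^bsub>?G \<times>\<times> ?H\<^esub> r' \<in> R" by (simp add: r)
  qed
  note ev = act2_def act3_def plus3_def P F2 arith eq
  have unip: "\<exists>h. (g, h) \<in> R" if "g \<in> elementary_mats 2 {1}" for g
  proof -
    \<comment> \<open>A nonzero determinant over two elements is 1, so exhibiting an inverse is
      enough.\<close>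
    have det1: "det A = 1" if "A \<in> carrier_mat 3 3" "B \<in> carrier_mat 3 3" "B * A = 1\<^sub>m 3" for A B :: "'b mat"
      using arg_cong[OF that(3), of det] that(1,2) F2(4)[of "det A"] by (auto simp: det_mult[of _ 3])
    have "mat3 1 1 0 0 0 1 1 0 0 * mat3 0 0 1 1 0 1 0 1 0 = (1\<^sub>m 3 :: 'b mat)"
      by (rule mat3_eqI) (auto simp: index_mult_mat3 F2 simp del: index_mult_mat(1))
    then have det: "det (mat3 0 0 1 1 0 1 0 1 0 :: 'b mat) = 1" by (intro det1) simp_all
    \<comment> \<open>The origin labels the point at infinity, so \<open>t\<close> is the label of
      its image: infinity under \<open>x + 1\<close>, and the point 1 under
      \<open>x / (x + 1)\<close> below.\<close>
    have "(mat2 1 1 0 1, mat3 0 0 1 1 0 1 0 1 0) \<in> R"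
    proof (rule RI[where t = "(0, 0, 0)"])
      show "mat2 1 1 0 1 \<in> carrier ?G" by (simp)
      show "mat3 0 0 1 1 0 1 0 1 0 \<in> carrier ?H" by (simp add: det)
      show "\<forall>x. proportional (act2 (mat2 1 1 0 1) (?P x)) (?P (plus3 (act3 (mat3 0 0 1 1 0 1 0 1 0) x) (0, 0, 0)))"
        unfolding all3 by (simp add: ev e01, (intro conjI)?; (rule proportional_refl | rule proportionalI; simp add: ev e01))
    qed
    moreover
    have "mat3 0 1 0 0 0 1 1 1 0 * mat3 1 0 1 1 0 0 0 1 0 = (1\<^sub>m 3 :: 'b mat)"
      by (rule mat3_eqI) (auto simp: index_mult_mat3 F2 simp del: index_mult_mat(1))
    then have det: "det (mat3 1 0 1 1 0 0 0 1 0 :: 'b mat) = 1" by (intro det1) simp_all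
    have "(mat2 1 0 1 1, mat3 1 0 1 1 0 0 0 1 0) \<in> R"
    proof (rule RI[where t = "(0, 1, 0)"])
      show "mat2 1 0 1 1 \<in> carrier ?G" by (simp)
      show "mat3 1 0 1 1 0 0 0 1 0 \<in> carrier ?H" by (simp add: det)
      show "\<forall>x. proportional (act2 (mat2 1 0 1 1) (?P x)) (?P (plus3 (act3 (mat3 1 0 1 1 0 0 0 1 0) x) (0, 1, 0)))"
        unfolding all3 by (simp add: ev e01, (intro conjI)?; (rule proportional_refl | rule proportionalI; simp add: ev e01))
    qed
    ultimately show ?thesis using that unfolding elementary_mats_2 by blast
  qed
  have elem: "\<exists>g. (g, h) \<in> R" if h: "h \<in> elementary_mats 3 {1}" for h
  proof -
    have E: "addrow_mat 3 1 0 (Suc 0) = (mat3 1 1 0 0 1 0 0 0 1 :: 'b mat)" "addrow_mat 3 1 0 2 = (mat3 1 0 1 0 1 0 0 0 1 :: 'b mat)"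
      "addrow_mat 3 1 (Suc 0) 0 = (mat3 1 0 0 1 1 0 0 0 1 :: 'b mat)" "addrow_mat 3 1 (Suc 0) 2 = (mat3 1 0 0 0 1 1 0 0 1 :: 'b mat)"
      "addrow_mat 3 1 2 0 = (mat3 1 0 0 0 1 0 1 0 1 :: 'b mat)" "addrow_mat 3 1 2 (Suc 0) = (mat3 1 0 0 0 1 0 0 1 1 :: 'b mat)"
      by - (rule mat3_eqI; simp; (elim disjE)?; simp)+
    \<comment> \<open>Transvections over two elements are involutions; accordingly their partners
      have trace 0 and determinant 1, hence square \<open>- 1\<close>. Again \<open>t\<close> is the
      label of the image of infinity.\<close>
    let ?table = "[(0, 1, mat2 (e 3) (e 1) (e 4) (e 4), (1, 0, 1)),
        (0, 2, mat2 (e 3) (e 4) (e 1) (e 4), (1, 1, 0)),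
        (1, 0, mat2 (e 3) (e 3) (e 6) (e 4), (0, 1, 1)),
        (1, 2, mat2 (e 0) (e 2) (e 3) (e 0), (1, 0, 0)),
        (2, 0, mat2 (e 3) (e 6) (e 3) (e 4), (0, 1, 0)),
        (2, 1, mat2 (e 0) (e 3) (e 2) (e 0), (1, 0, 0))]
        :: (nat \<times> nat \<times> 'a mat \<times> 'b \<times> 'b \<times> 'b) list"
    have "list_all (\<lambda>(k, l, g, t). linked g (addrow_mat 3 1 k l) t) ?table"
      unfolding linked_def all3
      by (simp add: E ev e01, (intro conjI)?; (rule proportional_refl | rule proportionalI; simp add: ev e01))
    moreover have "list_all (\<lambda>(k, l, g, t). g \<in> carrier ?G) ?table"
      by (simp add: arith eq e01)
    moreover obtain k l where kl: "h = addrow_mat 3 1 k l" "k < 3" "l < 3" "k \<noteq> l"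
      using h unfolding elementary_mats_def by blast
    then have "(k, l) \<in> (\<lambda>(k, l, g, t). (k, l)) ` set ?table"
      by (auto simp: less_3_iff)
    ultimately obtain g t where "g \<in> carrier ?G" "linked g h t"
      unfolding list_all_iff kl(1) by fastforce
    moreover have "h \<in> carrier ?H" unfolding kl(1) by (rule addrow_mat_in_SL[OF kl(2,3,4)])
    ultimately show ?thesis unfolding R_def by blast
  qed
  have genG: "carrier ?G = generate ?G (elementary_mats 2 {1})"
  proof (rule SL_generated_by_additive_generators)
    fix X :: "'a set" assume X0: "0 \<in> X" and X: "\<And>x a. x \<in> X \<Longrightarrow> a \<in> {1} \<Longrightarrow> x + a \<in> X"
    show "X = UNIV" by (rule prime_field_additive_generator[OF p card7 X0], erule (1) X)
  qed
  have genH: "carrier ?H = generate ?H (elementary_mats 3 {1})"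
  proof (rule SL_generated_by_additive_generators)
    fix X :: "'b set" assume X0: "0 \<in> X" and X: "\<And>x a. x \<in> X \<Longrightarrow> a \<in> {1} \<Longrightarrow> x + a \<in> X"
    show "X = UNIV" by (rule prime_field_additive_generator[OF two_is_prime_nat card2 X0], erule (1) X)
  qed
  have proj: "fst ` R = carrier ?G" "snd ` R = carrier ?H"
    by (rule generated_projections[OF G.is_group H.is_group R genG unip genH elem]; assumption)+
  have plus3_0: "plus3 x (0, 0, 0) = x" for x :: "'b \<times> 'b \<times> 'b" by (cases x) (simp add: plus3_def)
  have "{g. (g, \<one>\<^bsub>?H\<^esub>) \<in> R} = group_center ?G"
  proof (intro equalityI subsetI)
    fix g assume "g \<in> {g. (g, \<one>\<^bsub>?H\<^esub>) \<in> R}"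
    then obtain t where g: "g \<in> carrier ?G" and t: "\<And>x. proportional (act2 g (?P x)) (?P (plus3 x t))"
      unfolding R_def linked_def by (auto simp: act3_one)
    obtain a b c d where geq: "g = mat2 a b c d" using g by (auto elim: mat2_cases)
    have det: "a * d - b * c = 1" using g by (simp add: geq)
    have cross: "(a * e x + b * e y) * e y' = (c * e x + d * e y) * e x'"
      if "?P v = (e x, e y)" "?P (plus3 v t) = (e x', e y')" for v x y x' y'
      using proportional_cross t[of v] that by (simp add: act2_def geq)
    have no_swap: False if "a = c * q" "c * q + d = 0" "c = 0" for q
      using that det by simp
    \<comment> \<open>Translation by \<open>t\<close> exchanges the origin with \<open>t\<close>, so
      \<open>g\<close> exchanges infinity with the point labelled by \<open>t\<close>. Each case
      names two further pairs with different values in \<open>swap_image_of_infinity\<close>; then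
      \<open>c = 0\<close>, hence \<open>a = d = 0\<close>, against the determinant.\<close>
    have "t = (0, 0, 0)"
    proof (rule ccontr)
      assume "t \<noteq> (0, 0, 0)"
      moreover have "\<forall>u :: 'b \<times> 'b \<times> 'b. u \<noteq> (0, 0, 0) \<longrightarrow> u = (1, 0, 0) \<or> u = (0, 1, 0) \<or> u = (0, 0, 1) \<or> u = (1, 1, 0) \<or> u = (0, 1, 1) \<or> u = (1, 1, 1) \<or> u = (1, 0, 1)"
        unfolding all3 by simp
      ultimately consider "t = (1, 0, 0)" | "t = (0, 1, 0)" | "t = (0, 0, 1)" | "t = (1, 1, 0)" | "t = (0, 1, 1)" | "t = (1, 1, 1)" | "t = (1, 0, 1)"
        by blast
      then show False
      proof cases
        case 1
        have q1: "a = c * e 0" using cross[of "(0, 0, 0)" 1 0 0 1] by (simp add: ev 1 flip: e01)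
        have q2: "c * e 0 + d = 0" using cross[of "(1, 0, 0)" 0 1 1 0] by (simp add: ev 1 flip: e01)
        have "a * e 4 + b = (c * e 4 + d) * e 5" using cross[of "(0, 1, 1)" 4 1 5 1] by (simp add: ev 1 flip: e01)
        moreover have "a * e 2 + b = (c * e 2 + d) * e 6" using cross[of "(0, 0, 1)" 2 1 6 1] by (simp add: ev 1 flip: e01)
        ultimately have "c = 0" by (rule swap_image_of_infinity[OF q1 q2]) (simp add: arith eq)
        then show False by (rule no_swap[OF q1 q2])
      next
        case 2
        have q1: "a = c * e 1" using cross[of "(0, 0, 0)" 1 0 1 1] by (simp add: ev 2 flip: e01)
        have q2: "c * e 1 + d = 0" using cross[of "(0, 1, 0)" 1 1 1 0] by (simp add: ev 2 flip: e01)
        have "a * e 6 + b = (c * e 6 + d) * e 5" using cross[of "(1, 0, 1)" 6 1 5 1] by (simp add: ev 2 flip: e01)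
        moreover have "a * e 2 + b = (c * e 2 + d) * e 4" using cross[of "(0, 0, 1)" 2 1 4 1] by (simp add: ev 2 flip: e01)
        ultimately have "c = 0" by (rule swap_image_of_infinity[OF q1 q2]) (simp add: arith eq)
        then show False by (rule no_swap[OF q1 q2])
      next
        case 3
        have q1: "a = c * e 2" using cross[of "(0, 0, 0)" 1 0 2 1] by (simp add: ev 3 flip: e01)
        have q2: "c * e 2 + d = 0" using cross[of "(0, 0, 1)" 2 1 1 0] by (simp add: ev 3 flip: e01)
        have "a * e 3 + b = (c * e 3 + d) * e 5" using cross[of "(1, 1, 0)" 3 1 5 1] by (simp add: ev 3 flip: e01)
        moreover have "a * e 1 + b = (c * e 1 + d) * e 4" using cross[of "(0, 1, 0)" 1 1 4 1] by (simp add: ev 3 flip: e01)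
        ultimately have "c = 0" by (rule swap_image_of_infinity[OF q1 q2]) (simp add: arith eq)
        then show False by (rule no_swap[OF q1 q2])
      next
        case 4
        have q1: "a = c * e 3" using cross[of "(0, 0, 0)" 1 0 3 1] by (simp add: ev 4 flip: e01)
        have q2: "c * e 3 + d = 0" using cross[of "(1, 1, 0)" 3 1 1 0] by (simp add: ev 4 flip: e01)
        have "a * e 6 + b = (c * e 6 + d) * e 4" using cross[of "(1, 0, 1)" 6 1 4 1] by (simp add: ev 4 flip: e01)
        moreover have "a * e 2 + b = (c * e 2 + d) * e 5" using cross[of "(0, 0, 1)" 2 1 5 1] by (simp add: ev 4 flip: e01)
        ultimately have "c = 0" by (rule swap_image_of_infinity[OF q1 q2]) (simp add: arith eq)
        then show False by (rule no_swap[OF q1 q2])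
      next
        case 5
        have q1: "a = c * e 4" using cross[of "(0, 0, 0)" 1 0 4 1] by (simp add: ev 5 flip: e01)
        have q2: "c * e 4 + d = 0" using cross[of "(0, 1, 1)" 4 1 1 0] by (simp add: ev 5 flip: e01)
        have "a * e 3 + b = (c * e 3 + d) * e 6" using cross[of "(1, 1, 0)" 3 1 6 1] by (simp add: ev 5 flip: e01)
        moreover have "a * e 1 + b = (c * e 1 + d) * e 2" using cross[of "(0, 1, 0)" 1 1 2 1] by (simp add: ev 5 flip: e01)
        ultimately have "c = 0" by (rule swap_image_of_infinity[OF q1 q2]) (simp add: arith eq)
        then show False by (rule no_swap[OF q1 q2])
      next
        case 6
        have q1: "a = c * e 5" using cross[of "(0, 0, 0)" 1 0 5 1] by (simp add: ev 6 flip: e01)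
        have q2: "c * e 5 + d = 0" using cross[of "(1, 1, 1)" 5 1 1 0] by (simp add: ev 6 flip: e01)
        have "a * e 3 + b = (c * e 3 + d) * e 2" using cross[of "(1, 1, 0)" 3 1 2 1] by (simp add: ev 6 flip: e01)
        moreover have "a * e 1 + b = (c * e 1 + d) * e 6" using cross[of "(0, 1, 0)" 1 1 6 1] by (simp add: ev 6 flip: e01)
        ultimately have "c = 0" by (rule swap_image_of_infinity[OF q1 q2]) (simp add: arith eq)
        then show False by (rule no_swap[OF q1 q2])
      next
        case 7
        have q1: "a = c * e 6" using cross[of "(0, 0, 0)" 1 0 6 1] by (simp add: ev 7 flip: e01)
        have q2: "c * e 6 + d = 0" using cross[of "(1, 0, 1)" 6 1 1 0] by (simp add: ev 7 flip: e01)
        have "a * e 3 + b = (c * e 3 + d) * e 4" using cross[of "(1, 1, 0)" 3 1 4 1] by (simp add: ev 7 flip: e01)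
        moreover have "a * e 1 + b = (c * e 1 + d) * e 5" using cross[of "(0, 1, 0)" 1 1 5 1] by (simp add: ev 7 flip: e01)
        ultimately have "c = 0" by (rule swap_image_of_infinity[OF q1 q2]) (simp add: arith eq)
        then show False by (rule no_swap[OF q1 q2])
      qed
    qed
    note t0 = this
    \<comment> \<open>Now \<open>g\<close> fixes infinity, 0 and 1, hence is scalar.\<close>
    have "c = 0" using cross[of "(0, 0, 0)" 1 0 1 0] by (simp add: ev t0 flip: e01)
    moreover have "b = 0" using cross[of "(1, 0, 0)" 0 1 0 1] by (simp add: ev t0 flip: e01)
    moreover have "a + b = c + d" using cross[of "(0, 1, 0)" 1 1 1 1] by (simp add: ev t0 flip: e01)
    ultimately show "g \<in> group_center ?G" using det by (simp add: SL_2_center geq)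
  next
    fix g assume gz: "g \<in> group_center ?G"
    then obtain c where c: "g = mat2 c 0 0 c" "c * c = 1" by (auto simp: SL_2_center)
    have "c \<noteq> 0" using c(2) by auto
    then have "proportional (act2 g u) u" for u
      unfolding proportional_def c(1) by (intro exI[of _ c]) (cases u, simp add: act2_def)
    moreover have "g \<in> carrier ?G" using gz by (simp add: group_center_def)
    ultimately have "(g, \<one>\<^bsub>?H\<^esub>) \<in> R"
      using H.one_closed by (intro RI[where t = "(0, 0, 0)"]) (simp_all add: act3_one plus3_0)
    then show "g \<in> {g. (g, \<one>\<^bsub>?H\<^esub>) \<in> R}" by blast
  qed
  moreover have "{h. (\<one>\<^bsub>?G\<^esub>, h) \<in> R} = group_center ?H"
  proof (intro equalityI subsetI)
    fix h assume "h \<in> {h. (\<one>\<^bsub>?G\<^esub>, h) \<in> R}"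
    then obtain t where h: "h \<in> carrier ?H" and t: "\<And>x. proportional (?P x) (?P (plus3 (act3 h x) t))"
      unfolding R_def linked_def by (auto simp: act2_one simp del: mat2_arith)
    \<comment> \<open>Distinct triples label distinct points, so the affine map paired with the
      identity matrix is itself the identity.\<close>
    have "\<forall>x y. proportional (?P x) (?P y) \<longrightarrow> x = y"
      unfolding all3 by (auto dest!: proportional_cross simp: ev e01)
    then have fix_x: "plus3 (act3 h x) t = x" for x using t by metis
    have "t = (0, 0, 0)" using fix_x[of "(0, 0, 0)"] by (cases t) (simp add: act3_def plus3_def)
    then have e: "act3 h x = x" for x using fix_x[of x] plus3_0 by simp
    have "h = 1\<^sub>m 3"
      using e[of "(1, 0, 0)"] e[of "(0, 1, 0)"] e[of "(0, 0, 1)"] h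
      by (intro mat3_eqI) (auto simp: act3_def)
    also have "\<dots> = 1 \<cdot>\<^sub>m 1\<^sub>m 3" by (intro eq_matI) auto
    finally have "h = 1 \<cdot>\<^sub>m 1\<^sub>m 3" .
    then show "h \<in> group_center ?H" unfolding SL_center by (intro CollectI exI[of _ 1]) simp
  next
    fix h assume "h \<in> group_center ?H"
    then obtain c where c: "h = c \<cdot>\<^sub>m 1\<^sub>m 3" "c ^ 3 = 1" unfolding SL_center by blast
    moreover have "c = 1" using c(2) F2(4)[of c] by auto
    ultimately have "h = \<one>\<^bsub>?H\<^esub>" by (auto intro!: eq_matI)
    then show "h \<in> {h. (\<one>\<^bsub>?G\<^esub>, h) \<in> R}" using subgroup.one_closed[OF R] by simp
  qed
  ultimately show ?thesis
    using goursat_iso[OF G.is_group H.is_group R proj] by (simp add: PSL_def)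
qed

section \<open>The exceptional isomorphisms\<close>

theorem mainTheorem5:
  assumes "card (UNIV :: 'f2::field set) = 2"
    and "card (UNIV :: 'f3::field set) = 3"
    and "card (UNIV :: 'f4::field set) = 4"
    and "card (UNIV :: 'f5::field set) = 5"
    and "card (UNIV :: 'f7::field set) = 7"
    and "card (UNIV :: 'f9::field set) = 9"
  shows "(alt_group 5 \<cong> PSL 2 TYPE('f4) \<and> PSL 2 TYPE('f4) \<cong> PSL 2 TYPE('f5)) \<and>
    PSL 2 TYPE('f7) \<cong> PSL 3 TYPE('f2) \<and>
    (alt_group 6 \<cong> PSL 2 TYPE('f9) \<and>
      PSL 2 TYPE('f9) \<cong> derived_subgroup (type_B 2 TYPE('f2)) \<and>
      derived_subgroup (type_B 2 TYPE('f2)) \<cong> derived_subgroup (type_C 2 TYPE('f2))) \<and>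
    alt_group 8 \<cong> PSL 4 TYPE('f2) \<and>
    type_B 2 TYPE('f3) \<cong> type_C 2 TYPE('f3) \<and>
    type_B 2 TYPE('f2) \<cong> sym_group 6"
proof (intro conjI)
  have PSL: "group (PSL n TYPE('b))" for n and F :: "'b::field itself"
    unfolding PSL_def by (intro normal.factorgroup_is_group normal_group_center group_SL)
  have C: "group (type_C 2 TYPE('b))" for F :: "'b::field itself"
    unfolding type_C_def by (intro normal.factorgroup_is_group normal_group_center group_Sp_2)
  have B_C: "type_B 2 TYPE('b) \<cong> type_C 2 TYPE('b)" for F :: "'b::field itself"
    by (rule group.iso_sym[OF C type_C_2_iso_type_B_2(1)])
  show "alt_group 5 \<cong> PSL 2 TYPE('f4)"
    by (rule group.iso_sym[OF PSL PSL_2_4_iso[OF assms(3)]])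
  show "PSL 2 TYPE('f4) \<cong> PSL 2 TYPE('f5)"
    by (rule iso_trans[OF PSL_2_4_iso[OF assms(3)] group.iso_sym[OF PSL PSL_2_5_iso[OF assms(4)]]])
  show "PSL 2 TYPE('f7) \<cong> PSL 3 TYPE('f2)"
    by (rule PSL_2_7_iso_PSL_3_2[OF assms(5,1)])
  show "alt_group 6 \<cong> PSL 2 TYPE('f9)"
    by (rule group.iso_sym[OF PSL PSL_2_9_iso[OF assms(6)]])
  show "alt_group 8 \<cong> PSL 4 TYPE('f2)"
    by (rule group.iso_sym[OF PSL PSL_4_2_iso[OF assms(1)]])
  show "type_B 2 TYPE('f3) \<cong> type_C 2 TYPE('f3)"
    by (rule B_C)
  show B_S6: "type_B 2 TYPE('f2) \<cong> sym_group 6"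
    by (rule iso_trans[OF B_C type_C_2_2_iso[OF assms(1)]])
  \<comment> \<open>The derived subgroup of \<open>Sym_6\<close> is \<open>Alt_6\<close>, which
    connects \<open>PSL_2(9)\<close> with the derived subgroup of type B.\<close>
  have "derived_subgroup (sym_group 6) \<cong> derived_subgroup (type_B 2 TYPE('f2))"
    by (intro derived_subgroup_iso sym_group_is_group type_C_2_iso_type_B_2(2)
        group.iso_sym[OF _ B_S6])
  then show "PSL 2 TYPE('f9) \<cong> derived_subgroup (type_B 2 TYPE('f2))"
    using iso_trans[OF PSL_2_9_iso[OF assms(6)]] by (simp add: derived_subgroup_sym_group)
  show "derived_subgroup (type_B 2 TYPE('f2)) \<cong> derived_subgroup (type_C 2 TYPE('f2))"
    by (intro derived_subgroup_iso C type_C_2_iso_type_B_2(2) B_C)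
qed

end
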